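(* Let $\alpha\in(0,1)$ and let $L_t=\inf\{s>0:\sigma_s>t\}$, $t\ge0$, be the inverse process of an $\alpha$-stable subordinator $\sigma$. Let $X$ be an $m$-polynomial process on $S$, independent of $\sigma$, with extended generator $\mathcal{G}$, and let $A\in\mathbb{R}^{N\times N}$ be the matrix representation of $\mathcal{G}$ in a basis $H(x)$ of $\mathcal{P}_m$. For all $p\in\mathcal{P}_m$ and $x\in S$, $$\mathbb{E}_x[p(X_{L_t})]=H(x)^\top E_\alpha(t^\alpha A)\,\vec p,\quad t>0.$$
   Context: $S\subseteq\mathbb{R}^d$ is closed with nonempty interior. $\mathcal{P}_k$ is the finite-dimensional space of (restrictions to $S$ of) real polynomials of degree at most $k$; $N=\dim\mathcal{P}_m$. Given a basis $H=(h_1,\dots,h_N)^\top$ of $\mathcal{P}_m$, $\vec p\in\mathbb{R}^N$ denotes the coordinate vector of $p$, so $p(x)=H(x)^\top\vec p$. $X=(X_t)_{t\ge0}$ is an $S$-valued time-homogeneous càdlàg Markov process (without killing or explosion); $\mathbb{P}_x,\mathbb{E}_x$ refer to $X_0=x$. Its extended generator $\mathcal{G}$ has as domain the Borel functions $u:S\to\mathbb{R}$ for which there is a function $\mathcal{G}u$ such that $u(X_t)-u(x)-\int_0^t\mathcal{G}u(X_s)\,ds$, $t\ge0$, is a $\mathbb{P}_x$-local martingale for every $x\in S$. $X$ is $m$-polynomial if for all $k\in\{1,\dots,m\}$, $u\in\mathcal{P}_k$, $x\in S$ and $t\ge0$: $\mathbb{E}_x[|u(X_t)|]<\infty$, and $\mathcal{G}(\mathcal{P}_k)\subseteq\mathcal{P}_k$.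 The matrix $A$ is defined by $\mathcal{G}p(x)=H(x)^\top A\vec p$ for $p\in\mathcal{P}_m$. The $\alpha$-stable subordinator is the non-decreasing Lévy process with $\mathbb{E}[e^{-\lambda\sigma_s}]=e^{-s\lambda^\alpha}$, $s,\lambda>0$. The Mittag-Leffler function is the entire function $E_\alpha(z)=\sum_{k=0}^\infty\frac{z^k}{\Gamma(\alpha k+1)}$; for a square matrix it is evaluated by inserting the matrix into this power series.
   Formalization: For m=1 it is also assumed that u(X_t)-u(y)-∫_0^t Gu(X_s)ds is a true P_y-martingale for all u in P_1 and y in S, and for odd m that p(X_{L_t}) is P_x-integrable; without these assumptions the claim can fail. *)

theory Defs
  imports "HOL-Probability.Probability"
begin

section \<open>Polynomials on a subset of Euclidean space\<close>

text \<open>A function on \<open>S\<close> is represented by a function on the whole space of which only the values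
  on \<open>S\<close> matter: every equation between such functions is required on \<open>S\<close> only. The index set of
  the sum is finite, since \<open>'d\<close> is.\<close>

definition poly_space :: "(real ^ 'd) set \<Rightarrow> nat \<Rightarrow> (real ^ 'd \<Rightarrow> real) set" where
  "poly_space S k = {u. \<exists>c :: ('d \<Rightarrow> nat) \<Rightarrow> real. \<forall>x\<in>S.
     u x = (\<Sum>e | (\<Sum>i\<in>UNIV. e i) \<le> k. c e * (\<Prod>i\<in>UNIV. x $ i ^ e i))}"

text \<open>The components of \<open>H\<close> are the basis functions, so that \<open>CARD('n)\<close> is the dimension of \<open>V\<close>.\<close>

definition is_basis_on ::
  "(real ^ 'd) set \<Rightarrow> (real ^ 'd \<Rightarrow> real) set \<Rightarrow> (real ^ 'd \<Rightarrow> real ^ 'n) \<Rightarrow> bool" where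
  "is_basis_on S V H \<longleftrightarrow>
     (\<forall>i. (\<lambda>x. H x $ i) \<in> V) \<and>
     (\<forall>p\<in>V. \<exists>c. \<forall>x\<in>S. p x = H x \<bullet> c) \<and>
     (\<forall>c. (\<forall>x\<in>S. H x \<bullet> c = 0) \<longrightarrow> c = 0)"

definition coords ::
  "(real ^ 'd) set \<Rightarrow> (real ^ 'd \<Rightarrow> real ^ 'n) \<Rightarrow> (real ^ 'd \<Rightarrow> real) \<Rightarrow> real ^ 'n" where
  "coords S H p = (THE c. \<forall>x\<in>S. p x = H x \<bullet> c)"


section \<open>Mittag-Leffler function of a matrix\<close>

text \<open>On \<open>real ^ 'n ^ 'n\<close> the operations \<open>*\<close> and \<open>^\<close> are not the matrix product and its powers.\<close>

primrec matrix_pow :: "real ^ 'n ^ 'n \<Rightarrow> nat \<Rightarrow> real ^ 'n ^ 'n" where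
  "matrix_pow B 0 = mat 1"
| "matrix_pow B (Suc k) = B ** matrix_pow B k"

definition mittag_leffler_matrix :: "real \<Rightarrow> real ^ 'n ^ 'n \<Rightarrow> real ^ 'n ^ 'n" where
  "mittag_leffler_matrix \<alpha> B = (\<Sum>k. (1 / Gamma (\<alpha> * real k + 1)) *\<^sub>R matrix_pow B k)"


section \<open>Paths and martingales\<close>

text \<open>Processes are indexed by all reals; their values at negative times are irrelevant.\<close>

definition cadlag :: "(real \<Rightarrow> 'b::topological_space) \<Rightarrow> bool" where
  "cadlag f \<longleftrightarrow> (\<forall>t\<ge>0. continuous (at_right t) f) \<and> (\<forall>t>0. \<exists>l. (f \<longlongrightarrow> l) (at_left t))"

definition martingale ::
  "'w measure \<Rightarrow> (real \<Rightarrow> 'w measure) \<Rightarrow> (real \<Rightarrow> 'w \<Rightarrow> real) \<Rightarrow> bool" where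
  "martingale Q F Y \<longleftrightarrow>
     (\<forall>t\<ge>0. Y t \<in> borel_measurable (F t) \<and> integrable Q (Y t)) \<and>
     (\<forall>s\<ge>0. \<forall>t\<ge>s. AE \<omega> in Q. real_cond_exp Q (F s) (Y t) \<omega> = Y s \<omega>)"

text \<open>Real-valued localizing times are no restriction, since a stopping time \<open>\<tau> n\<close> with values in
  \<open>[0, \<infinity>]\<close> may be replaced by its minimum with \<open>n\<close>.\<close>

definition local_martingale ::
  "'w measure \<Rightarrow> (real \<Rightarrow> 'w measure) \<Rightarrow> (real \<Rightarrow> 'w \<Rightarrow> real) \<Rightarrow> bool" where
  "local_martingale Q F Y \<longleftrightarrow> (\<exists>\<tau> :: nat \<Rightarrow> 'w \<Rightarrow> real.
     (\<forall>n. stopping_time F (\<tau> n) \<and> (\<forall>\<omega>\<in>space Q. 0 \<le> \<tau> n \<omega>)) \<and>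
     (AE \<omega> in Q. incseq (\<lambda>n. \<tau> n \<omega>) \<and> filterlim (\<lambda>n. \<tau> n \<omega>) at_top sequentially) \<and>
     (\<forall>n. martingale Q F (\<lambda>t \<omega>. Y (min t (\<tau> n \<omega>)) \<omega>)))"


section \<open>Markov processes and their extended generator\<close>

locale cadlag_markov_process =
  fixes S :: "(real ^ 'd) set"
    and \<Omega> :: "'w measure"
    and F :: "real \<Rightarrow> 'w measure"
    and P :: "real ^ 'd \<Rightarrow> 'w measure"
    and X :: "real \<Rightarrow> 'w \<Rightarrow> real ^ 'd"
  assumes prob_space_P: "x \<in> S \<Longrightarrow> prob_space (P x)"
    and sets_P: "x \<in> S \<Longrightarrow> sets (P x) = sets \<Omega>"
    and filtration_F: "filtration (space \<Omega>) F"
    and subalgebra_F: "subalgebra \<Omega> (F t)"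
    and adapted: "t \<ge> 0 \<Longrightarrow> X t \<in> borel_measurable (F t)"
    and state_space: "\<lbrakk>t \<ge> 0; \<omega> \<in> space \<Omega>\<rbrakk> \<Longrightarrow> X t \<omega> \<in> S"
    and cadlag_paths: "\<omega> \<in> space \<Omega> \<Longrightarrow> cadlag (\<lambda>t. X t \<omega>)"
    and initial: "x \<in> S \<Longrightarrow> AE \<omega> in P x. X 0 \<omega> = x"
    and kernel_measurable: "\<lbrakk>t \<ge> 0; B \<in> sets borel\<rbrakk> \<Longrightarrow>
      (\<lambda>y. measure (P y) {\<omega> \<in> space \<Omega>. X t \<omega> \<in> B}) \<in> borel_measurable (restrict_space borel S)"
    and markov: "\<lbrakk>x \<in> S; s \<ge> 0; t \<ge> 0; B \<in> sets borel\<rbrakk> \<Longrightarrow>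
      AE \<omega> in P x. real_cond_exp (P x) (F s) (indicator {\<omega> \<in> space \<Omega>. X (s + t) \<omega> \<in> B}) \<omega> =
        measure (P (X s \<omega>)) {\<omega>' \<in> space \<Omega>. X t \<omega>' \<in> B}"

definition dynkin_process ::
  "(real \<Rightarrow> 'w \<Rightarrow> real ^ 'd) \<Rightarrow> real ^ 'd \<Rightarrow> (real ^ 'd \<Rightarrow> real) \<Rightarrow> (real ^ 'd \<Rightarrow> real) \<Rightarrow> real \<Rightarrow> 'w \<Rightarrow> real"
  where
  "dynkin_process X x u v = (\<lambda>t \<omega>. u (X t \<omega>) - u x - (LBINT s:{0..t}. v (X s \<omega>)))"

text \<open>\<open>v\<close> is a version of the extended generator applied to \<open>u\<close>.\<close>

definition generator_version ::
  "(real ^ 'd) set \<Rightarrow> (real \<Rightarrow> 'w measure) \<Rightarrow> (real ^ 'd \<Rightarrow> 'w measure) \<Rightarrow> (real \<Rightarrow> 'w \<Rightarrow> real ^ 'd) \<Rightarrow>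
   (real ^ 'd \<Rightarrow> real) \<Rightarrow> (real ^ 'd \<Rightarrow> real) \<Rightarrow> bool" where
  "generator_version S F P X u v \<longleftrightarrow>
     v \<in> borel_measurable (restrict_space borel S) \<and>
     (\<forall>x\<in>S. (AE \<omega> in P x. \<forall>t\<ge>0. set_integrable lborel {0..t} (\<lambda>s. v (X s \<omega>))) \<and>
            local_martingale (P x) F (dynkin_process X x u v))"

definition generator_domain ::
  "(real ^ 'd) set \<Rightarrow> (real \<Rightarrow> 'w measure) \<Rightarrow> (real ^ 'd \<Rightarrow> 'w measure) \<Rightarrow> (real \<Rightarrow> 'w \<Rightarrow> real ^ 'd) \<Rightarrow>
   (real ^ 'd \<Rightarrow> real) set" where
  "generator_domain S F P X =
     {u \<in> borel_measurable (restrict_space borel S). \<exists>v. generator_version S F P X u v}"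

text \<open>The function \<open>v\<close> above is determined by \<open>u\<close> only up to a set of potential zero, so an
  extended generator is a choice of versions. Continuous versions are unique on \<open>S\<close>.\<close>

definition extended_generator ::
  "(real ^ 'd) set \<Rightarrow> (real \<Rightarrow> 'w measure) \<Rightarrow> (real ^ 'd \<Rightarrow> 'w measure) \<Rightarrow> (real \<Rightarrow> 'w \<Rightarrow> real ^ 'd) \<Rightarrow>
   ((real ^ 'd \<Rightarrow> real) \<Rightarrow> (real ^ 'd \<Rightarrow> real)) \<Rightarrow> bool" where
  "extended_generator S F P X G \<longleftrightarrow>
     (\<forall>u\<in>generator_domain S F P X. generator_version S F P X u (G u))"

definition m_polynomial ::
  "nat \<Rightarrow> (real ^ 'd) set \<Rightarrow> (real \<Rightarrow> 'w measure) \<Rightarrow> (real ^ 'd \<Rightarrow> 'w measure) \<Rightarrow>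
   (real \<Rightarrow> 'w \<Rightarrow> real ^ 'd) \<Rightarrow> ((real ^ 'd \<Rightarrow> real) \<Rightarrow> (real ^ 'd \<Rightarrow> real)) \<Rightarrow> bool" where
  "m_polynomial m S F P X G \<longleftrightarrow>
     (\<forall>k\<in>{1..m}. \<forall>u\<in>poly_space S k.
        (\<forall>x\<in>S. \<forall>t\<ge>0. integrable (P x) (\<lambda>\<omega>. u (X t \<omega>))) \<and>
        u \<in> generator_domain S F P X \<and> G u \<in> poly_space S k)"


section \<open>Stable subordinators and their inverse\<close>

definition levy_process :: "'w measure \<Rightarrow> (real \<Rightarrow> 'w \<Rightarrow> real) \<Rightarrow> bool" where
  "levy_process Q Z \<longleftrightarrow>
     (\<forall>t\<ge>0. Z t \<in> borel_measurable Q) \<and>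
     (\<forall>\<omega>\<in>space Q. cadlag (\<lambda>t. Z t \<omega>)) \<and>
     (AE \<omega> in Q. Z 0 \<omega> = 0) \<and>
     (\<forall>n (r :: nat \<Rightarrow> real). 0 \<le> r 0 \<and> incseq r \<longrightarrow>
        prob_space.indep_vars Q (\<lambda>_. borel) (\<lambda>i \<omega>. Z (r (Suc i)) \<omega> - Z (r i) \<omega>) {..<n}) \<and>
     (\<forall>s\<ge>0. \<forall>t\<ge>s. distr Q borel (\<lambda>\<omega>. Z t \<omega> - Z s \<omega>) = distr Q borel (Z (t - s)))"

definition stable_subordinator :: "real \<Rightarrow> 'w measure \<Rightarrow> (real \<Rightarrow> 'w \<Rightarrow> real) \<Rightarrow> bool" where
  "stable_subordinator \<alpha> Q \<sigma> \<longleftrightarrow>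
     levy_process Q \<sigma> \<and>
     (\<forall>\<omega>\<in>space Q. mono_on {0..} (\<lambda>t. \<sigma> t \<omega>)) \<and>
     (\<forall>s>0. \<forall>l>0. (LINT \<omega>|Q. exp (- (l * \<sigma> s \<omega>))) = exp (- (s * l powr \<alpha>)))"

text \<open>For a stable subordinator the set is almost surely nonempty; the value \<open>0\<close> on the
  exceptional event only keeps \<open>inverse_process \<sigma> t\<close> measurable and nonnegative there.\<close>

definition inverse_process :: "(real \<Rightarrow> 'w \<Rightarrow> real) \<Rightarrow> real \<Rightarrow> 'w \<Rightarrow> real" where
  "inverse_process \<sigma> t \<omega> = (if \<exists>s>0. \<sigma> s \<omega> > t then Inf {s. s > 0 \<and> \<sigma> s \<omega> > t} else 0)"

definition independent_processes ::
  "'w measure \<Rightarrow> (real \<Rightarrow> 'w \<Rightarrow> 'b::topological_space) \<Rightarrow> (real \<Rightarrow> 'w \<Rightarrow> 'c::topological_space) \<Rightarrow> bool"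
  where
  "independent_processes Q Y Z \<longleftrightarrow>
     prob_space.indep_set Q
       (sets (vimage_algebra (space Q) (\<lambda>\<omega>. \<lambda>t\<in>{0..}. Y t \<omega>) (PiM {0..} (\<lambda>_. borel))))
       (sets (vimage_algebra (space Q) (\<lambda>\<omega>. \<lambda>t\<in>{0..}. Z t \<omega>) (PiM {0..} (\<lambda>_. borel))))"

end

theory Submission
  imports Defs
begin

text \<open>Conditioning on the clock \<open>L\<^sub>t\<close>, which is independent of \<open>X\<close>, splits the statement into two
  computations. For the process, the moments evolve by the matrix exponential,
  \<open>E\<^sub>x[p(X\<^sub>s)] = \<Sum>k. s\<^sup>k / k! \<cdot> H(x)\<bullet>A\<^sup>k c\<close> with \<open>c\<close> the coordinates of \<open>p\<close> (lemma
  \<open>moment_power_series\<close>). For the clock, \<open>E[L\<^sub>t\<^sup>k] = t\<^bsup>\<alpha>k\<^esup> k! / \<Gamma>(\<alpha>k + 1)\<close>, and all exponential moments are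
  finite (\<open>moment_clock\<close>, \<open>integrable_exp_clock\<close>). Integrating the first series against the law of the
  clock (\<open>independent_time_change\<close>, \<open>expectation_clock_power_series\<close>) replaces \<open>s\<^sup>k / k!\<close> by
  \<open>t\<^bsup>\<alpha>k\<^esup> / \<Gamma>(\<alpha>k + 1)\<close>, which is the series of the Mittag-Leffler function at \<open>t\<^sup>\<alpha> A\<close>.

  The clock: \<open>L\<^sub>t > s\<close> means \<open>\<sigma>\<^sub>s \<le> t\<close> up to a single \<open>s\<close>, so moments of \<open>L\<^sub>t\<close> are integrals of
  \<open>P(\<sigma>\<^sub>s \<le> t)\<close>. The Laplace transform of \<open>\<sigma>\<close> gives self-similarity, hence
  \<open>E[L\<^sub>t\<^sup>k] = t\<^bsup>\<alpha>k\<^esup> E[L\<^sub>1\<^sup>k]\<close>, and one integration against \<open>e\<^bsup>-t\<^esup>\<close> identifies the constant.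

  The process: the moment series comes from iterating
  \<open>E\<^sub>x[u(X\<^sub>t)] = u(x) + \<integral>\<^sub>0\<^sup>t E\<^sub>x[G u(X\<^sub>s)] ds\<close> (\<open>moment_formula\<close>), and the work lies in this formula,
  since \<open>G\<close> provides local martingales only and \<open>u\<close> is of top degree \<open>m\<close>: no integrable function
  of higher degree is at hand to control it. For \<open>m = 1\<close> the martingale property is a hypothesis, and a
  pathwise Gronwall argument makes the time integral integrable. For \<open>m \<ge> 2\<close> the square of the norm
  grows at most exponentially in mean (\<open>dynkin_exponential_bound\<close>); this gives the formula in degree
  one (\<open>dynkin_formula_affine\<close>), by Fatou's lemma applied to \<open>\<epsilon>f \<plusminus> u\<close> with \<open>f\<close> quadratic. The first
  moments therefore solve a linear differential equation, which can be run backwards in time: the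
  weight \<open>w(x) = 1 + \<Sum>\<bar>x\<^sub>i\<bar>\<close> satisfies \<open>w(y) \<le> e\<^bsup>Ct\<^esup> E\<^sub>y[w(X\<^sub>t)]\<close> (\<open>weight_submean\<close>). By Jensen's
  inequality the same holds for \<open>w\<^sup>m\<close>, so \<open>w\<^sup>m\<close> at a stopping time before \<open>t\<close> is dominated by \<open>w\<^sup>m\<close> at
  the fixed time \<open>t\<close> (\<open>stopped_domination\<close>). That is the uniform integrability which removes the
  localization in degree \<open>m\<close> (\<open>dynkin_formula_dominated\<close>).\<close>

section \<open>Gronwall inequalities and iterated integrals\<close>

lemma set_integral_point: "(LBINT s:{a}. f s) = (0 :: real)"
proof -
  have "AE s in lborel. indicator {a} s *\<^sub>R f s = 0"
    using AE_lborel_singleton[of a] by eventually_elim (simp add: indicator_def)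
  then have "(\<integral>s. indicator {a} s *\<^sub>R f s \<partial>lborel) = 0" by (rule integral_eq_zero_AE)
  then show ?thesis by (simp add: set_lebesgue_integral_def)
qed

lemma set_integral_abs_le:
  fixes f :: "real \<Rightarrow> real"
  assumes f: "set_integrable lborel {0..t} f" and r: "r \<le> t"
  shows "\<bar>LBINT s:{0..r}. f s\<bar> \<le> (LBINT s:{0..t}. \<bar>f s\<bar>)"
proof -
  have fr: "set_integrable lborel {0..r} f"
    by (rule set_integrable_subset[OF f]) (use r in auto)
  have "\<bar>LBINT s:{0..r}. f s\<bar> \<le> (LBINT s:{0..r}. \<bar>f s\<bar>)"
    using set_integral_norm_bound[OF fr] by simp
  also have "\<dots> \<le> (LBINT s:{0..t}. \<bar>f s\<bar>)"
    unfolding set_lebesgue_integral_def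
    using set_integrable_abs[OF fr] set_integrable_abs[OF f] r
    by (intro integral_mono) (auto simp: set_integrable_def indicator_def)
  finally show ?thesis .
qed

lemma set_integrable_bounded:
  fixes f :: "real \<Rightarrow> real"
  assumes "f \<in> borel_measurable borel" "\<And>s. \<lbrakk>0 \<le> s; s \<le> t\<rbrakk> \<Longrightarrow> \<bar>f s\<bar> \<le> B"
  shows "set_integrable lborel {0..t} f"
proof (rule set_integrable_bound)
  show "set_integrable lborel {0..t} (\<lambda>_. B)"
    by (intro borel_integrable_atLeastAtMost' continuous_on_const)
  show "set_borel_measurable lborel {0..t} f"
    using assms(1) by (simp add: set_borel_measurable_def)
  have "\<bar>f s\<bar> \<le> \<bar>B\<bar>" if "0 \<le> s" "s \<le> t" for s using assms(2)[OF that] by simp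
  then show "AE s in lborel. s \<in> {0..t} \<longrightarrow> norm (f s) \<le> norm B" by simp
qed

text \<open>Gronwall's inequality, linear in \<open>k\<close>: the inhomogeneous term will be the path of a martingale, of
  which the expectation is known but not that of its absolute value.\<close>

lemma gronwall_set_integral:
  fixes v k :: "real \<Rightarrow> real"
  assumes T: "0 \<le> T" and C: "0 \<le> C"
    and v: "set_integrable lborel {0..T} v" and k: "set_integrable lborel {0..T} k"
    and le: "\<And>s. \<lbrakk>0 \<le> s; s \<le> T\<rbrakk> \<Longrightarrow> v s \<le> k s + C * (LBINT r:{0..s}. v r)"
  shows "(LBINT s:{0..T}. v s) \<le> (LBINT s:{0..T}. exp (C * (T - s)) * k s)"
proof -
  \<comment> \<open>Integrating the hypothesis against \<open>e\<^bsup>C(T - s)\<^esup>\<close> produces a double integral of \<open>W\<close>; by Fubini it equals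
    the integral of \<open>(e\<^bsup>C(T - r)\<^esup> - 1) v(r)\<close>, so that the exponentially weighted terms in \<open>v\<close> cancel.\<close>
  define v' where "v' r = indicator {0..T} r * v r" for r :: real
  define W where "W s r = (indicator {0..T} s * exp (C * (T - s))) * (indicator {0..s} r * v' r)" for s r :: real
  have [measurable]: "v' \<in> borel_measurable borel"
    using borel_measurable_integrable[OF v[unfolded set_integrable_def]] by (simp add: v'_def[abs_def])
  have Wm[measurable]: "case_prod W \<in> borel_measurable (lborel \<Otimes>\<^sub>M lborel)"
    unfolding W_def[abs_def] split_beta' indicator_def atLeastAtMost_iff by measurable
  have prod: "integrable (lborel \<Otimes>\<^sub>M lborel) (\<lambda>(s, r). (indicator {0..T} s * exp (C * T)) * (indicator {0..T} r * v r))"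
  proof (rule lborel_pair.Fubini_integrable)
    have "integrable lborel (\<lambda>s. indicator {0..T} s * (exp (C * T) * (\<integral>r. norm (indicator {0..T} r * v r) \<partial>lborel)))"
      using borel_integrable_atLeastAtMost'[of 0 T "\<lambda>_. exp (C * T) * (\<integral>r. norm (indicator {0..T} r * v r) \<partial>lborel)"]
      by (simp add: set_integrable_def)
    then show "integrable lborel (\<lambda>x. LINT y|lborel. norm (case (x, y) of (s, r) \<Rightarrow> indicator {0..T} s * exp (C * T) * (indicator {0..T} r * v r)))"
      by (simp add: abs_mult mult.assoc)
  qed (use v in \<open>auto simp: set_integrable_def\<close>)
  have Wi: "integrable (lborel \<Otimes>\<^sub>M lborel) (case_prod W)"
  proof (rule Bochner_Integration.integrable_bound[OF prod])
    have "\<bar>W s r\<bar> \<le> \<bar>(indicator {0..T} s * exp (C * T)) * (indicator {0..T} r * v r)\<bar>" for s r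
      using C by (auto simp: W_def v'_def abs_mult indicator_def intro!: mult_right_mono mult_left_mono)
    then show "AE z in lborel \<Otimes>\<^sub>M lborel. norm (case_prod W z)
        \<le> norm (case z of (s, r) \<Rightarrow> (indicator {0..T} s * exp (C * T)) * (indicator {0..T} r * v r))"
      by (intro always_eventually) auto
  qed measurable
  have inner_r: "(\<integral>r. W s r \<partial>lborel) = indicator {0..T} s * exp (C * (T - s)) * (LBINT r:{0..s}. v r)" for s
  proof -
    have "W s r = (indicator {0..T} s * exp (C * (T - s))) * (indicator {0..s} r * v r)" for r
      by (auto simp: W_def v'_def indicator_def)
    then show ?thesis by (simp add: set_lebesgue_integral_def)
  qed
  have inner_s: "C * (\<integral>s. W s r \<partial>lborel) = indicator {0..T} r * v r * (exp (C * (T - r)) - 1)" for r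
  proof (cases "0 \<le> r \<and> r \<le> T")
    case True
    have "(\<integral>s. C * exp (C * (T - s)) * indicator {r..T} s \<partial>lborel) = - exp (C * (T - T)) - - exp (C * (T - r))"
      by (intro integral_FTC_Icc_real(1)) (use True in \<open>auto intro!: derivative_eq_intros continuous_intros\<close>)
    moreover have "C * W s r = v r * (C * exp (C * (T - s)) * indicator {r..T} s)" for s
      using True by (auto simp: W_def v'_def indicator_def)
    moreover have "C * (\<integral>s. W s r \<partial>lborel) = v r * (\<integral>s. C * exp (C * (T - s)) * indicator {r..T} s \<partial>lborel)"
      unfolding integral_mult_right_zero[symmetric] calculation(2) ..
    ultimately show ?thesis using True by simp
  next
    case False
    then have "W s r = 0" for s by (auto simp: W_def v'_def indicator_def)
    then show ?thesis using False by simp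
  qed
  have fub: "(\<integral>s. (\<integral>r. W s r \<partial>lborel) \<partial>lborel) = (\<integral>r. (\<integral>s. W s r \<partial>lborel) \<partial>lborel)"
    by (rule lborel_pair.Fubini_integral[symmetric]) (use Wi in simp)
  have int_r: "integrable lborel (\<lambda>s. \<integral>r. W s r \<partial>lborel)"
    using lborel_pair.integrable_fst[OF Wi] by simp
  have b: "\<bar>exp (C * (T - s))\<bar> \<le> exp (C * T)" if "0 \<le> s" for s
    using that C by (simp add: mult_left_mono)
  have weighted: "integrable lborel (\<lambda>s. exp (C * (T - s)) * (indicator {0..T} s * f s))"
    if f: "set_integrable lborel {0..T} f" for f :: "real \<Rightarrow> real"
  proof -
    have f': "integrable lborel (\<lambda>s. indicator {0..T} s * f s)"
      using f by (simp add: set_integrable_def)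
    show ?thesis
    proof (rule Bochner_Integration.integrable_bound[OF integrable_mult_right[OF f', of "exp (C * T)"]])
      show "(\<lambda>s. exp (C * (T - s)) * (indicator {0..T} s * f s)) \<in> borel_measurable lborel"
        by (intro borel_measurable_times borel_measurable_integrable[OF f']) measurable
      have "\<bar>exp (C * (T - s)) * (indicator {0..T} s * f s)\<bar> \<le> \<bar>exp (C * T) * (indicator {0..T} s * f s)\<bar>" for s
        using b[of s] by (auto simp: abs_mult indicator_def intro!: mult_right_mono)
      then show "AE s in lborel. norm (exp (C * (T - s)) * (indicator {0..T} s * f s))
          \<le> norm (exp (C * T) * (indicator {0..T} s * f s))" by (intro always_eventually) auto
    qed
  qed
  note ev = weighted[OF v] and ek = weighted[OF k]
  have iv: "integrable lborel (\<lambda>s. indicator {0..T} s * v s)"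
    using v by (simp add: set_integrable_def)
  have "(\<integral>s. exp (C * (T - s)) * (indicator {0..T} s * v s) \<partial>lborel)
      \<le> (\<integral>s. exp (C * (T - s)) * (indicator {0..T} s * k s) + C * (\<integral>r. W s r \<partial>lborel) \<partial>lborel)"
  proof (rule integral_mono)
    fix s
    show "exp (C * (T - s)) * (indicator {0..T} s * v s) \<le>
      exp (C * (T - s)) * (indicator {0..T} s * k s) + C * (\<integral>r. W s r \<partial>lborel)"
    proof (cases "0 \<le> s \<and> s \<le> T")
      case True
      have "exp (C * (T - s)) * v s \<le> exp (C * (T - s)) * (k s + C * (LBINT r:{0..s}. v r))"
        using le[of s] True by (intro mult_left_mono) auto
      then show ?thesis unfolding inner_r using True by (simp add: algebra_simps)
    next
      case False then show ?thesis unfolding inner_r by auto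
    qed
  qed (use ev ek int_r in auto)
  also have "\<dots> = (\<integral>s. exp (C * (T - s)) * (indicator {0..T} s * k s) \<partial>lborel) + (\<integral>r. C * (\<integral>s. W s r \<partial>lborel) \<partial>lborel)"
    using ek int_r fub by simp
  also have "(\<integral>r. C * (\<integral>s. W s r \<partial>lborel) \<partial>lborel) = (\<integral>r. exp (C * (T - r)) * (indicator {0..T} r * v r) - indicator {0..T} r * v r \<partial>lborel)"
    unfolding inner_s by (simp add: algebra_simps)
  also have "\<dots> = (\<integral>r. exp (C * (T - r)) * (indicator {0..T} r * v r) \<partial>lborel) - (\<integral>r. indicator {0..T} r * v r \<partial>lborel)"
    using ev iv by simp
  finally have "(\<integral>r. indicator {0..T} r * v r \<partial>lborel) \<le> (\<integral>s. exp (C * (T - s)) * (indicator {0..T} s * k s) \<partial>lborel)"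
    by simp
  then show ?thesis
    by (simp add: set_lebesgue_integral_def ac_simps)
qed

lemma integral_exp_weight:
  fixes C K t :: real
  assumes "0 \<le> t"
  shows "C * (LBINT s:{0..t}. exp (C * (t - s)) * K) = K * (exp (C * t) - 1)"
proof -
  have "C * (LBINT s:{0..t}. exp (C * (t - s)) * K) = K * (\<integral>s. C * exp (C * (t - s)) * indicator {0..t} s \<partial>lborel)"
    unfolding set_lebesgue_integral_def
    by (simp flip: integral_mult_right_zero add: ac_simps)
  also have "(\<integral>s. C * exp (C * (t - s)) * indicator {0..t} s \<partial>lborel) = - exp (C * (t - t)) - - exp (C * (t - 0))"
    by (intro integral_FTC_Icc_real(1)) (use assms in \<open>auto intro!: derivative_eq_intros continuous_intros\<close>)
  finally show ?thesis by simp
qed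

lemma gronwall_const:
  fixes v :: "real \<Rightarrow> real"
  assumes T: "0 \<le> T" and C: "0 \<le> C"
    and v: "set_integrable lborel {0..T} v"
    and le: "\<And>s. \<lbrakk>0 \<le> s; s \<le> T\<rbrakk> \<Longrightarrow> v s \<le> K + C * (LBINT r:{0..s}. v r)"
  shows "v T \<le> K * exp (C * T)"
proof -
  have "v T \<le> K + C * (LBINT r:{0..T}. v r)" using le T by simp
  also have "\<dots> \<le> K + C * (LBINT s:{0..T}. exp (C * (T - s)) * K)"
    using C
    by (intro add_left_mono mult_left_mono gronwall_set_integral[OF T C v _ le] borel_integrable_atLeastAtMost' continuous_on_const)
  also have "C * (LBINT s:{0..T}. exp (C * (T - s)) * K) = K * (exp (C * T) - 1)"
    by (rule integral_exp_weight[OF T])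
  finally show ?thesis by (simp add: algebra_simps)
qed

text \<open>Time reversal \<open>r \<mapsto> t - r\<close> reduces this to the forward inequality. It bounds an initial value by a
  later one.\<close>

lemma gronwall_backward:
  fixes \<phi> :: "real \<Rightarrow> real"
  assumes t: "0 \<le> t" and C: "0 \<le> C" and \<phi>: "set_integrable lborel {0..t} \<phi>"
    and le: "\<And>s. \<lbrakk>0 \<le> s; s \<le> t\<rbrakk> \<Longrightarrow> \<phi> s \<le> \<phi> t + C * (LBINT r:{s..t}. \<phi> r)"
  shows "\<phi> 0 \<le> \<phi> t * exp (C * t)"
proof -
  have reflect: "(LBINT r:{t - s..t}. \<phi> r) = (LBINT r:{0..s}. \<phi> (t - r))" for s
  proof -
    have "(LBINT r:{t - s..t}. \<phi> r) = (\<integral>r. indicator {t - s..t} (t + (- 1) * r) *\<^sub>R \<phi> (t + (- 1) * r) \<partial>lborel)"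
      unfolding set_lebesgue_integral_def by (subst lborel_integral_real_affine[where c="- 1" and t=t]) auto
    also have "\<dots> = (LBINT r:{0..s}. \<phi> (t - r))"
      unfolding set_lebesgue_integral_def
      by (intro Bochner_Integration.integral_cong) (auto simp: indicator_def)
    finally show ?thesis .
  qed
  have int: "set_integrable lborel {0..t} (\<lambda>r. \<phi> (t - r))"
  proof -
    have "integrable lborel (\<lambda>r. indicator {0..t} (t + (- 1) * r) *\<^sub>R \<phi> (t + (- 1) * r))"
      using \<phi> unfolding set_integrable_def by (rule lborel_integrable_real_affine) simp
    moreover have "(\<lambda>r. indicat_real {0..t} (t + (- 1) * r) *\<^sub>R \<phi> (t + (- 1) * r)) = (\<lambda>r. indicator {0..t} r *\<^sub>R \<phi> (t - r))"
      by (rule ext) (auto simp: indicator_def)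
    ultimately show ?thesis unfolding set_integrable_def by (simp only:)
  qed
  have "\<phi> (t - t) \<le> \<phi> t * exp (C * t)"
  proof (rule gronwall_const[OF t C int])
    fix s assume "0 \<le> s" "s \<le> t"
    then show "\<phi> (t - s) \<le> \<phi> t + C * (LBINT r:{0..s}. \<phi> (t - r))"
      using le[of "t - s"] reflect[of s] by simp
  qed
  then show ?thesis by simp
qed

text \<open>A chain \<open>g\<^sub>k' = g\<^sub>k\<^sub>+\<^sub>1\<close>, in integrated form, whose members grow at most geometrically in \<open>k\<close> is
  given by its Taylor series. For \<open>g\<^sub>k(s) = E\<^sub>x[G\<^sup>k p(X\<^sub>s)]\<close> this takes the place of solving a linear
  system by the matrix exponential.\<close>

lemma iterated_integral_sums:
  fixes g :: "nat \<Rightarrow> real \<Rightarrow> real"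
  assumes T: "0 \<le> T"
    and meas: "\<And>k. g k \<in> borel_measurable borel"
    and eq: "\<And>k s. \<lbrakk>0 \<le> s; s \<le> T\<rbrakk> \<Longrightarrow> g k s = g0 k + (LBINT r:{0..s}. g (Suc k) r)"
    and bound: "\<And>k s. \<lbrakk>0 \<le> s; s \<le> T\<rbrakk> \<Longrightarrow> \<bar>g k s\<bar> \<le> K * a ^ k"
  shows "(\<lambda>k. T ^ k / fact k * g0 k) sums g 0 T"
proof -
  have int: "set_integrable lborel {0..s} (g k)" if "0 \<le> s" "s \<le> T" for s k
  proof (rule set_integrable_bound)
    show "set_integrable lborel {0..s} (\<lambda>_. K * a ^ k)"
      by (intro borel_integrable_atLeastAtMost' continuous_on_const)
    show "set_borel_measurable lborel {0..s} (g k)"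
      using meas[of k] by (simp add: set_borel_measurable_def)
    have "\<bar>g k x\<bar> \<le> \<bar>K * a ^ k\<bar>" if "x \<in> {0..s}" for x
      using bound[of x k] that \<open>s \<le> T\<close> by simp
    then show "AE x in lborel. x \<in> {0..s} \<longrightarrow> norm (g k x) \<le> norm (K * a ^ k)"
      by simp
  qed
  have pow: "(LBINT r:{0..s}. r ^ j) = s ^ Suc j / real (Suc j)" "set_integrable lborel {0..s} (\<lambda>r. r ^ j)"
    if "0 \<le> s" for s :: real and j
  proof -
    show "(LBINT r:{0..s}. r ^ j) = s ^ Suc j / real (Suc j)"
      using integral_power[of 0 s j] that by (simp add: set_lebesgue_integral_def ac_simps)
    show "set_integrable lborel {0..s} (\<lambda>r. r ^ j)"
      by (intro borel_integrable_atLeastAtMost') (auto intro!: continuous_intros)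
  qed
  \<comment> \<open>The remainder after \<open>n\<close> terms is an \<open>n\<close>-fold iterated integral of \<open>g (k + n)\<close>.\<close>
  have rem: "\<bar>g k s - (\<Sum>j<n. s ^ j / fact j * g0 (k + j))\<bar> \<le> K * a ^ (k + n) * (s ^ n / fact n)"
    if "0 \<le> s" "s \<le> T" for n k s
    using that
  proof (induction n arbitrary: k s)
    case 0 then show ?case using bound[of s k] by simp
  next
    case (Suc n)
    let ?q = "\<lambda>r. \<Sum>j<n. r ^ j / fact j * g0 (Suc k + j)"
    let ?R = "\<lambda>r. g (Suc k) r - ?q r"
    have term_int: "set_integrable lborel {0..s} (\<lambda>r. r ^ j / fact j * g0 (Suc k + j))" for j
      using set_integrable_mult_right[OF pow(2)[of s j], of "g0 (Suc k + j) / fact j"] Suc.prems by (simp add: ac_simps)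
    have q_int: "set_integrable lborel {0..s} ?q"
      unfolding set_integrable_def scaleR_sum_right
      by (intro Bochner_Integration.integrable_sum) (use term_int in \<open>simp add: set_integrable_def\<close>)
    have "(LBINT r:{0..s}. ?q r) = (\<Sum>j<n. (LBINT r:{0..s}. r ^ j / fact j * g0 (Suc k + j)))"
      unfolding set_lebesgue_integral_def scaleR_sum_right
      using term_int by (intro Bochner_Integration.integral_sum) (auto simp: set_integrable_def)
    also have "\<dots> = (\<Sum>j<n. s ^ Suc j / fact (Suc j) * g0 (k + Suc j))"
    proof (rule sum.cong[OF refl])
      fix j
      have "(LBINT r:{0..s}. r ^ j / fact j * g0 (Suc k + j)) = (LBINT r:{0..s}. r ^ j) * (g0 (Suc k + j) / fact j)"
        by (simp flip: set_integral_mult_left)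
      then show "(LBINT r:{0..s}. r ^ j / fact j * g0 (Suc k + j)) = s ^ Suc j / fact (Suc j) * g0 (k + Suc j)"
        using pow(1)[of s j] Suc.prems by (simp add: divide_simps) (simp add: algebra_simps)?
    qed
    finally have q: "(LBINT r:{0..s}. ?q r) = (\<Sum>j<n. s ^ Suc j / fact (Suc j) * g0 (k + Suc j))" .
    have "(\<Sum>j<Suc n. s ^ j / fact j * g0 (k + j)) = g0 k + (LBINT r:{0..s}. ?q r)"
      unfolding q sum.lessThan_Suc_shift by simp
    then have "g k s - (\<Sum>j<Suc n. s ^ j / fact j * g0 (k + j)) = (LBINT r:{0..s}. ?R r)"
      using eq[of s k] Suc.prems int[of s "Suc k"] q_int by (simp add: set_integral_diff)
    also have "\<bar>\<dots>\<bar> \<le> (LBINT r:{0..s}. \<bar>?R r\<bar>)"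
      using set_integral_norm_bound[of lborel "{0..s}" ?R] int[of s "Suc k"] q_int Suc.prems
      by (simp add: set_integral_diff)
    also have "\<dots> \<le> (LBINT r:{0..s}. (K * a ^ (Suc k + n) / fact n) * r ^ n)"
    proof (rule set_integral_mono)
      show "set_integrable lborel {0..s} (\<lambda>r. \<bar>?R r\<bar>)"
        using int[of s "Suc k"] q_int Suc.prems by (intro set_integrable_abs set_integral_diff) auto
      show "set_integrable lborel {0..s} (\<lambda>r. (K * a ^ (Suc k + n) / fact n) * r ^ n)"
        using pow(2)[of s n] Suc.prems by simp
      fix r assume "r \<in> {0..s}"
      then show "\<bar>?R r\<bar> \<le> (K * a ^ (Suc k + n) / fact n) * r ^ n"
        using Suc.IH[of r "Suc k"] Suc.prems by simp
    qed
    also have "\<dots> = K * a ^ (k + Suc n) * (s ^ Suc n / fact (Suc n))"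
      using Suc.prems by (simp add: pow(1) ac_simps del: of_nat_Suc)
    finally show ?case .
  qed
  have "(\<lambda>n. K * ((a * T) ^ n / fact n)) \<longlonglongrightarrow> K * 0"
    by (intro tendsto_mult_left) (use summable_LIMSEQ_zero[OF summable_exp[of "a * T"]] in \<open>simp add: field_simps\<close>)
  then have lim0: "(\<lambda>n. K * ((a * T) ^ n / fact n)) \<longlonglongrightarrow> 0" by simp
  have err: "\<bar>(\<Sum>j<n. T ^ j / fact j * g0 j) - g 0 T\<bar> \<le> K * ((a * T) ^ n / fact n)" for n
  proof -
    have "K * a ^ (0 + n) * (T ^ n / fact n) = K * ((a * T) ^ n / fact n)"
      by (simp add: power_mult_distrib)
    then show ?thesis
      using rem[OF T order_refl, of 0 n] by (simp only: abs_minus_commute add_0)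
  qed
  have "(\<lambda>n. (\<Sum>j<n. T ^ j / fact j * g0 j) - g 0 T) \<longlonglongrightarrow> 0"
  proof (rule Lim_null_comparison[OF _ lim0])
    show "\<forall>\<^sub>F n in sequentially. norm ((\<Sum>j<n. T ^ j / fact j * g0 j) - g 0 T) \<le> K * ((a * T) ^ n / fact n)"
      unfolding real_norm_def by (intro always_eventually allI err)
  qed
  then show ?thesis unfolding sums_def by (rule LIM_zero_cancel)
qed

section \<open>Right-continuous paths\<close>

text \<open>One-sided limits bound the path near each time; bisection of the interval makes this uniform.\<close>

lemma cadlag_bounded:
  fixes f :: "real \<Rightarrow> 'b::metric_space"
  assumes "cadlag f"
  shows "bounded (f ` {0..T})"
proof (cases "0 \<le> T")
  case True
  have "bounded (f ` {max 0 0..T})"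
  proof (rule Bolzano[OF True, of "\<lambda>a b. bounded (f ` {max 0 a..b})"])
    fix a b c :: real
    assume "bounded (f ` {max 0 a..b})" "bounded (f ` {max 0 b..c})"
    then have "bounded (f ` ({max 0 a..b} \<union> {max 0 b..c}))" by (simp add: image_Un)
    then show "bounded (f ` {max 0 a..c})" by (rule bounded_subset) (intro image_mono, auto)
  next
    fix x :: real assume x: "0 \<le> x" "x \<le> T"
    have "(f \<longlongrightarrow> f x) (at_right x)"
      using assms x unfolding cadlag_def continuous_within by auto
    then have "eventually (\<lambda>s. dist (f s) (f x) < 1) (at_right x)" by (rule tendstoD) simp
    then obtain b where b: "b > x" "\<And>s. \<lbrakk>x < s; s < b\<rbrakk> \<Longrightarrow> dist (f s) (f x) < 1"
      unfolding eventually_at_right_field by auto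
    have "\<exists>a<x. \<exists>l. \<forall>s\<ge>0. a < s \<longrightarrow> s < x \<longrightarrow> dist (f s) l < 1"
    proof (cases "x = 0")
      case True then show ?thesis by (intro exI[of _ "x - 1"]) auto
    next
      case False
      then obtain l where "(f \<longlongrightarrow> l) (at_left x)" using assms x unfolding cadlag_def by force
      then have "eventually (\<lambda>s. dist (f s) l < 1) (at_left x)" by (rule tendstoD) simp
      then show ?thesis unfolding eventually_at_left_field by blast
    qed
    then obtain a l where a: "a < x" "\<And>s. \<lbrakk>0 \<le> s; a < s; s < x\<rbrakk> \<Longrightarrow> dist (f s) l < 1" by blast
    show "\<exists>d>0. \<forall>a b. a \<le> x \<and> x \<le> b \<and> b - a < d \<longrightarrow> bounded (f ` {max 0 a..b})"
    proof (intro exI[of _ "min (b - x) (x - a)"] conjI allI impI)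
      show "0 < min (b - x) (x - a)" using a b by simp
      fix a' b' assume H: "a' \<le> x \<and> x \<le> b' \<and> b' - a' < min (b - x) (x - a)"
      have "f ` {max 0 a'..b'} \<subseteq> ball l 1 \<union> cball (f x) 1"
      proof safe
        fix s assume s: "s \<in> {max 0 a'..b'}" "f s \<notin> cball (f x) 1"
        then have "s < x" using H b(2)[of s] by (cases s x rule: linorder_cases) (auto simp: dist_commute less_imp_le)
        then show "f s \<in> ball l 1" using a(2)[of s] s H by (auto simp: dist_commute)
      qed
      then show "bounded (f ` {max 0 a'..b'})"
        by (rule bounded_subset[rotated]) auto
    qed
  qed
  then show ?thesis by simp
qed simp

text \<open>The grid points approach \<open>s\<close> strictly from the right, as right-continuity requires; evaluating a
  process or a stopping time on the grid leaves countably many times.\<close>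

lemma at_right_grid:
  fixes s :: real
  shows "filterlim (\<lambda>n. (real_of_int \<lfloor>s * real (Suc n)\<rfloor> + 1) / real (Suc n)) (at_right s) sequentially"
proof -
  have gt: "s < (real_of_int \<lfloor>s * real (Suc n)\<rfloor> + 1) / real (Suc n)" for n
    by (simp add: pos_less_divide_eq)
  have le: "(real_of_int \<lfloor>s * real (Suc n)\<rfloor> + 1) / real (Suc n) \<le> s + 1 / real (Suc n)" for n
  proof -
    have "(real_of_int \<lfloor>s * real (Suc n)\<rfloor> + 1) / real (Suc n) \<le> (s * real (Suc n) + 1) / real (Suc n)"
      by (intro divide_right_mono) auto
    then show ?thesis by (simp add: add_divide_distrib del: of_nat_Suc)
  qed
  have "(\<lambda>n. s + 1 / real (Suc n)) \<longlonglongrightarrow> s + 0"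
    by (intro tendsto_add tendsto_const LIMSEQ_Suc[OF lim_1_over_n])
  then have lim: "(\<lambda>n. s + 1 / real (Suc n)) \<longlonglongrightarrow> s" by simp
  have "(\<lambda>n. (real_of_int \<lfloor>s * real (Suc n)\<rfloor> + 1) / real (Suc n)) \<longlonglongrightarrow> s"
    by (rule tendsto_sandwich[OF _ _ tendsto_const lim])
      (rule always_eventually, rule allI, rule less_imp_le, rule gt,
       rule always_eventually, rule allI, rule le)
  moreover have "(real_of_int \<lfloor>s * real (Suc n)\<rfloor> + 1) / real (Suc n) \<in> {s<..} \<and>
      (real_of_int \<lfloor>s * real (Suc n)\<rfloor> + 1) / real (Suc n) \<noteq> s" for n
    using gt[of n] by (simp del: of_nat_Suc)
  ultimately show ?thesis unfolding filterlim_at by (intro conjI always_eventually allI) blast+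
qed

lemma right_continuous_jointly_measurable:
  fixes Y :: "real \<Rightarrow> 'w \<Rightarrow> 'b::{metric_space, second_countable_topology}"
  assumes meas: "\<And>t. 0 \<le> t \<Longrightarrow> Y t \<in> borel_measurable N"
    and cont: "\<And>\<omega> t. \<lbrakk>\<omega> \<in> space N; 0 \<le> t\<rbrakk> \<Longrightarrow> continuous (at_right t) (\<lambda>t. Y t \<omega>)"
  shows "(\<lambda>(s, \<omega>). Y (max 0 s) \<omega>) \<in> borel_measurable (borel \<Otimes>\<^sub>M N)"
proof (rule borel_measurable_LIMSEQ_metric)
  fix n
  let ?i = "\<lambda>z :: real \<times> 'w. \<lfloor>max 0 (fst z) * real (Suc n)\<rfloor>"
  have "(\<lambda>z. Y (max 0 ((real_of_int (?i z) + 1) / real (Suc n))) (snd z)) \<in> borel_measurable (borel \<Otimes>\<^sub>M N)"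
  proof (rule measurable_compose_countable[where f="\<lambda>i z. Y (max 0 ((real_of_int i + 1) / real (Suc n))) (snd z)"])
    show "(\<lambda>z. Y (max 0 ((real_of_int i + 1) / real (Suc n))) (snd z)) \<in> borel_measurable (borel \<Otimes>\<^sub>M N)" for i
      by (rule measurable_compose[OF measurable_snd meas]) simp
    show "?i \<in> borel \<Otimes>\<^sub>M N \<rightarrow>\<^sub>M count_space UNIV" by measurable
  qed
  then show "(\<lambda>z. Y (max 0 ((real_of_int (?i z) + 1) / real (Suc n))) (snd z)) \<in> borel_measurable (borel \<Otimes>\<^sub>M N)" .
next
  fix z assume "z \<in> space (borel \<Otimes>\<^sub>M N :: (real \<times> 'w) measure)"
  then have z: "snd z \<in> space N" by (auto simp: space_pair_measure)
  have "((\<lambda>t. Y t (snd z)) \<longlongrightarrow> Y (max 0 (fst z)) (snd z)) (at_right (max 0 (fst z)))"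
    using cont[OF z, of "max 0 (fst z)"] by (simp add: continuous_within)
  from filterlim_compose[OF this at_right_grid]
  have "(\<lambda>n. Y ((real_of_int \<lfloor>max 0 (fst z) * real (Suc n)\<rfloor> + 1) / real (Suc n)) (snd z))
       \<longlonglongrightarrow> Y (max 0 (fst z)) (snd z)" .
  moreover have "max 0 ((real_of_int \<lfloor>max 0 (fst z) * real (Suc n)\<rfloor> + 1) / real (Suc n)) =
      (real_of_int \<lfloor>max 0 (fst z) * real (Suc n)\<rfloor> + 1) / real (Suc n)" for n
    by (intro max_absorb2 divide_nonneg_nonneg add_nonneg_nonneg) auto
  ultimately show "(\<lambda>n. Y (max 0 ((real_of_int \<lfloor>max 0 (fst z) * real (Suc n)\<rfloor> + 1) / real (Suc n))) (snd z))
       \<longlonglongrightarrow> (case z of (s, \<omega>) \<Rightarrow> Y (max 0 s) \<omega>)"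
    by (simp add: split_beta')
qed

section \<open>Martingales and expectations of time integrals\<close>

lemma martingale_expectation:
  assumes Q: "finite_measure Q" and sub: "subalgebra Q (F s)"
    and Y: "martingale Q F Y" and st: "0 \<le> s" "s \<le> t"
  shows "(LINT \<omega>|Q. Y t \<omega>) = (LINT \<omega>|Q. Y s \<omega>)"
    and "(LINT \<omega>|Q. \<bar>Y s \<omega>\<bar>) \<le> (LINT \<omega>|Q. \<bar>Y t \<omega>\<bar>)"
proof -
  interpret finite_measure Q by fact
  interpret finite_measure_subalgebra Q "F s" by unfold_locales (rule sub)
  have int: "integrable Q (Y s)" "integrable Q (Y t)" using Y st by (auto simp: martingale_def)
  have ce: "AE \<omega> in Q. real_cond_exp Q (F s) (Y t) \<omega> = Y s \<omega>" using Y st by (auto simp: martingale_def)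
  have "(LINT \<omega>|Q. Y t \<omega>) = (LINT \<omega>|Q. real_cond_exp Q (F s) (Y t) \<omega>)"
    using real_cond_exp_int(2)[OF int(2)] by simp
  also have "\<dots> = (LINT \<omega>|Q. Y s \<omega>)"
    using ce int by (intro integral_cong_AE) auto
  finally show "(LINT \<omega>|Q. Y t \<omega>) = (LINT \<omega>|Q. Y s \<omega>)" .
  have "(LINT \<omega>|Q. \<bar>Y s \<omega>\<bar>) \<le> (LINT \<omega>|Q. real_cond_exp Q (F s) (\<lambda>\<omega>. \<bar>Y t \<omega>\<bar>) \<omega>)"
  proof (rule integral_mono_AE)
    have "AE \<omega> in Q. \<bar>real_cond_exp Q (F s) (Y t) \<omega>\<bar> \<le> real_cond_exp Q (F s) (\<lambda>\<omega>. \<bar>Y t \<omega>\<bar>) \<omega>"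
    proof -
      have "AE \<omega> in Q. real_cond_exp Q (F s) (Y t) \<omega> \<le> real_cond_exp Q (F s) (\<lambda>\<omega>. \<bar>Y t \<omega>\<bar>) \<omega>"
        by (rule real_cond_exp_mono) (use int in auto)
      moreover have "AE \<omega> in Q. real_cond_exp Q (F s) (\<lambda>\<omega>. - 1 * Y t \<omega>) \<omega> \<le> real_cond_exp Q (F s) (\<lambda>\<omega>. \<bar>Y t \<omega>\<bar>) \<omega>"
        by (rule real_cond_exp_mono) (use int in auto)
      moreover have "AE \<omega> in Q. real_cond_exp Q (F s) (\<lambda>\<omega>. - 1 * Y t \<omega>) \<omega> = - 1 * real_cond_exp Q (F s) (Y t) \<omega>"
        by (rule real_cond_exp_cmult) (use int in auto)
      ultimately show ?thesis by eventually_elim auto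
    qed
    with ce show "AE \<omega> in Q. \<bar>Y s \<omega>\<bar> \<le> real_cond_exp Q (F s) (\<lambda>\<omega>. \<bar>Y t \<omega>\<bar>) \<omega>"
      by eventually_elim simp
  qed (use int real_cond_exp_int(1) in auto)
  also have "\<dots> = (LINT \<omega>|Q. \<bar>Y t \<omega>\<bar>)"
    using int by (intro real_cond_exp_int(2)) auto
  finally show "(LINT \<omega>|Q. \<bar>Y s \<omega>\<bar>) \<le> (LINT \<omega>|Q. \<bar>Y t \<omega>\<bar>)" .
qed

lemma martingale_cong:
  assumes Q: "finite_measure Q" and sub: "\<And>t. subalgebra Q (F t)"
    and Y: "martingale Q F Y" and eq: "\<And>t \<omega>. \<lbrakk>0 \<le> t; \<omega> \<in> space Q\<rbrakk> \<Longrightarrow> Y t \<omega> = Z t \<omega>"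
  shows "martingale Q F Z"
  unfolding martingale_def
proof (intro conjI allI impI)
  interpret finite_measure Q by fact
  have sp: "space (F t) = space Q" for t using sub by (simp add: subalgebra_def)
  fix t :: real assume t: "0 \<le> t"
  have "Y t \<in> borel_measurable (F t)" using Y t by (simp add: martingale_def)
  then show "Z t \<in> borel_measurable (F t)"
    by (rule measurable_cong[THEN iffD1, rotated]) (use eq t sp in auto)
  have "integrable Q (Y t)" using Y t by (simp add: martingale_def)
  then show "integrable Q (Z t)"
    by (rule Bochner_Integration.integrable_cong[THEN iffD1, rotated -1]) (use eq t in auto)
next
  interpret finite_measure Q by fact
  fix s t :: real assume st: "0 \<le> s" "s \<le> t"
  interpret finite_measure_subalgebra Q "F s" by unfold_locales (rule sub)
  have Yi: "integrable Q (Y t)" using Y st by (simp add: martingale_def)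
  have "Y t \<in> borel_measurable Q" using Yi by simp
  moreover from this have "Z t \<in> borel_measurable Q"
    by (rule measurable_cong[THEN iffD1, rotated]) (use eq st in auto)
  ultimately have "AE \<omega> in Q. real_cond_exp Q (F s) (Y t) \<omega> = real_cond_exp Q (F s) (Z t) \<omega>"
    using eq[of t] st by (intro real_cond_exp_cong AE_I2) auto
  moreover have "AE \<omega> in Q. real_cond_exp Q (F s) (Y t) \<omega> = Y s \<omega>"
    using Y st by (simp add: martingale_def)
  ultimately show "AE \<omega> in Q. real_cond_exp Q (F s) (Z t) \<omega> = Z s \<omega>"
    using AE_space by eventually_elim (use eq[of s] st in auto)
qed

lemma local_martingale_cong:
  assumes Q: "finite_measure Q" and sub: "\<And>t. subalgebra Q (F t)"
    and Y: "local_martingale Q F Y" and eq: "\<And>t \<omega>. \<lbrakk>0 \<le> t; \<omega> \<in> space Q\<rbrakk> \<Longrightarrow> Y t \<omega> = Z t \<omega>"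
  shows "local_martingale Q F Z"
proof -
  obtain \<tau> where \<tau>: "\<forall>n. stopping_time F (\<tau> n) \<and> (\<forall>\<omega>\<in>space Q. 0 \<le> \<tau> n \<omega>)"
    "AE \<omega> in Q. incseq (\<lambda>n. \<tau> n \<omega>) \<and> filterlim (\<lambda>n. \<tau> n \<omega>) at_top sequentially"
    "\<forall>n. martingale Q F (\<lambda>t \<omega>. Y (min t (\<tau> n \<omega>)) \<omega>)"
    using Y unfolding local_martingale_def by (elim exE conjE)
  have "martingale Q F (\<lambda>t \<omega>. Z (min t (\<tau> n \<omega>)) \<omega>)" for n
    by (rule martingale_cong[OF Q sub spec[OF \<tau>(3), of n]]) (use \<tau>(1) eq in simp)
  with \<tau>(1,2) show ?thesis unfolding local_martingale_def by blast
qed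

lemma local_martingale_zero:
  assumes Q: "finite_measure Q" and sub: "\<And>t. subalgebra Q (F t)"
  shows "local_martingale Q F (\<lambda>t \<omega>. 0)"
  unfolding local_martingale_def
proof (intro exI[of _ "\<lambda>n \<omega>. real n"] conjI allI)
  interpret finite_measure Q by fact
  show "martingale Q F (\<lambda>t \<omega>. 0)"
    unfolding martingale_def
  proof (intro conjI allI impI)
    fix s :: real
    interpret finite_measure_subalgebra Q "F s" by unfold_locales (rule sub)
    show "AE \<omega> in Q. real_cond_exp Q (F s) (\<lambda>\<omega>. 0) \<omega> = 0"
      by (rule real_cond_exp_F_meas) auto
  qed auto
  show "AE \<omega> in Q. incseq (\<lambda>n. real n) \<and> filterlim (\<lambda>n. real n) at_top sequentially"
    by (intro AE_I2 conjI filterlim_real_sequentially) (auto simp: incseq_def)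
qed (auto intro: stopping_time_const)

lemma integrable_pair_bounded_sections:
  fixes k :: "real \<Rightarrow> 'w \<Rightarrow> real"
  assumes Q: "sigma_finite_measure Q" and t: "0 \<le> t"
    and meas: "(\<lambda>(s, \<omega>). k s \<omega>) \<in> borel_measurable (borel \<Otimes>\<^sub>M Q)"
    and bound: "\<And>s. \<lbrakk>0 \<le> s; s \<le> t\<rbrakk> \<Longrightarrow> (\<integral>\<^sup>+\<omega>. \<bar>k s \<omega>\<bar> \<partial>Q) \<le> ennreal B"
  shows "integrable (lborel \<Otimes>\<^sub>M Q) (\<lambda>(s, \<omega>). indicator {0..t} s * k s \<omega>)"
proof (rule integrableI_bounded)
  interpret Q: sigma_finite_measure Q by fact
  interpret pair_sigma_finite lborel Q ..
  have m[measurable]: "(\<lambda>z. k (fst z) (snd z)) \<in> borel_measurable (lborel \<Otimes>\<^sub>M Q)"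
    using meas by (simp add: split_beta' cong: measurable_cong_sets sets_pair_measure_cong)
  show m2: "(\<lambda>(s, \<omega>). indicator {0..t} s * k s \<omega>) \<in> borel_measurable (lborel \<Otimes>\<^sub>M Q)"
    unfolding split_beta' by measurable
  have "(\<integral>\<^sup>+z. norm (case z of (s, \<omega>) \<Rightarrow> indicator {0..t} s * k s \<omega>) \<partial>(lborel \<Otimes>\<^sub>M Q))
    = (\<integral>\<^sup>+s. (\<integral>\<^sup>+\<omega>. norm (indicator {0..t} s * k s \<omega>) \<partial>Q) \<partial>lborel)"
    using Q.nn_integral_fst[of "\<lambda>z. ennreal (norm (case z of (s, \<omega>) \<Rightarrow> indicator {0..t} s * k s \<omega>))" lborel] m2
    by simp
  also have "\<dots> \<le> (\<integral>\<^sup>+s. ennreal B * indicator {0..t} s \<partial>lborel)"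
    using bound by (intro nn_integral_mono) (auto simp: indicator_def)
  also have "\<dots> = ennreal B * ennreal t"
    using t by (simp add: nn_integral_cmult_indicator)
  also have "\<dots> < \<infinity>" by (simp add: ennreal_mult_less_top)
  finally show "(\<integral>\<^sup>+z. norm (case z of (s, \<omega>) \<Rightarrow> indicator {0..t} s * k s \<omega>) \<partial>(lborel \<Otimes>\<^sub>M Q)) < \<infinity>" .
qed

text \<open>Fubini's theorem under a bound on the first absolute moment that is uniform in time.\<close>

lemma expectation_set_integral:
  fixes k :: "real \<Rightarrow> 'w \<Rightarrow> real"
  assumes Q: "sigma_finite_measure Q" and t: "0 \<le> t"
    and meas: "(\<lambda>(s, \<omega>). k s \<omega>) \<in> borel_measurable (borel \<Otimes>\<^sub>M Q)"
    and bound: "\<And>s. \<lbrakk>0 \<le> s; s \<le> t\<rbrakk> \<Longrightarrow> (\<integral>\<^sup>+\<omega>. \<bar>k s \<omega>\<bar> \<partial>Q) \<le> ennreal B"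
  shows "integrable Q (\<lambda>\<omega>. LBINT s:{0..t}. k s \<omega>)"
    and "(LINT \<omega>|Q. (LBINT s:{0..t}. k s \<omega>)) = (LBINT s:{0..t}. (LINT \<omega>|Q. k s \<omega>))"
    and "set_integrable lborel {0..t} (\<lambda>s. LINT \<omega>|Q. k s \<omega>)"
proof -
  interpret Q: sigma_finite_measure Q by fact
  interpret pair_sigma_finite lborel Q ..
  note i = integrable_pair_bounded_sections[OF assms]
  show "integrable Q (\<lambda>\<omega>. LBINT s:{0..t}. k s \<omega>)"
    using integrable_snd[OF i] by (simp add: set_lebesgue_integral_def)
  show "(LINT \<omega>|Q. (LBINT s:{0..t}. k s \<omega>)) = (LBINT s:{0..t}. (LINT \<omega>|Q. k s \<omega>))"
    using Fubini_integral[OF i] by (simp add: set_lebesgue_integral_def)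
  show "set_integrable lborel {0..t} (\<lambda>s. LINT \<omega>|Q. k s \<omega>)"
    using integrable_fst[OF i] by (simp add: set_integrable_def)
qed

text \<open>Gronwall's inequality is applied to each path, and expectations are taken afterwards. In this order
  finiteness of the expectation of \<open>v\<close> is part of the conclusion. The bound \<open>B\<close> makes Fubini's
  theorem applicable to \<open>k\<close>.\<close>

lemma expected_gronwall:
  fixes v k :: "real \<Rightarrow> 'w \<Rightarrow> real"
  assumes Q: "sigma_finite_measure Q" and t: "0 \<le> t" and C: "0 \<le> C"
    and meas: "(\<lambda>(s, \<omega>). k s \<omega>) \<in> borel_measurable (borel \<Otimes>\<^sub>M Q)"
    and v: "\<And>\<omega>. \<omega> \<in> space Q \<Longrightarrow> set_integrable lborel {0..t} (\<lambda>s. v s \<omega>)"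
    and k: "\<And>\<omega>. \<omega> \<in> space Q \<Longrightarrow> set_integrable lborel {0..t} (\<lambda>s. k s \<omega>)"
    and nonneg: "\<And>\<omega>. \<omega> \<in> space Q \<Longrightarrow> 0 \<le> v t \<omega>"
    and le: "\<And>s \<omega>. \<lbrakk>\<omega> \<in> space Q; 0 \<le> s; s \<le> t\<rbrakk> \<Longrightarrow> v s \<omega> \<le> k s \<omega> + C * (LBINT r:{0..s}. v r \<omega>)"
    and int: "\<And>s. \<lbrakk>0 \<le> s; s \<le> t\<rbrakk> \<Longrightarrow> integrable Q (k s)"
    and bound: "\<And>s. \<lbrakk>0 \<le> s; s \<le> t\<rbrakk> \<Longrightarrow> (LINT \<omega>|Q. \<bar>k s \<omega>\<bar>) \<le> B"
    and \<kappa>: "\<And>s. \<lbrakk>0 \<le> s; s \<le> t\<rbrakk> \<Longrightarrow> (LINT \<omega>|Q. k s \<omega>) \<le> \<kappa>"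
  shows "(\<integral>\<^sup>+\<omega>. v t \<omega> \<partial>Q) \<le> ennreal (\<kappa> * exp (C * t))"
proof -
  let ?w = "\<lambda>s \<omega>. exp (C * (t - s)) * k s \<omega>"
  have wm: "(\<lambda>(s, \<omega>). ?w s \<omega>) \<in> borel_measurable (borel \<Otimes>\<^sub>M Q)"
    using meas unfolding split_beta' by measurable
  have wb: "(\<integral>\<^sup>+\<omega>. \<bar>?w s \<omega>\<bar> \<partial>Q) \<le> ennreal (exp (C * t) * B)" if s: "0 \<le> s" "s \<le> t" for s
  proof -
    have "(\<integral>\<^sup>+\<omega>. \<bar>?w s \<omega>\<bar> \<partial>Q) = ennreal (LINT \<omega>|Q. \<bar>?w s \<omega>\<bar>)"
      using int[OF s] by (intro nn_integral_eq_integral) auto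
    also have "(LINT \<omega>|Q. \<bar>?w s \<omega>\<bar>) = exp (C * (t - s)) * (LINT \<omega>|Q. \<bar>k s \<omega>\<bar>)"
      by (simp add: abs_mult)
    also have "\<dots> \<le> exp (C * t) * B"
      using s C bound[OF s] by (intro mult_mono) (auto intro!: integral_nonneg_AE simp: mult_left_mono)
    finally show ?thesis by (simp add: ennreal_leI)
  qed
  note wi = expectation_set_integral[OF Q t wm wb]
  let ?R = "\<lambda>\<omega>. k t \<omega> + C * (LBINT s:{0..t}. ?w s \<omega>)"
  have vR: "v t \<omega> \<le> ?R \<omega>" if "\<omega> \<in> space Q" for \<omega>
  proof -
    have "v t \<omega> \<le> k t \<omega> + C * (LBINT r:{0..t}. v r \<omega>)" using le[OF that, of t] t by simp
    also have "\<dots> \<le> ?R \<omega>"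
      using C by (intro add_left_mono mult_left_mono gronwall_set_integral[OF t C v[OF that] k[OF that] le[OF that]]) auto
    finally show ?thesis .
  qed
  have Ri: "integrable Q ?R" using int[of t] t wi(1) by simp
  have "(\<integral>\<^sup>+\<omega>. v t \<omega> \<partial>Q) \<le> (\<integral>\<^sup>+\<omega>. ?R \<omega> \<partial>Q)"
    using vR by (intro nn_integral_mono ennreal_leI)
  also have "\<dots> = ennreal (LINT \<omega>|Q. ?R \<omega>)"
    using vR nonneg by (intro nn_integral_eq_integral Ri AE_I2) (auto intro: order_trans)
  also have "(LINT \<omega>|Q. ?R \<omega>) = (LINT \<omega>|Q. k t \<omega>) + C * (LBINT s:{0..t}. exp (C * (t - s)) * (LINT \<omega>|Q. k s \<omega>))"
    using int[of t] t wi(1,2) by simp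
  also have "\<dots> \<le> \<kappa> + C * (LBINT s:{0..t}. exp (C * (t - s)) * \<kappa>)"
  proof (intro add_mono mult_left_mono set_integral_mono)
    show "set_integrable lborel {0..t} (\<lambda>s. exp (C * (t - s)) * (LINT \<omega>|Q. k s \<omega>))"
      using wi(3) by simp
    show "set_integrable lborel {0..t} (\<lambda>s. exp (C * (t - s)) * \<kappa>)"
      by (intro borel_integrable_atLeastAtMost' continuous_intros)
  qed (use \<kappa> t C in auto)
  also have "C * (LBINT s:{0..t}. exp (C * (t - s)) * \<kappa>) = \<kappa> * (exp (C * t) - 1)"
    by (rule integral_exp_weight[OF t])
  finally show ?thesis by (simp add: algebra_simps ennreal_leI)
qed

section \<open>The inverse of a stable subordinator\<close>

lemma char_sums_moments:
  assumes "prob_space Q" and X[measurable]: "X \<in> borel_measurable Q"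
    and b: "AE \<omega> in Q. 0 \<le> X \<omega> \<and> X \<omega> \<le> 1"
  shows "(\<lambda>n. (\<i> * of_real s) ^ n / fact n * of_real (LINT \<omega>|Q. X \<omega> ^ n)) sums char (distr Q borel X) s"
proof -
  interpret prob_space Q by fact
  have powb: "AE \<omega> in Q. \<bar>X \<omega> ^ n\<bar> \<le> 1" for n
    using b by eventually_elim (auto simp: power_le_one)
  have intX: "integrable Q (\<lambda>\<omega>. X \<omega> ^ n)" for n
    by (rule integrable_const_bound[where B=1]) (use powb in auto)
  let ?f = "\<lambda>n \<omega>. (\<i> * of_real s) ^ n / fact n * complex_of_real (X \<omega> ^ n)"
  have intf: "integrable Q (?f n)" for n
    by (intro integrable_mult_right integrable_of_real intX)
  have nf: "norm (?f n \<omega>) = \<bar>s\<bar> ^ n / fact n * \<bar>X \<omega> ^ n\<bar>" for n \<omega>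
    by (simp add: norm_mult norm_divide norm_power power_abs)
  have sume: "summable (\<lambda>n. \<bar>s\<bar> ^ n / fact n)"
    using summable_exp[of "\<bar>s\<bar>"] by (simp add: field_simps)
  have ev: "(\<lambda>n. ?f n \<omega>) sums iexp (s * X \<omega>)" for \<omega>
  proof -
    have "(\<lambda>n. (\<i> * of_real s * of_real (X \<omega>)) ^ n /\<^sub>R fact n) sums exp (\<i> * of_real s * of_real (X \<omega>))"
      by (rule exp_converges)
    moreover have "(\<i> * of_real s * of_real (X \<omega>)) ^ n /\<^sub>R fact n = ?f n \<omega>" for n
      by (simp add: scaleR_conv_of_real power_mult_distrib divide_simps)
    ultimately show ?thesis by (simp add: mult.assoc)
  qed
  have "(\<lambda>n. integral\<^sup>L Q (?f n)) sums (\<integral>\<omega>. (\<Sum>n. ?f n \<omega>) \<partial>Q)"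
  proof (rule sums_integral[OF intf])
    show "AE \<omega> in Q. summable (\<lambda>n. norm (?f n \<omega>))"
      using b
    proof eventually_elim
      fix \<omega> assume "0 \<le> X \<omega> \<and> X \<omega> \<le> 1"
      then have "norm (norm (?f n \<omega>)) \<le> \<bar>s\<bar> ^ n / fact n" for n
        unfolding nf using mult_left_mono[of "\<bar>X \<omega> ^ n\<bar>" 1 "\<bar>s\<bar> ^ n / fact n"] by (auto simp: power_le_one)
      then show "summable (\<lambda>n. norm (?f n \<omega>))"
        by (intro summable_comparison_test'[OF sume])
    qed
    show "summable (\<lambda>n. \<integral>\<omega>. norm (?f n \<omega>) \<partial>Q)"
    proof (rule summable_comparison_test'[OF sume])
      fix n
      have "(\<integral>\<omega>. norm (?f n \<omega>) \<partial>Q) \<le> (\<integral>\<omega>. \<bar>s\<bar> ^ n / fact n \<partial>Q)"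
      proof (rule integral_mono_AE)
        show "AE \<omega> in Q. norm (?f n \<omega>) \<le> \<bar>s\<bar> ^ n / fact n"
          using powb[of n] unfolding nf
          by eventually_elim (use mult_left_mono[of _ 1 "\<bar>s\<bar> ^ n / fact n"] in auto)
      qed (use intf in auto)
      then show "norm (\<integral>\<omega>. norm (?f n \<omega>) \<partial>Q) \<le> \<bar>s\<bar> ^ n / fact n"
        by (simp add: prob_space)
    qed
  qed
  moreover have "integral\<^sup>L Q (?f n) = (\<i> * of_real s) ^ n / fact n * of_real (LINT \<omega>|Q. X \<omega> ^ n)" for n
    unfolding integral_mult_right_zero integral_complex_of_real ..
  moreover have "(\<integral>\<omega>. (\<Sum>n. ?f n \<omega>) \<partial>Q) = char (distr Q borel X) s"
    using ev[THEN sums_unique] by (simp add: char_def integral_distr)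
  ultimately show ?thesis by (simp only:)
qed

text \<open>A bounded variable has a characteristic function that is the power series of its moments, so
  Levy's uniqueness theorem applies.\<close>

lemma distr_eqI_moments:
  fixes X Y :: "'w \<Rightarrow> real"
  assumes Q: "prob_space Q" and X: "X \<in> borel_measurable Q" and Y: "Y \<in> borel_measurable Q"
    and "AE \<omega> in Q. 0 \<le> X \<omega> \<and> X \<omega> \<le> 1" and "AE \<omega> in Q. 0 \<le> Y \<omega> \<and> Y \<omega> \<le> 1"
    and eq: "\<And>n. (LINT \<omega>|Q. X \<omega> ^ n) = (LINT \<omega>|Q. Y \<omega> ^ n)"
  shows "distr Q borel X = distr Q borel Y"
proof (rule Levy_uniqueness)
  interpret prob_space Q by fact
  show "real_distribution (distr Q borel X)" "real_distribution (distr Q borel Y)"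
    using X Y by (auto intro: real_distribution_distr)
  show "char (distr Q borel X) = char (distr Q borel Y)"
  proof
    fix s
    from sums_unique2[OF char_sums_moments[OF Q X, of s] char_sums_moments[OF Q Y, of s, folded eq]]
    show "char (distr Q borel X) s = char (distr Q borel Y) s" using assms by auto
  qed
qed

lemma exp_decay:
  fixes c :: real
  assumes "0 < c"
  shows "((\<lambda>s. exp (- (c * s))) \<longlongrightarrow> 0) at_top"
proof (rule filterlim_compose[OF exp_at_bot])
  show "LIM s at_top. - (c * s) :> at_bot"
    using filterlim_tendsto_pos_mult_at_top[OF tendsto_const assms filterlim_ident]
    by (simp add: filterlim_uminus_at_top)
qed

lemma inverse_process_nonneg: "0 \<le> inverse_process \<sigma> t \<omega>"
  unfolding inverse_process_def by (auto intro!: cInf_greatest)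

lemma inverse_process_less_iff:
  assumes "\<exists>s>0. \<sigma> s \<omega> > t"
  shows "inverse_process \<sigma> t \<omega> < a \<longleftrightarrow> (\<exists>s>0. s < a \<and> \<sigma> s \<omega> > t)"
proof -
  have "bdd_below {s. s > 0 \<and> \<sigma> s \<omega> > t}" by (rule bdd_belowI[of _ 0]) auto
  with assms show ?thesis
    unfolding inverse_process_def by (subst if_P[OF assms], subst cInf_less_iff) auto
qed

text \<open>By monotonicity rational times suffice. The measurable space is arbitrary, so that it can be the
  \<open>\<sigma>\<close>-algebra generated by the subordinator, which is what independence of the clock needs.\<close>

lemma inverse_process_measurable:
  assumes meas: "\<And>s. 0 \<le> s \<Longrightarrow> \<sigma> s \<in> borel_measurable N"
    and mono: "\<And>\<omega>. \<omega> \<in> space N \<Longrightarrow> mono_on {0..} (\<lambda>s. \<sigma> s \<omega>)"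
  shows "inverse_process \<sigma> t \<in> borel_measurable N"
proof (rule borel_measurableI_less)
  fix a :: real
  have rat: "(\<exists>s>0. s < b \<and> t < \<sigma> s \<omega>) \<longleftrightarrow> (\<exists>q::rat. 0 < q \<and> of_rat q < b \<and> t < \<sigma> (max 0 (of_rat q)) \<omega>)"
    if \<omega>: "\<omega> \<in> space N" for \<omega> and b :: real
  proof
    assume "\<exists>s>0. s < b \<and> t < \<sigma> s \<omega>"
    then obtain s where s: "0 < s" "s < b" "t < \<sigma> s \<omega>" by blast
    obtain q where q: "s < of_rat q" "of_rat q < b" using of_rat_dense[OF s(2)] by blast
    have "\<sigma> s \<omega> \<le> \<sigma> (of_rat q) \<omega>"
      using s q less_trans[OF s(1) q(1)] by (intro mono_onD[OF mono[OF \<omega>]]) auto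
    moreover have "0 < (of_rat q :: real)" using s q by linarith
    ultimately show "\<exists>q::rat. 0 < q \<and> of_rat q < b \<and> t < \<sigma> (max 0 (of_rat q)) \<omega>"
      using s q by (intro exI[of _ q]) auto
  next
    assume "\<exists>q::rat. 0 < q \<and> of_rat q < b \<and> t < \<sigma> (max 0 (of_rat q)) \<omega>"
    then obtain q :: rat where q: "0 < q" "of_rat q < b" "t < \<sigma> (max 0 (of_rat q)) \<omega>" by blast
    then have "max 0 (of_rat q :: real) = of_rat q" "0 < (of_rat q :: real)" by auto
    then show "\<exists>s>0. s < b \<and> t < \<sigma> s \<omega>" using q by (intro exI[of _ "of_rat q"]) auto
  qed
  have ex: "(\<exists>s>0. t < \<sigma> s \<omega>) \<longleftrightarrow> (\<exists>q::rat. 0 < q \<and> t < \<sigma> (max 0 (of_rat q)) \<omega>)" if "\<omega> \<in> space N" for \<omega>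
  proof
    assume "\<exists>s>0. t < \<sigma> s \<omega>"
    then obtain s where "0 < s" "t < \<sigma> s \<omega>" by blast
    then have "\<exists>s'>0. s' < s + 1 \<and> t < \<sigma> s' \<omega>" by (intro exI[of _ s]) auto
    then show "\<exists>q::rat. 0 < q \<and> t < \<sigma> (max 0 (of_rat q)) \<omega>" unfolding rat[OF that] by blast
  next
    assume "\<exists>q::rat. 0 < q \<and> t < \<sigma> (max 0 (of_rat q)) \<omega>"
    then obtain q :: rat where "0 < q" "t < \<sigma> (max 0 (of_rat q)) \<omega>" by blast
    then show "\<exists>s>0. t < \<sigma> s \<omega>" by (intro exI[of _ "max 0 (of_rat q)"]) auto
  qed
  have m[measurable]: "(\<lambda>\<omega>. \<sigma> (max 0 (of_rat q)) \<omega>) \<in> borel_measurable N" for q :: rat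
    by (rule meas) simp
  have "{\<omega> \<in> space N. inverse_process \<sigma> t \<omega> < a} =
    {\<omega> \<in> space N. if (\<exists>q::rat. 0 < q \<and> t < \<sigma> (max 0 (of_rat q)) \<omega>)
       then (\<exists>q::rat. 0 < q \<and> of_rat q < a \<and> t < \<sigma> (max 0 (of_rat q)) \<omega>) else 0 < a}"
    using ex rat[of _ a] inverse_process_less_iff[of t \<sigma> _ a]
    by (intro Collect_cong conj_cong refl) (auto simp: inverse_process_def)
  also have "\<dots> \<in> sets N" by measurable
  finally show "{\<omega> \<in> space N. inverse_process \<sigma> t \<omega> < a} \<in> sets N" .
qed

lemma nn_integral_FTC_open:
  fixes f F :: "real \<Rightarrow> real"
  assumes [measurable]: "f \<in> borel_measurable borel"
    and F: "\<And>s. (F has_real_derivative f s) (at s)" and f: "\<And>s. 0 \<le> s \<Longrightarrow> 0 \<le> f s" and c: "0 \<le> c"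
  shows "(\<integral>\<^sup>+s. ennreal (f s) * indicator {0<..<c} s \<partial>lborel) = ennreal (F c - F 0)"
proof -
  have "(\<integral>\<^sup>+s. ennreal (f s) * indicator {0<..<c} s \<partial>lborel) = (\<integral>\<^sup>+s. ennreal (f s) * indicator {0..c} s \<partial>lborel)"
  proof (rule nn_integral_cong_AE)
    show "AE s in lborel. ennreal (f s) * indicator {0<..<c} s = ennreal (f s) * indicator {0..c} s"
      using AE_lborel_singleton[of 0] AE_lborel_singleton[of c]
      by eventually_elim (auto simp: indicator_def)
  qed
  also have "\<dots> = F c - F 0"
    by (rule nn_integral_FTC_Icc) (use assms in auto)
  finally show ?thesis .
qed

locale stable_clock = prob_space Q for Q :: "'w measure" +
  fixes \<sigma> :: "real \<Rightarrow> 'w \<Rightarrow> real" and \<alpha> :: real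
  assumes \<alpha>_pos: "0 < \<alpha>" and subordinator: "stable_subordinator \<alpha> Q \<sigma>"
begin

abbreviation clock :: "real \<Rightarrow> 'w \<Rightarrow> real" where
  "clock t \<equiv> inverse_process \<sigma> t"

lemma meas_\<sigma>[measurable]: "0 \<le> s \<Longrightarrow> \<sigma> s \<in> borel_measurable Q"
  using subordinator by (auto simp: stable_subordinator_def levy_process_def)

lemma mono_\<sigma>: "\<lbrakk>\<omega> \<in> space Q; 0 \<le> r; r \<le> s\<rbrakk> \<Longrightarrow> \<sigma> r \<omega> \<le> \<sigma> s \<omega>"
  using subordinator mono_onD[of "{0..}" "\<lambda>t. \<sigma> t \<omega>" r s] by (auto simp: stable_subordinator_def)

lemma laplace_\<sigma>: "\<lbrakk>0 < s; 0 < l\<rbrakk> \<Longrightarrow> (LINT \<omega>|Q. exp (- (l * \<sigma> s \<omega>))) = exp (- (s * l powr \<alpha>))"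
  using subordinator by (auto simp: stable_subordinator_def)

lemma \<sigma>_nonneg: "AE \<omega> in Q. \<forall>s\<ge>0. 0 \<le> \<sigma> s \<omega>"
proof -
  have "AE \<omega> in Q. \<sigma> 0 \<omega> = 0"
    using subordinator by (auto simp: stable_subordinator_def levy_process_def)
  with AE_space show ?thesis by eventually_elim (use mono_\<sigma>[of _ 0] in fastforce)
qed

lemma integrable_exp_\<sigma>: "\<lbrakk>0 \<le> s; 0 \<le> l\<rbrakk> \<Longrightarrow> integrable Q (\<lambda>\<omega>. exp (- (l * \<sigma> s \<omega>)))"
  using \<sigma>_nonneg by (intro integrable_const_bound[where B=1]) auto

lemma jointly_measurable_\<sigma>[measurable]:
  "(\<lambda>(s, \<omega>). \<sigma> (max 0 s) \<omega>) \<in> borel_measurable (borel \<Otimes>\<^sub>M Q)"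
  using subordinator
  by (intro right_continuous_jointly_measurable meas_\<sigma>)
    (auto simp: stable_subordinator_def levy_process_def cadlag_def)

lemma clock_measurable[measurable]: "clock t \<in> borel_measurable Q"
  using subordinator by (intro inverse_process_measurable meas_\<sigma>) (auto simp: stable_subordinator_def)

text \<open>Markov's inequality for \<open>e\<^bsup>-l\<sigma>\<^esup>\<close>. With \<open>l\<close> free this makes the tail of the clock decay faster than
  any exponential.\<close>

lemma prob_\<sigma>_le:
  assumes "0 < s" "0 < l"
  shows "prob {\<omega> \<in> space Q. \<sigma> s \<omega> \<le> t} \<le> exp (l * t) * exp (- (s * l powr \<alpha>))"
proof -
  have [measurable]: "\<sigma> s \<in> borel_measurable Q" using assms by simp
  have "prob {\<omega> \<in> space Q. \<sigma> s \<omega> \<le> t} = (LINT \<omega>|Q. indicator {\<omega> \<in> space Q. \<sigma> s \<omega> \<le> t} \<omega>)"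
    by simp
  also have "\<dots> \<le> (LINT \<omega>|Q. exp (l * t) * exp (- (l * \<sigma> s \<omega>)))"
  proof (rule integral_mono)
    show "integrable Q (\<lambda>\<omega>. exp (l * t) * exp (- (l * \<sigma> s \<omega>)))"
      using assms by (intro integrable_mult_right integrable_exp_\<sigma>) auto
    show "indicator {\<omega> \<in> space Q. \<sigma> s \<omega> \<le> t} \<omega> \<le> exp (l * t) * exp (- (l * \<sigma> s \<omega>))" for \<omega>
      using assms by (auto simp: indicator_def simp flip: exp_add)
  qed (auto intro!: integrable_real_indicator simp: emeasure_eq_measure)
  also have "\<dots> = exp (l * t) * exp (- (s * l powr \<alpha>))"
    using assms by (simp add: laplace_\<sigma>)
  finally show ?thesis .
qed

lemma \<sigma>_unbounded: "AE \<omega> in Q. \<exists>s>0. \<sigma> s \<omega> > t"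
proof -
  let ?A = "\<lambda>n. {\<omega> \<in> space Q. \<sigma> (real (Suc n)) \<omega> \<le> t}"
  have "(\<lambda>n. exp t * exp (- 1) ^ Suc n) \<longlonglongrightarrow> exp t * 0"
    by (intro tendsto_mult_left LIMSEQ_Suc LIMSEQ_power_zero) simp
  then have lim: "(\<lambda>n. exp t * exp (- 1) ^ Suc n) \<longlonglongrightarrow> 0" by simp
  have le: "prob (?A n) \<le> exp t * exp (- 1) ^ Suc n" for n
  proof -
    have "exp (- 1) ^ Suc n = exp (- real (Suc n))"
      by (simp only: exp_of_nat_mult[symmetric] mult_minus_right mult_1_right)
    then show ?thesis using prob_\<sigma>_le[of "real (Suc n)" 1 t] by simp
  qed
  have "(\<lambda>n. prob (?A n)) \<longlonglongrightarrow> 0"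
    by (rule tendsto_sandwich[OF _ _ tendsto_const lim])
      (rule always_eventually, rule allI, rule measure_nonneg, rule always_eventually, rule allI, rule le)
  moreover have "prob (\<Inter>n. ?A n) \<le> prob (?A n)" for n
    by (intro finite_measure_mono) auto
  ultimately have "prob (\<Inter>n. ?A n) \<le> 0"
    by (intro LIMSEQ_le_const) auto
  then have "prob (\<Inter>n. ?A n) = 0" by (simp add: measure_le_0_iff)
  moreover have "(\<Inter>n. ?A n) \<in> events" by measurable
  ultimately have "(\<Inter>n. ?A n) \<in> null_sets Q" by (auto simp: emeasure_eq_measure)
  from AE_not_in[OF this] AE_space show ?thesis
  proof eventually_elim
    fix \<omega> assume "\<omega> \<notin> (\<Inter>n. ?A n)" "\<omega> \<in> space Q"
    then obtain n where "\<sigma> (real (Suc n)) \<omega> > t" by (auto simp: not_le)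
    then show "\<exists>s>0. \<sigma> s \<omega> > t" by (intro exI[of _ "real (Suc n)"]) auto
  qed
qed

text \<open>The layer cake formula for the clock: \<open>s\<close> lies before \<open>L\<^sub>t\<close> exactly when \<open>\<sigma>\<^sub>s \<le> t\<close>, except for one \<open>s\<close>.\<close>

lemma nn_integral_clock_layers:
  fixes h :: "real \<Rightarrow> ennreal"
  assumes [measurable]: "h \<in> borel_measurable borel"
  shows "(\<integral>\<^sup>+\<omega>. (\<integral>\<^sup>+s. h s * indicator {0<..<clock t \<omega>} s \<partial>lborel) \<partial>Q) =
    (\<integral>\<^sup>+s. h s * indicator {0<..} s * prob {\<omega> \<in> space Q. \<sigma> s \<omega> \<le> t} \<partial>lborel)"
proof -
  interpret pair_sigma_finite lborel Q ..
  let ?g = "\<lambda>s \<omega>. h s * indicator {0<..} s * indicator {..t} (\<sigma> (max 0 s) \<omega>)"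
  have [measurable]: "(\<lambda>(s, \<omega>). ?g s \<omega>) \<in> borel_measurable (lborel \<Otimes>\<^sub>M Q)"
    by measurable
  have "(\<integral>\<^sup>+\<omega>. (\<integral>\<^sup>+s. h s * indicator {0<..<clock t \<omega>} s \<partial>lborel) \<partial>Q) = (\<integral>\<^sup>+\<omega>. (\<integral>\<^sup>+s. ?g s \<omega> \<partial>lborel) \<partial>Q)"
  proof (rule nn_integral_cong_AE)
    show "AE \<omega> in Q. (\<integral>\<^sup>+s. h s * indicator {0<..<clock t \<omega>} s \<partial>lborel) = (\<integral>\<^sup>+s. ?g s \<omega> \<partial>lborel)"
      using \<sigma>_unbounded[of t] AE_space
    proof eventually_elim
      fix \<omega> assume ex: "\<exists>s>0. \<sigma> s \<omega> > t" and \<omega>: "\<omega> \<in> space Q"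
      have bdd: "bdd_below {s. s > 0 \<and> \<sigma> s \<omega> > t}" by (rule bdd_belowI[of _ 0]) auto
      have clock: "clock t \<omega> = Inf {s. s > 0 \<and> \<sigma> s \<omega> > t}" using ex by (simp add: inverse_process_def)
      show "(\<integral>\<^sup>+s. h s * indicator {0<..<clock t \<omega>} s \<partial>lborel) = (\<integral>\<^sup>+s. ?g s \<omega> \<partial>lborel)"
      proof (rule nn_integral_cong_AE)
        \<comment> \<open>At \<open>s = clock t \<omega>\<close> itself either case may occur.\<close>
        show "AE s in lborel. h s * indicator {0<..<clock t \<omega>} s = ?g s \<omega>"
          using AE_lborel_singleton[of "clock t \<omega>"]
        proof eventually_elim
          fix s assume ne: "s \<noteq> clock t \<omega>"
          have "s < clock t \<omega> \<longleftrightarrow> \<sigma> s \<omega> \<le> t" if "0 < s"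
          proof
            assume "s < clock t \<omega>"
            then show "\<sigma> s \<omega> \<le> t" unfolding clock using cInf_lower[OF _ bdd, of s] that by force
          next
            assume le: "\<sigma> s \<omega> \<le> t"
            have "s \<le> clock t \<omega>" unfolding clock
            proof (rule cInf_greatest)
              fix r assume "r \<in> {s. s > 0 \<and> \<sigma> s \<omega> > t}"
              then show "s \<le> r" using mono_\<sigma>[OF \<omega>, of r s] le by force
            qed (use ex in auto)
            then show "s < clock t \<omega>" using ne by simp
          qed
          then show "h s * indicator {0<..<clock t \<omega>} s = ?g s \<omega>"
            by (auto simp: indicator_def)
        qed
      qed
    qed
  qed
  also have "\<dots> = (\<integral>\<^sup>+s. (\<integral>\<^sup>+\<omega>. ?g s \<omega> \<partial>Q) \<partial>lborel)"
    by (rule Fubini') measurable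
  also have "\<dots> = (\<integral>\<^sup>+s. h s * indicator {0<..} s * prob {\<omega> \<in> space Q. \<sigma> s \<omega> \<le> t} \<partial>lborel)"
  proof (rule nn_integral_cong)
    fix s
    show "(\<integral>\<^sup>+\<omega>. ?g s \<omega> \<partial>Q) = h s * indicator {0<..} s * prob {\<omega> \<in> space Q. \<sigma> s \<omega> \<le> t}"
    proof (cases "0 < s")
      case True
      have [measurable]: "\<sigma> s \<in> borel_measurable Q" using True by simp
      have "(\<integral>\<^sup>+\<omega>. ?g s \<omega> \<partial>Q) = h s * (\<integral>\<^sup>+\<omega>. indicator {..t} (\<sigma> s \<omega>) \<partial>Q)"
        using True by (subst nn_integral_cmult[symmetric]) (auto simp: max_def)
      also have "(\<integral>\<^sup>+\<omega>. indicator {..t} (\<sigma> s \<omega>) \<partial>Q) = (\<integral>\<^sup>+\<omega>. indicator {\<omega> \<in> space Q. \<sigma> s \<omega> \<le> t} \<omega> \<partial>Q)"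
        by (intro nn_integral_cong) (auto simp: indicator_def)
      also have "\<dots> = prob {\<omega> \<in> space Q. \<sigma> s \<omega> \<le> t}"
        by (subst nn_integral_indicator) (auto simp: emeasure_eq_measure)
      finally show ?thesis using True by simp
    qed simp
  qed
  finally show ?thesis .
qed

text \<open>Self-similarity, \<open>\<sigma>\<^sub>s / t\<close> and \<open>\<sigma>\<close> at time \<open>s t\<^bsup>-\<alpha>\<^esup>\<close> having the same law: the moments of \<open>e\<^bsup>-\<sigma>\<^esup>\<close> are values of
  the Laplace transform, and \<open>e\<^bsup>-\<sigma>\<^esup>\<close> is bounded.\<close>

lemma prob_\<sigma>_scaling:
  assumes s: "0 < s" and t: "0 < t"
  shows "prob {\<omega> \<in> space Q. \<sigma> s \<omega> \<le> t} = prob {\<omega> \<in> space Q. \<sigma> (s * t powr - \<alpha>) \<omega> \<le> 1}"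
proof -
  let ?r = "s * t powr - \<alpha>"
  let ?X = "\<lambda>\<omega>. exp (- ((1 / t) * \<sigma> s \<omega>))" and ?Y = "\<lambda>\<omega>. exp (- (1 * \<sigma> ?r \<omega>))"
  have r: "0 < ?r" using assms by simp
  have [measurable]: "\<sigma> s \<in> borel_measurable Q" "\<sigma> ?r \<in> borel_measurable Q"
    using s r by auto
  have "distr Q borel ?X = distr Q borel ?Y"
  proof (rule distr_eqI_moments[OF prob_space_axioms])
    show "AE \<omega> in Q. 0 \<le> ?X \<omega> \<and> ?X \<omega> \<le> 1" "AE \<omega> in Q. 0 \<le> ?Y \<omega> \<and> ?Y \<omega> \<le> 1"
      using \<sigma>_nonneg s r t by auto
    fix n
    show "(LINT \<omega>|Q. ?X \<omega> ^ n) = (LINT \<omega>|Q. ?Y \<omega> ^ n)"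
    proof (cases "n = 0")
      case False
      have "(LINT \<omega>|Q. ?X \<omega> ^ n) = (LINT \<omega>|Q. exp (- ((real n / t) * \<sigma> s \<omega>)))"
        by (simp flip: exp_of_nat_mult)
      also have "\<dots> = exp (- (s * (real n / t) powr \<alpha>))"
        using False s t by (intro laplace_\<sigma>) auto
      also have "s * (real n / t) powr \<alpha> = ?r * real n powr \<alpha>"
        using t by (simp add: powr_divide powr_minus_divide)
      also have "exp (- (?r * real n powr \<alpha>)) = (LINT \<omega>|Q. exp (- (real n * \<sigma> ?r \<omega>)))"
        using False r by (intro laplace_\<sigma>[symmetric]) auto
      also have "\<dots> = (LINT \<omega>|Q. ?Y \<omega> ^ n)"
        by (simp flip: exp_of_nat_mult)
      finally show ?thesis .
    qed simp
  qed measurable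
  then have "measure (distr Q borel ?X) {exp (- 1)..} = measure (distr Q borel ?Y) {exp (- 1)..}"
    by simp
  then have "prob (?X -` {exp (- 1)..} \<inter> space Q) = prob (?Y -` {exp (- 1)..} \<inter> space Q)"
    by (subst (asm) (1 2) measure_distr) auto
  moreover have "?X -` {exp (- 1)..} \<inter> space Q = {\<omega> \<in> space Q. \<sigma> s \<omega> \<le> t}"
    using t by (auto simp: field_simps)
  moreover have "?Y -` {exp (- 1)..} \<inter> space Q = {\<omega> \<in> space Q. \<sigma> ?r \<omega> \<le> 1}"
    by auto
  ultimately show ?thesis by simp
qed

lemma integrable_exp_clock:
  assumes \<theta>: "0 < \<theta>"
  shows "integrable Q (\<lambda>\<omega>. exp (\<theta> * clock t \<omega>))"
proof (rule integrableI_nonneg)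
  \<comment> \<open>This \<open>l\<close> makes the tail bound \<open>e\<^bsup>lt - 2\<theta>s\<^esup>\<close>, which beats the density \<open>\<theta> e\<^bsup>\<theta>s\<^esup>\<close>.\<close>
  define l where "l = (2 * \<theta>) powr (1 / \<alpha>)"
  have l: "0 < l" "l powr \<alpha> = 2 * \<theta>" using \<theta> \<alpha>_pos by (auto simp: l_def powr_powr)
  have layer: "ennreal (exp (\<theta> * c)) = 1 + (\<integral>\<^sup>+s. ennreal (\<theta> * exp (\<theta> * s)) * indicator {0<..<c} s \<partial>lborel)" if "0 \<le> c" for c
  proof -
    have "(\<integral>\<^sup>+s. ennreal (\<theta> * exp (\<theta> * s)) * indicator {0<..<c} s \<partial>lborel) = ennreal (exp (\<theta> * c) - exp (\<theta> * 0))"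
      by (rule nn_integral_FTC_open) (use that \<theta> in \<open>auto intro!: derivative_eq_intros\<close>)
    then show ?thesis using that \<theta>
      by (simp add: ennreal_plus[symmetric] flip: ennreal_1 del: ennreal_plus)
  qed
  have "(\<integral>\<^sup>+\<omega>. ennreal (exp (\<theta> * clock t \<omega>)) \<partial>Q) =
    (\<integral>\<^sup>+\<omega>. 1 + (\<integral>\<^sup>+s. ennreal (\<theta> * exp (\<theta> * s)) * indicator {0<..<clock t \<omega>} s \<partial>lborel) \<partial>Q)"
    by (intro nn_integral_cong layer inverse_process_nonneg)
  also have "\<dots> = 1 + (\<integral>\<^sup>+\<omega>. (\<integral>\<^sup>+s. ennreal (\<theta> * exp (\<theta> * s)) * indicator {0<..<clock t \<omega>} s \<partial>lborel) \<partial>Q)"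
    unfolding indicator_def greaterThanLessThan_iff by (subst nn_integral_add) (auto simp: emeasure_space_1)
  also have "\<dots> = 1 + (\<integral>\<^sup>+s. ennreal (\<theta> * exp (\<theta> * s)) * indicator {0<..} s * prob {\<omega> \<in> space Q. \<sigma> s \<omega> \<le> t} \<partial>lborel)"
    by (subst nn_integral_clock_layers) auto
  also have "\<dots> \<le> 1 + (\<integral>\<^sup>+s. ennreal (exp (l * t) * (\<theta> * exp (- (\<theta> * s)))) * indicator {0..} s \<partial>lborel)"
  proof (intro add_left_mono nn_integral_mono)
    fix s
    show "ennreal (\<theta> * exp (\<theta> * s)) * indicator {0<..} s * prob {\<omega> \<in> space Q. \<sigma> s \<omega> \<le> t} \<le>
      ennreal (exp (l * t) * (\<theta> * exp (- (\<theta> * s)))) * indicator {0..} s"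
    proof (cases "0 < s")
      case True
      have "\<theta> * exp (\<theta> * s) * prob {\<omega> \<in> space Q. \<sigma> s \<omega> \<le> t} \<le> \<theta> * exp (\<theta> * s) * (exp (l * t) * exp (- (s * (2 * \<theta>))))"
        using prob_\<sigma>_le[OF True l(1), of t] \<theta> by (intro mult_left_mono) (auto simp: l)
      also have "\<dots> = exp (l * t) * (\<theta> * (exp (\<theta> * s) * exp (- (s * (2 * \<theta>)))))" by simp
      also have "exp (\<theta> * s) * exp (- (s * (2 * \<theta>))) = exp (- (\<theta> * s))"
        by (simp flip: exp_add)
      finally show ?thesis using True \<theta>
        by (simp add: ennreal_mult[symmetric] ennreal_leI)
    qed simp
  qed
  also have "(\<integral>\<^sup>+s. ennreal (exp (l * t) * (\<theta> * exp (- (\<theta> * s)))) * indicator {0..} s \<partial>lborel) = ennreal (0 - - exp (l * t) * exp (- (\<theta> * 0)))"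
  proof (rule nn_integral_FTC_atLeast)
    show "((\<lambda>s. - exp (l * t) * exp (- (\<theta> * s))) \<longlongrightarrow> 0) at_top"
      using tendsto_mult_right_zero[OF exp_decay[OF \<theta>], of "- exp (l * t)"] by simp
  qed (use \<theta> in \<open>auto intro!: derivative_eq_intros\<close>)
  also have "1 + \<dots> < \<infinity>" by simp
  finally show "(\<integral>\<^sup>+\<omega>. ennreal (exp (\<theta> * clock t \<omega>)) \<partial>Q) < \<infinity>" .
qed auto

lemma nn_moment_clock_layers:
  assumes k: "0 < k"
  shows "(\<integral>\<^sup>+\<omega>. ennreal (clock t \<omega> ^ k) \<partial>Q) =
    (\<integral>\<^sup>+s. ennreal (real k * s ^ (k - 1)) * indicator {0<..} s * prob {\<omega> \<in> space Q. \<sigma> s \<omega> \<le> t} \<partial>lborel)"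
proof -
  have layer: "ennreal (c ^ k) = (\<integral>\<^sup>+s. ennreal (real k * s ^ (k - 1)) * indicator {0<..<c} s \<partial>lborel)" if "0 \<le> c" for c :: real
  proof -
    have "(\<integral>\<^sup>+s. ennreal (real k * s ^ (k - 1)) * indicator {0<..<c} s \<partial>lborel) = ennreal (c ^ k - 0 ^ k)"
      by (rule nn_integral_FTC_open) (use that k in \<open>auto intro!: derivative_eq_intros\<close>)
    then show ?thesis using k by (simp add: zero_power)
  qed
  show ?thesis
    by (subst nn_integral_clock_layers[symmetric], measurable)
      (intro nn_integral_cong layer inverse_process_nonneg)
qed

text \<open>Both sides are the Laplace transform of \<open>\<sigma>\<^sub>s\<close> at \<open>1\<close>: exchange the integral over \<open>t\<close> with the
  expectation, and integrate \<open>e\<^bsup>-t\<^esup>\<close> from \<open>\<sigma>\<^sub>s\<close> on.\<close>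

lemma nn_laplace_prob_\<sigma>:
  assumes s: "0 < s"
  shows "(\<integral>\<^sup>+t. ennreal (exp (- t)) * indicator {0<..} t * prob {\<omega> \<in> space Q. \<sigma> s \<omega> \<le> t} \<partial>lborel) = ennreal (exp (- s))"
proof -
  interpret pair_sigma_finite lborel Q ..
  have [measurable]: "\<sigma> s \<in> borel_measurable Q" using s by simp
  have ind: "ennreal (prob {\<omega> \<in> space Q. \<sigma> s \<omega> \<le> t}) = (\<integral>\<^sup>+\<omega>. of_bool (\<sigma> s \<omega> \<le> t) \<partial>Q)" for t
  proof -
    have "(\<integral>\<^sup>+\<omega>. of_bool (\<sigma> s \<omega> \<le> t) \<partial>Q) = (\<integral>\<^sup>+\<omega>. indicator {\<omega> \<in> space Q. \<sigma> s \<omega> \<le> t} \<omega> \<partial>Q)"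
      by (intro nn_integral_cong) (auto simp: indicator_def)
    also have "\<dots> = prob {\<omega> \<in> space Q. \<sigma> s \<omega> \<le> t}"
      by (subst nn_integral_indicator) (auto simp: emeasure_eq_measure)
    finally show ?thesis ..
  qed
  have "(\<integral>\<^sup>+t. ennreal (exp (- t)) * indicator {0<..} t * prob {\<omega> \<in> space Q. \<sigma> s \<omega> \<le> t} \<partial>lborel)
    = (\<integral>\<^sup>+t. (\<integral>\<^sup>+\<omega>. ennreal (exp (- t)) * of_bool (0 < t) * of_bool (\<sigma> s \<omega> \<le> t) \<partial>Q) \<partial>lborel)"
    unfolding ind by (subst nn_integral_cmult) (auto simp: indicator_def)
  also have "\<dots> = (\<integral>\<^sup>+\<omega>. (\<integral>\<^sup>+t. ennreal (exp (- t)) * of_bool (0 < t) * of_bool (\<sigma> s \<omega> \<le> t) \<partial>lborel) \<partial>Q)"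
    by (rule Fubini'[symmetric]) measurable
  also have "\<dots> = (\<integral>\<^sup>+\<omega>. ennreal (exp (- (1 * \<sigma> s \<omega>))) \<partial>Q)"
  proof (rule nn_integral_cong_AE)
    show "AE \<omega> in Q. (\<integral>\<^sup>+t. ennreal (exp (- t)) * of_bool (0 < t) * of_bool (\<sigma> s \<omega> \<le> t) \<partial>lborel) = ennreal (exp (- (1 * \<sigma> s \<omega>)))"
      using \<sigma>_nonneg
    proof eventually_elim
      fix \<omega> assume "\<forall>s\<ge>0. 0 \<le> \<sigma> s \<omega>"
      then have n: "0 \<le> \<sigma> s \<omega>" using s by simp
      have "(\<integral>\<^sup>+t. ennreal (exp (- t)) * of_bool (0 < t) * of_bool (\<sigma> s \<omega> \<le> t) \<partial>lborel)
        = (\<integral>\<^sup>+t. ennreal (exp (- t)) * indicator {\<sigma> s \<omega>..} t \<partial>lborel)"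
      proof (rule nn_integral_cong_AE)
        show "AE t in lborel. ennreal (exp (- t)) * of_bool (0 < t) * of_bool (\<sigma> s \<omega> \<le> t) = ennreal (exp (- t)) * indicator {\<sigma> s \<omega>..} t"
          using AE_lborel_singleton[of 0]
          by eventually_elim (use n in \<open>auto simp: indicator_def\<close>)
      qed
      also have "\<dots> = ennreal (0 - - exp (- \<sigma> s \<omega>))"
      proof (rule nn_integral_FTC_atLeast)
        show "((\<lambda>t. - exp (- t)) \<longlongrightarrow> (0::real)) at_top"
          using tendsto_minus[OF exp_decay[of 1]] by simp
      qed (auto intro!: derivative_eq_intros)
      finally show "(\<integral>\<^sup>+t. ennreal (exp (- t)) * of_bool (0 < t) * of_bool (\<sigma> s \<omega> \<le> t) \<partial>lborel) = ennreal (exp (- (1 * \<sigma> s \<omega>)))"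
        by simp
    qed
  qed
  also have "\<dots> = ennreal (LINT \<omega>|Q. exp (- (1 * \<sigma> s \<omega>)))"
    using s by (intro nn_integral_eq_integral integrable_exp_\<sigma>) auto
  also have "\<dots> = ennreal (exp (- s))" using laplace_\<sigma>[OF s, of 1] by simp
  finally show ?thesis .
qed

text \<open>Scaling reduces the moment to the one at time \<open>1\<close>, the constant \<open>c\<close> below, which a Laplace
  transform at the single point \<open>1\<close> then determines.\<close>

lemma nn_moment_clock:
  assumes t: "0 < t"
  shows "(\<integral>\<^sup>+\<omega>. ennreal (clock t \<omega> ^ k) \<partial>Q) = ennreal (t powr (\<alpha> * real k) * fact k / Gamma (\<alpha> * real k + 1))"
proof (cases "k = 0")
  case True then show ?thesis using t by (simp add: emeasure_space_1)
next
  case False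
  then have k: "0 < k" by simp
  define F where "F r = (\<integral>\<^sup>+\<omega>. indicator {..1} (\<sigma> (max 0 r) \<omega>) \<partial>Q)" for r :: real
  have [measurable]: "F \<in> borel_measurable borel"
    unfolding F_def[abs_def] by measurable
  have F: "ennreal (prob {\<omega> \<in> space Q. \<sigma> s \<omega> \<le> r}) = F (s * r powr - \<alpha>)" if "0 < s" "0 < r" for s r
  proof -
    have [measurable]: "\<sigma> (s * r powr - \<alpha>) \<in> borel_measurable Q" using that by simp
    have "F (s * r powr - \<alpha>) = (\<integral>\<^sup>+\<omega>. indicator {\<omega> \<in> space Q. \<sigma> (s * r powr - \<alpha>) \<omega> \<le> 1} \<omega> \<partial>Q)"
      unfolding F_def using that by (intro nn_integral_cong) (auto simp: indicator_def)
    also have "\<dots> = prob {\<omega> \<in> space Q. \<sigma> (s * r powr - \<alpha>) \<omega> \<le> 1}"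
      by (subst nn_integral_indicator) (auto simp: emeasure_eq_measure)
    finally show ?thesis using prob_\<sigma>_scaling[OF that] by simp
  qed
  let ?h = "\<lambda>s. ennreal (real k * s ^ (k - 1)) * indicator {0<..} s"
  define c where "c = (\<integral>\<^sup>+s. ?h s * F s \<partial>lborel)"
  have moment: "(\<integral>\<^sup>+\<omega>. ennreal (clock r \<omega> ^ k) \<partial>Q) = (\<integral>\<^sup>+s. ?h s * F (s * r powr - \<alpha>) \<partial>lborel)" if "0 < r" for r
    unfolding nn_moment_clock_layers[OF k] using F[OF _ that] by (intro nn_integral_cong) (auto simp: indicator_def)
  \<comment> \<open>Substituting \<open>s = r\<^sup>\<alpha> s'\<close> in the layer cake formula.\<close>
  have scaled: "(\<integral>\<^sup>+s. ?h s * F (s * r powr - \<alpha>) \<partial>lborel) = ennreal (r powr (\<alpha> * real k)) * c" if r: "0 < r" for r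
  proof -
    have "(\<integral>\<^sup>+s. ?h s * F (s * r powr - \<alpha>) \<partial>lborel)
      = \<bar>r powr \<alpha>\<bar> * (\<integral>\<^sup>+s. ?h (0 + r powr \<alpha> * s) * F ((0 + r powr \<alpha> * s) * r powr - \<alpha>) \<partial>lborel)"
      using r by (intro nn_integral_real_affine) auto
    also have "(\<integral>\<^sup>+s. ?h (0 + r powr \<alpha> * s) * F ((0 + r powr \<alpha> * s) * r powr - \<alpha>) \<partial>lborel)
      = (\<integral>\<^sup>+s. ennreal ((r powr \<alpha>) ^ (k - 1)) * (?h s * F s) \<partial>lborel)"
    proof (intro nn_integral_cong)
      fix s
      have "r powr \<alpha> * s * r powr - \<alpha> = s" using r by (simp add: powr_minus field_simps)
      moreover have "?h (r powr \<alpha> * s) = ennreal ((r powr \<alpha>) ^ (k - 1)) * ?h s"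
        using r by (cases "0 < s")
          (auto simp: power_mult_distrib ennreal_mult[symmetric] mult.left_commute zero_less_mult_iff)
      ultimately show "?h (0 + r powr \<alpha> * s) * F ((0 + r powr \<alpha> * s) * r powr - \<alpha>) = ennreal ((r powr \<alpha>) ^ (k - 1)) * (?h s * F s)"
        by (simp only: add_0 mult.assoc)
    qed
    also have "\<dots> = ennreal ((r powr \<alpha>) ^ (k - 1)) * c"
      unfolding c_def by (intro nn_integral_cmult) measurable
    also have "\<bar>r powr \<alpha>\<bar> * (ennreal ((r powr \<alpha>) ^ (k - 1)) * c) = ennreal ((r powr \<alpha>) ^ k) * c"
      using k by (simp add: mult.assoc[symmetric] ennreal_mult[symmetric] power_Suc[symmetric] del: power_Suc)
    also have "(r powr \<alpha>) ^ k = r powr (\<alpha> * real k)"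
      using r by (simp add: powr_powr[symmetric] powr_realpow)
    finally show ?thesis .
  qed
  \<comment> \<open>The double integral of \<open>e\<^bsup>-r\<^esup> k s\<^bsup>k-1\<^esup> P(\<sigma>\<^sub>s \<le> r)\<close> in both orders: \<open>s\<close> first gives \<open>\<Gamma>(\<alpha>k + 1) c\<close>, and \<open>r\<close> first
    gives the integral of \<open>k s\<^bsup>k-1\<^esup> e\<^bsup>-s\<^esup>\<close>, which is \<open>k!\<close>.\<close>
  have "ennreal (Gamma (\<alpha> * real k + 1)) * c = (\<integral>\<^sup>+r. ennreal (indicator {0..} r * r powr (\<alpha> * real k + 1 - 1) / exp r) * c \<partial>lborel)"
    using \<alpha>_pos k by (subst Gamma_conv_nn_integral_real) (auto simp: add_pos_pos intro!: nn_integral_multc[symmetric])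
  also have "\<dots> = (\<integral>\<^sup>+r. ennreal (exp (- r)) * indicator {0<..} r * (ennreal (r powr (\<alpha> * real k)) * c) \<partial>lborel)"
  proof (rule nn_integral_cong_AE)
    show "AE r in lborel. ennreal (indicator {0..} r * r powr (\<alpha> * real k + 1 - 1) / exp r) * c
       = ennreal (exp (- r)) * indicator {0<..} r * (ennreal (r powr (\<alpha> * real k)) * c)"
      using AE_lborel_singleton[of 0]
    proof eventually_elim
      fix r :: real assume "r \<noteq> 0"
      then show "ennreal (indicator {0..} r * r powr (\<alpha> * real k + 1 - 1) / exp r) * c
       = ennreal (exp (- r)) * indicator {0<..} r * (ennreal (r powr (\<alpha> * real k)) * c)"
        by (cases "0 < r") (auto simp: exp_minus field_simps ennreal_mult[symmetric] mult.assoc[symmetric])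
    qed
  qed
  also have "\<dots> = (\<integral>\<^sup>+r. (\<integral>\<^sup>+s. ennreal (exp (- r)) * indicator {0<..} r * (?h s * F (s * r powr - \<alpha>)) \<partial>lborel) \<partial>lborel)"
  proof (rule nn_integral_cong)
    fix r :: real
    have "(\<integral>\<^sup>+s. ennreal (exp (- r)) * indicator {0<..} r * (?h s * F (s * r powr - \<alpha>)) \<partial>lborel)
       = ennreal (exp (- r)) * indicator {0<..} r * (\<integral>\<^sup>+s. ?h s * F (s * r powr - \<alpha>) \<partial>lborel)"
      by (intro nn_integral_cmult) measurable
    then show "ennreal (exp (- r)) * indicator {0<..} r * (ennreal (r powr (\<alpha> * real k)) * c)
       = (\<integral>\<^sup>+s. ennreal (exp (- r)) * indicator {0<..} r * (?h s * F (s * r powr - \<alpha>)) \<partial>lborel)"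
      using scaled[of r] by (cases "0 < r") auto
  qed
  also have "\<dots> = (\<integral>\<^sup>+s. (\<integral>\<^sup>+r. ennreal (exp (- r)) * indicator {0<..} r * (?h s * F (s * r powr - \<alpha>)) \<partial>lborel) \<partial>lborel)"
    by (rule lborel_pair.Fubini') measurable
  also have "\<dots> = (\<integral>\<^sup>+s. ennreal (real k * (indicator {0..} s * s powr (real k - 1) / exp s)) \<partial>lborel)"
  proof (rule nn_integral_cong_AE)
    show "AE s in lborel. (\<integral>\<^sup>+r. ennreal (exp (- r)) * indicator {0<..} r * (?h s * F (s * r powr - \<alpha>)) \<partial>lborel)
      = ennreal (real k * (indicator {0..} s * s powr (real k - 1) / exp s))"
      using AE_lborel_singleton[of 0]
    proof eventually_elim
      fix s :: real assume "s \<noteq> 0"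
      show "(\<integral>\<^sup>+r. ennreal (exp (- r)) * indicator {0<..} r * (?h s * F (s * r powr - \<alpha>)) \<partial>lborel)
        = ennreal (real k * (indicator {0..} s * s powr (real k - 1) / exp s))"
      proof (cases "0 < s")
        case True
        have "(\<integral>\<^sup>+r. ennreal (exp (- r)) * indicator {0<..} r * (?h s * F (s * r powr - \<alpha>)) \<partial>lborel)
          = (\<integral>\<^sup>+r. ?h s * (ennreal (exp (- r)) * indicator {0<..} r * F (s * r powr - \<alpha>)) \<partial>lborel)"
          by (intro nn_integral_cong) (simp add: ac_simps)
        also have "\<dots> = ?h s * (\<integral>\<^sup>+r. ennreal (exp (- r)) * indicator {0<..} r * F (s * r powr - \<alpha>) \<partial>lborel)"
          by (intro nn_integral_cmult) measurable
        also have "(\<integral>\<^sup>+r. ennreal (exp (- r)) * indicator {0<..} r * F (s * r powr - \<alpha>) \<partial>lborel)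
          = (\<integral>\<^sup>+r. ennreal (exp (- r)) * indicator {0<..} r * prob {\<omega> \<in> space Q. \<sigma> s \<omega> \<le> r} \<partial>lborel)"
          using F[OF True] by (intro nn_integral_cong) (auto simp: indicator_def)
        also have "\<dots> = ennreal (exp (- s))" by (rule nn_laplace_prob_\<sigma>[OF True])
        finally have lhs: "(\<integral>\<^sup>+r. ennreal (exp (- r)) * indicator {0<..} r * (?h s * F (s * r powr - \<alpha>)) \<partial>lborel) = ?h s * ennreal (exp (- s))" .
        have "s powr (real k - 1) = s ^ (k - 1)"
          using True k by (simp add: of_nat_diff flip: powr_realpow)
        then show ?thesis unfolding lhs using True
          by (simp add: ennreal_mult[symmetric] exp_minus field_simps)
      next
        case False then show ?thesis using \<open>s \<noteq> 0\<close> by simp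
      qed
    qed
  qed
  also have "\<dots> = ennreal (real k) * ennreal (Gamma (real k))"
    using k by (subst Gamma_conv_nn_integral_real, simp, subst nn_integral_cmult[symmetric])
      (auto simp: ennreal_mult[symmetric] intro!: nn_integral_cong)
  also have "\<dots> = ennreal (fact k)"
    using k Gamma_fact[of "k - 1", where 'a=real] fact_reduce[OF k, where 'a=real]
    by (simp add: ennreal_mult[symmetric] of_nat_diff)
  finally have eq: "ennreal (Gamma (\<alpha> * real k + 1)) * c = ennreal (fact k)" .
  have G: "0 < Gamma (\<alpha> * real k + 1)" using \<alpha>_pos by (intro Gamma_real_pos) (auto intro: add_nonneg_pos)
  have "c = ennreal (1 / Gamma (\<alpha> * real k + 1)) * (ennreal (Gamma (\<alpha> * real k + 1)) * c)"
    using G by (simp add: mult.assoc[symmetric] ennreal_mult[symmetric])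
  also have "\<dots> = ennreal (fact k / Gamma (\<alpha> * real k + 1))"
    unfolding eq using G by (simp add: ennreal_mult[symmetric])
  finally have c: "c = ennreal (fact k / Gamma (\<alpha> * real k + 1))" .
  show ?thesis
    unfolding moment[OF t] scaled[OF t] c using G by (simp add: ennreal_mult[symmetric])
qed

lemma moment_clock:
  assumes "0 < t"
  shows "integrable Q (\<lambda>\<omega>. clock t \<omega> ^ k)"
    and "(LINT \<omega>|Q. clock t \<omega> ^ k) = t powr (\<alpha> * real k) * fact k / Gamma (\<alpha> * real k + 1)"
proof -
  have "0 < Gamma (\<alpha> * real k + 1)" using \<alpha>_pos by (intro Gamma_real_pos) (auto intro: add_nonneg_pos)
  then have n: "0 \<le> t powr (\<alpha> * real k) * fact k / Gamma (\<alpha> * real k + 1)" by simp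
  show i: "integrable Q (\<lambda>\<omega>. clock t \<omega> ^ k)"
    by (rule integrableI_nonneg) (auto simp: nn_moment_clock[OF assms] inverse_process_nonneg)
  have "(LINT \<omega>|Q. clock t \<omega> ^ k) = enn2real (\<integral>\<^sup>+\<omega>. ennreal (clock t \<omega> ^ k) \<partial>Q)"
    by (rule integral_eq_nn_integral) (auto simp: inverse_process_nonneg)
  then show "(LINT \<omega>|Q. clock t \<omega> ^ k) = t powr (\<alpha> * real k) * fact k / Gamma (\<alpha> * real k + 1)"
    unfolding nn_moment_clock[OF assms] using n by simp
qed

text \<open>Termwise expectation of the power series. The exponential moments of the clock dominate the partial
  sums. Applied to the geometric sequence \<open>b k = a\<^sup>k\<close> this also shows that the Mittag-Leffler series
  converges.\<close>

lemma expectation_clock_power_series: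
  fixes b :: "nat \<Rightarrow> real" and g :: "real \<Rightarrow> real"
  assumes t: "0 < t" and a: "0 < a" and bound: "\<And>k. \<bar>b k\<bar> \<le> K * a ^ k"
    and g: "\<And>s. 0 \<le> s \<Longrightarrow> (\<lambda>k. s ^ k / fact k * b k) sums g s"
  shows "(\<lambda>k. t powr (\<alpha> * real k) / Gamma (\<alpha> * real k + 1) * b k) sums (LINT \<omega>|Q. g (clock t \<omega>))"
proof -
  let ?f = "\<lambda>k \<omega>. clock t \<omega> ^ k / fact k * b k"
  have int: "integrable Q (?f k)" for k
    using moment_clock(1)[OF t, of k] by simp
  have le: "norm (?f k \<omega>) \<le> K * ((a * clock t \<omega>) ^ k / fact k)" for k \<omega>
    using mult_left_mono[OF bound[of k], of "clock t \<omega> ^ k / fact k"] inverse_process_nonneg[of \<sigma> t \<omega>]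
    by (simp add: abs_mult power_mult_distrib mult_ac)
  have K: "0 \<le> K" using bound[of 0] by simp
  have esum: "(\<lambda>k. c ^ k / fact k) sums exp c" for c :: real
    using exp_converges[of c] by (simp add: field_simps)
  have "(\<lambda>k. integral\<^sup>L Q (?f k)) sums (\<integral>\<omega>. (\<Sum>k. ?f k \<omega>) \<partial>Q)"
  proof (rule sums_integral[OF int])
    show "AE \<omega> in Q. summable (\<lambda>k. norm (?f k \<omega>))"
    proof (rule AE_I2)
      fix \<omega>
      show "summable (\<lambda>k. norm (?f k \<omega>))"
        by (rule summable_comparison_test'[where g = "\<lambda>k. K * ((a * clock t \<omega>) ^ k / fact k)"])
          (intro summable_mult sums_summable[OF esum], simp only: real_norm_def abs_idempotent le[unfolded real_norm_def])
    qed
    show "summable (\<lambda>k. \<integral>\<omega>. norm (?f k \<omega>) \<partial>Q)"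
    proof (rule summableI_nonneg_bounded)
      fix n
      have "(\<Sum>k<n. \<integral>\<omega>. norm (?f k \<omega>) \<partial>Q) = (\<integral>\<omega>. (\<Sum>k<n. norm (?f k \<omega>)) \<partial>Q)"
        by (intro Bochner_Integration.integral_sum[symmetric] integrable_norm int)
      also have "\<dots> \<le> (\<integral>\<omega>. K * exp (a * clock t \<omega>) \<partial>Q)"
      proof (rule integral_mono)
        show "integrable Q (\<lambda>\<omega>. \<Sum>k<n. norm (?f k \<omega>))"
          by (intro Bochner_Integration.integrable_sum integrable_norm int)
        show "integrable Q (\<lambda>\<omega>. K * exp (a * clock t \<omega>))"
          by (intro integrable_mult_right integrable_exp_clock a)
        fix \<omega>
        have "(\<Sum>k<n. norm (?f k \<omega>)) \<le> K * (\<Sum>k<n. (a * clock t \<omega>) ^ k / fact k)"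
          unfolding sum_distrib_left by (intro sum_mono le)
        also have "\<dots> \<le> K * exp (a * clock t \<omega>)"
          using a K inverse_process_nonneg[of \<sigma> t \<omega>]
          by (intro mult_left_mono sum_le_suminf[OF sums_summable[OF esum], THEN order_trans] order_eq_refl[OF sums_unique[OF esum, symmetric]]) auto
        finally show "(\<Sum>k<n. norm (?f k \<omega>)) \<le> K * exp (a * clock t \<omega>)" .
      qed
      finally show "(\<Sum>k<n. \<integral>\<omega>. norm (?f k \<omega>) \<partial>Q) \<le> (\<integral>\<omega>. K * exp (a * clock t \<omega>) \<partial>Q)" .
    qed simp
  qed
  moreover have "integral\<^sup>L Q (?f k) = t powr (\<alpha> * real k) / Gamma (\<alpha> * real k + 1) * b k" for k
    using moment_clock(2)[OF t, of k] by simp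
  moreover have "(\<Sum>k. ?f k \<omega>) = g (clock t \<omega>)" for \<omega>
    using g[OF inverse_process_nonneg] by (rule sums_unique[symmetric])
  ultimately show ?thesis by simp
qed

end

section \<open>Joint measurability and the Markov property\<close>

context cadlag_markov_process
begin

lemma space_P: "x \<in> S \<Longrightarrow> space (P x) = space \<Omega>"
  using sets_P by (rule sets_eq_imp_space_eq)

lemma space_F: "space (F t) = space \<Omega>"
  using filtration_F by (rule filtration.space_F)

lemma sets_F_subset: "sets (F t) \<subseteq> sets \<Omega>"
  using subalgebra_F by (auto simp: subalgebra_def)

lemma subalgebra_P: "x \<in> S \<Longrightarrow> subalgebra (P x) (F t)"
  using subalgebra_F[of t] by (auto simp: subalgebra_def sets_P space_P)

lemma finite_measure_P: "x \<in> S \<Longrightarrow> finite_measure (P x)"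
  using prob_space_P by (rule prob_space.finite_measure)

lemma sigma_finite_P: "x \<in> S \<Longrightarrow> sigma_finite_measure (P x)"
  using finite_measure_P by (rule finite_measure.axioms(1))

lemma measurable_P: "x \<in> S \<Longrightarrow> measurable (P x) = measurable \<Omega>"
  by (intro ext measurable_cong_sets sets_P refl)

lemma X_measurable_\<Omega>: "0 \<le> t \<Longrightarrow> X t \<in> borel_measurable \<Omega>"
  using adapted subalgebra_F by (rule measurable_from_subalg[rotated])

lemma X_measurable: "\<lbrakk>x \<in> S; 0 \<le> t\<rbrakk> \<Longrightarrow> X t \<in> borel_measurable (P x)"
  using X_measurable_\<Omega> by (simp add: measurable_P)

lemma X_jointly_measurable:
  "x \<in> S \<Longrightarrow> (\<lambda>(s, \<omega>). X (max 0 s) \<omega>) \<in> borel_measurable (borel \<Otimes>\<^sub>M P x)"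
  using cadlag_paths by (intro right_continuous_jointly_measurable X_measurable)
    (auto simp: cadlag_def space_P)

lemma continuous_X_jointly_measurable:
  fixes u :: "real ^ 'd \<Rightarrow> real"
  assumes "x \<in> S" "continuous_on UNIV u"
  shows "(\<lambda>(s, \<omega>). u (X (max 0 s) \<omega>)) \<in> borel_measurable (borel \<Otimes>\<^sub>M P x)"
  using measurable_compose[OF X_jointly_measurable[OF assms(1)] borel_measurable_continuous_onI[OF assms(2)]]
  by (simp add: split_beta')

lemma continuous_X_measurable:
  fixes u :: "real ^ 'd \<Rightarrow> real"
  assumes "x \<in> S" "0 \<le> t" "continuous_on UNIV u"
  shows "(\<lambda>\<omega>. u (X t \<omega>)) \<in> borel_measurable (P x)"
  using measurable_compose[OF X_measurable[OF assms(1,2)] borel_measurable_continuous_onI[OF assms(3)]] .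

lemma stopping_time_measurable:
  assumes "stopping_time F \<rho>"
  shows "\<rho> \<in> borel_measurable \<Omega>"
  using assms sets_F_subset space_F by (rule measurable_stopping_time)

lemma X_at_random_time_measurable:
  fixes u :: "real ^ 'd \<Rightarrow> real"
  assumes "x \<in> S" "continuous_on UNIV u" "\<rho> \<in> borel_measurable (P x)"
    and "\<And>\<omega>. \<omega> \<in> space \<Omega> \<Longrightarrow> 0 \<le> \<rho> \<omega>"
  shows "(\<lambda>\<omega>. u (X (\<rho> \<omega>) \<omega>)) \<in> borel_measurable (P x)"
proof -
  have "(\<lambda>\<omega>. u (X (max 0 (\<rho> \<omega>)) \<omega>)) \<in> borel_measurable (P x)"
    using measurable_compose[OF measurable_Pair[OF assms(3) measurable_ident] continuous_X_jointly_measurable[OF assms(1,2)]]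
    by simp
  then show ?thesis
    by (rule measurable_cong[THEN iffD1, rotated]) (use assms in \<open>simp add: space_P max_def\<close>)
qed

lemma path_bounded:
  fixes u :: "real ^ 'd \<Rightarrow> real"
  assumes "\<omega> \<in> space \<Omega>" "continuous_on UNIV u"
  shows "\<exists>B. \<forall>s. 0 \<le> s \<longrightarrow> s \<le> t \<longrightarrow> \<bar>u (X s \<omega>)\<bar> \<le> B"
proof -
  let ?K = "closure ((\<lambda>s. X s \<omega>) ` {0..t})"
  have "compact ?K"
    using cadlag_bounded[OF cadlag_paths[OF assms(1)]] by (simp add: compact_closure)
  then have "bounded (u ` ?K)"
    by (intro compact_imp_bounded compact_continuous_image continuous_on_subset[OF assms(2)]) auto
  then obtain B where B: "\<And>y. y \<in> ?K \<Longrightarrow> \<bar>u y\<bar> \<le> B" unfolding bounded_iff by auto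
  have "X s \<omega> \<in> ?K" if "0 \<le> s" "s \<le> t" for s
    using that closure_subset[of "(\<lambda>s. X s \<omega>) ` {0..t}"] by (auto simp: subset_iff)
  then show ?thesis using B by blast
qed

lemma path_section_measurable:
  fixes u :: "real ^ 'd \<Rightarrow> real"
  assumes "x \<in> S" "\<omega> \<in> space \<Omega>" "continuous_on UNIV u"
  shows "(\<lambda>s. u (X (max 0 s) \<omega>)) \<in> borel_measurable borel"
  using measurable_compose[OF measurable_Pair2' continuous_X_jointly_measurable[OF assms(1,3)]] assms(1,2)
  by (simp add: space_P)

lemma path_integrable:
  fixes u :: "real ^ 'd \<Rightarrow> real"
  assumes "x \<in> S" "\<omega> \<in> space \<Omega>" "continuous_on UNIV u"
  shows "set_integrable lborel {0..t} (\<lambda>s. u (X s \<omega>))"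
proof -
  obtain B where B: "\<And>s. \<lbrakk>0 \<le> s; s \<le> t\<rbrakk> \<Longrightarrow> \<bar>u (X s \<omega>)\<bar> \<le> B"
    using path_bounded[OF assms(2,3)] by blast
  have "set_integrable lborel {0..t} (\<lambda>s. u (X (max 0 s) \<omega>))"
    by (rule set_integrable_bounded[where B=B]) (use B path_section_measurable[OF assms] in auto)
  then show ?thesis
    unfolding set_integrable_def by (rule Bochner_Integration.integrable_cong[THEN iffD1, rotated -1]) (auto simp: indicator_def)
qed

lemma path_integral_jointly_measurable:
  fixes v :: "real ^ 'd \<Rightarrow> real"
  assumes "x \<in> S" "continuous_on UNIV v"
  shows "(\<lambda>(s, \<omega>). LBINT r:{0..s}. v (X r \<omega>)) \<in> borel_measurable (borel \<Otimes>\<^sub>M P x)"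
proof -
  have [measurable]: "(\<lambda>(s, \<omega>). v (X (max 0 s) \<omega>)) \<in> borel_measurable (borel \<Otimes>\<^sub>M P x)"
    by (rule continuous_X_jointly_measurable[OF assms])
  have "(\<lambda>z. v (X (max 0 (snd z)) (snd (fst z)))) \<in> borel_measurable ((borel \<Otimes>\<^sub>M P x) \<Otimes>\<^sub>M lborel)"
    using measurable_compose[of "\<lambda>z. (snd z, snd (fst z))" "(borel \<Otimes>\<^sub>M P x) \<Otimes>\<^sub>M lborel" "borel \<Otimes>\<^sub>M P x"
      "\<lambda>(s, \<omega>). v (X (max 0 s) \<omega>)" borel] by simp
  then have "(\<lambda>z. (if 0 \<le> snd z \<and> snd z \<le> fst (fst z) then 1 else 0) * v (X (max 0 (snd z)) (snd (fst z))))
      \<in> borel_measurable ((borel \<Otimes>\<^sub>M P x) \<Otimes>\<^sub>M lborel)"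
    by measurable
  then have "(\<lambda>y. \<integral>r. (if 0 \<le> r \<and> r \<le> fst y then 1 else 0) * v (X (max 0 r) (snd y)) \<partial>lborel) \<in> borel_measurable (borel \<Otimes>\<^sub>M P x)"
    by (intro lborel.borel_measurable_lebesgue_integral) (simp add: split_beta')
  moreover have "(\<integral>r. (if 0 \<le> r \<and> r \<le> s then 1 else 0) * v (X (max 0 r) \<omega>) \<partial>lborel) = (LBINT r:{0..s}. v (X r \<omega>))" for s \<omega>
    unfolding set_lebesgue_integral_def by (intro Bochner_Integration.integral_cong) (auto simp: indicator_def)
  ultimately show ?thesis by (simp add: split_beta')
qed

lemma X_measurable_restrict: "\<lbrakk>x \<in> S; 0 \<le> t\<rbrakk> \<Longrightarrow> X t \<in> P x \<rightarrow>\<^sub>M restrict_space borel S"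
  using X_measurable state_space by (intro measurable_restrict_space2) (auto simp: space_P)

lemma emeasure_transition_kernel:
  assumes y: "y \<in> S" and t: "0 \<le> t" and B: "B \<in> sets borel"
  shows "emeasure (distr (P y) borel (X t)) B = ennreal (measure (P y) {\<omega> \<in> space \<Omega>. X t \<omega> \<in> B})"
proof -
  interpret prob_space "P y" by (rule prob_space_P[OF y])
  have "X t -` B \<inter> space (P y) = {\<omega> \<in> space \<Omega>. X t \<omega> \<in> B}" by (auto simp: space_P[OF y])
  then show ?thesis using X_measurable[OF y t] B by (simp add: emeasure_distr emeasure_eq_measure)
qed

lemma transition_kernel_measurable:
  assumes t: "0 \<le> t"
  shows "(\<lambda>y. distr (P y) borel (X t)) \<in> restrict_space borel S \<rightarrow>\<^sub>M subprob_algebra borel"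
proof (rule measurable_subprob_algebra)
  fix y assume "y \<in> space (restrict_space borel S)"
  then have y: "y \<in> S" by (simp add: space_restrict_space)
  interpret prob_space "P y" by (rule prob_space_P[OF y])
  show "subprob_space (distr (P y) borel (X t))"
    by (intro prob_space_imp_subprob_space prob_space_distr X_measurable[OF y t])
next
  fix B :: "(real ^ 'd) set" assume B: "B \<in> sets borel"
  have "(\<lambda>y. ennreal (measure (P y) {\<omega> \<in> space \<Omega>. X t \<omega> \<in> B})) \<in> borel_measurable (restrict_space borel S)"
    using kernel_measurable[OF t B] by simp
  then show "(\<lambda>y. emeasure (distr (P y) borel (X t)) B) \<in> borel_measurable (restrict_space borel S)"
    by (rule measurable_cong[THEN iffD1, rotated])
      (use B t in \<open>simp add: space_restrict_space emeasure_transition_kernel\<close>)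
qed simp

lemma transition_nn_integral:
  assumes "g \<in> borel_measurable borel" "y \<in> S" "0 \<le> t"
  shows "(\<integral>\<^sup>+z. g z \<partial>distr (P y) borel (X t)) = (\<integral>\<^sup>+\<omega>. g (X t \<omega>) \<partial>P y)"
  using assms by (subst nn_integral_distr) (auto intro: X_measurable)

lemma transition_nn_integral_measurable:
  assumes g: "g \<in> borel_measurable borel" and t: "0 \<le> t"
  shows "(\<lambda>y. \<integral>\<^sup>+\<omega>. g (X t \<omega>) \<partial>P y) \<in> borel_measurable (restrict_space borel S)"
  using measurable_compose[OF transition_kernel_measurable[OF t] nn_integral_measurable_subprob_algebra[OF g]]
  by (rule measurable_cong[THEN iffD1, rotated])
    (use transition_nn_integral[OF g _ t] in \<open>simp add: space_restrict_space\<close>)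

text \<open>The Markov property passes from events to nonnegative functions by an identity of measures: with
  \<open>P\<^sub>x\<close> restricted to \<open>D\<close>, the law of \<open>X\<close> at time \<open>s + t\<close> is the law at time \<open>s\<close> followed by the transition
  kernel.\<close>

lemma markov_nn_integral:
  fixes g :: "real ^ 'd \<Rightarrow> ennreal"
  assumes g: "g \<in> borel_measurable borel" and s: "0 \<le> s" and t: "0 \<le> t"
    and x: "x \<in> S" and D: "D \<in> sets (F s)"
  shows "(\<integral>\<^sup>+\<omega>. g (X (s + t) \<omega>) * indicator D \<omega> \<partial>P x) =
      (\<integral>\<^sup>+\<omega>. (\<integral>\<^sup>+\<omega>'. g (X t \<omega>') \<partial>P (X s \<omega>)) * indicator D \<omega> \<partial>P x)"
proof -
  interpret prob_space "P x" using prob_space_P[OF x] .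
  interpret finite_measure_subalgebra "P x" "F s" by unfold_locales (rule subalgebra_P[OF x])
  let ?R = "restrict_space borel S" and ?K = "\<lambda>y. distr (P y) borel (X t)"
  let ?\<mu> = "density (P x) (indicator D)"
  have D'[measurable]: "D \<in> sets (P x)" using D sets_F_subset[of s] by (auto simp: sets_P[OF x])
  have K[measurable]: "?K \<in> ?R \<rightarrow>\<^sub>M subprob_algebra borel" by (rule transition_kernel_measurable[OF t])
  have Xs[measurable]: "X s \<in> P x \<rightarrow>\<^sub>M ?R" by (rule X_measurable_restrict[OF x s])
  have Xst[measurable]: "X (s + t) \<in> borel_measurable (P x)" using s t by (intro X_measurable[OF x]) simp
  have ne: "space (distr ?\<mu> ?R (X s)) \<noteq> {}" using x by (auto simp: space_restrict_space)
  have "distr ?\<mu> borel (X (s + t)) = bind (distr ?\<mu> ?R (X s)) ?K"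
  proof (rule measure_eqI)
    show "sets (distr ?\<mu> borel (X (s + t))) = sets (bind (distr ?\<mu> ?R (X s)) ?K)"
      using ne by (subst sets_bind[where N=borel]) auto
    fix B assume "B \<in> sets (distr ?\<mu> borel (X (s + t)))"
    then have B: "B \<in> sets borel" by simp
    let ?A = "{\<omega> \<in> space \<Omega>. X (s + t) \<omega> \<in> B}"
    let ?k = "\<lambda>\<omega>. measure (P (X s \<omega>)) {\<omega>' \<in> space \<Omega>. X t \<omega>' \<in> B}"
    have A[measurable]: "?A \<in> sets (P x)"
      using measurable_sets[OF Xst B] by (simp add: space_P[OF x] vimage_def Int_def conj_commute)
    have intA: "integrable (P x) (indicat_real ?A)"
      by (intro integrable_real_indicator A) (simp add: emeasure_eq_measure)
    have km[measurable]: "?k \<in> borel_measurable (P x)"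
      by (rule measurable_compose[OF Xs kernel_measurable[OF t B]])
    have le1: "?k \<omega> \<le> 1" if "\<omega> \<in> space (P x)" for \<omega>
      using prob_space.prob_le_1[OF prob_space_P[OF state_space[OF s]]] that by (simp add: space_P[OF x])
    have intk: "integrable (P x) (\<lambda>\<omega>. ?k \<omega> * indicator D \<omega>)"
      using le1 by (intro integrable_const_bound[where B=1]) (auto simp: indicator_def)
    have "emeasure (distr ?\<mu> borel (X (s + t))) B = (\<integral>\<^sup>+\<omega>. ennreal (indicator D \<omega> * indicator ?A \<omega>) \<partial>P x)"
    proof -
      have "X (s + t) -` B \<inter> space ?\<mu> = ?A" by (auto simp: space_P[OF x])
      then have "emeasure (distr ?\<mu> borel (X (s + t))) B = emeasure ?\<mu> ?A"
        using B by (simp add: emeasure_distr)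
      also have "\<dots> = (\<integral>\<^sup>+\<omega>. ennreal (indicator D \<omega> * indicator ?A \<omega>) \<partial>P x)"
        by (subst emeasure_density) (auto intro!: nn_integral_cong simp: indicator_def)
      finally show ?thesis .
    qed
    also have "\<dots> = ennreal (LINT \<omega>|P x. indicator D \<omega> * indicator ?A \<omega>)"
      using integrable_real_mult_indicator[OF D' intA]
      by (intro nn_integral_eq_integral) (auto simp: mult.commute)
    also have "(LINT \<omega>|P x. indicator D \<omega> * indicator ?A \<omega>) = (LINT \<omega>:D|P x. real_cond_exp (P x) (F s) (indicator ?A) \<omega>)"
      using real_cond_exp_intA[OF intA D] by (simp add: set_lebesgue_integral_def)
    also have "\<dots> = (LINT \<omega>|P x. ?k \<omega> * indicator D \<omega>)"
      unfolding set_lebesgue_integral_def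
    proof (rule integral_cong_AE)
      show "AE \<omega> in P x. indicator D \<omega> *\<^sub>R real_cond_exp (P x) (F s) (indicator ?A) \<omega> = ?k \<omega> * indicator D \<omega>"
        using markov[OF x s t B] by eventually_elim simp
    qed measurable
    also have "ennreal \<dots> = (\<integral>\<^sup>+\<omega>. indicator D \<omega> * emeasure (?K (X s \<omega>)) B \<partial>P x)"
      using emeasure_transition_kernel[OF state_space[OF s] t B]
      by (subst nn_integral_eq_integral[OF intk, symmetric])
        (auto intro!: nn_integral_cong simp: space_P[OF x] indicator_def)
    also have "\<dots> = emeasure (bind (distr ?\<mu> ?R (X s)) ?K) B"
      using B ne by (subst emeasure_bind[where N=borel], simp, simp, simp, subst nn_integral_distr, simp, simp, subst nn_integral_density)
        (auto intro!: measurable_emeasure_kernel[OF K])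
    finally show "emeasure (distr ?\<mu> borel (X (s + t))) B = emeasure (bind (distr ?\<mu> ?R (X s)) ?K) B" .
  qed
  then have "(\<integral>\<^sup>+z. g z \<partial>distr ?\<mu> borel (X (s + t))) = (\<integral>\<^sup>+y. (\<integral>\<^sup>+z. g z \<partial>?K y) \<partial>distr ?\<mu> ?R (X s))"
    using nn_integral_bind[OF g, of ?K "distr ?\<mu> ?R (X s)"] by simp
  moreover have "(\<integral>\<^sup>+y. (\<integral>\<^sup>+z. g z \<partial>?K y) \<partial>distr ?\<mu> ?R (X s)) = (\<integral>\<^sup>+y. (\<integral>\<^sup>+\<omega>'. g (X t \<omega>') \<partial>P y) \<partial>distr ?\<mu> ?R (X s))"
    using transition_nn_integral[OF g _ t] by (intro nn_integral_cong) (simp add: space_restrict_space)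
  moreover note transition_nn_integral_measurable[OF g t, measurable]
  ultimately show ?thesis
    using g by (simp add: nn_integral_distr nn_integral_density mult.commute)
qed

lemma markov_domination:
  fixes \<phi> :: "real ^ 'd \<Rightarrow> real"
  assumes x: "x \<in> S" and s: "0 \<le> s" "s \<le> t" and D: "D \<in> sets (F s)"
    and \<phi>: "continuous_on UNIV \<phi>"
    and dom: "\<And>y r. \<lbrakk>y \<in> S; 0 \<le> r; r \<le> t\<rbrakk> \<Longrightarrow> ennreal (\<phi> y) \<le> c * (\<integral>\<^sup>+\<omega>. \<phi> (X r \<omega>) \<partial>P y)"
  shows "(\<integral>\<^sup>+\<omega>. ennreal (\<phi> (X s \<omega>)) * indicator D \<omega> \<partial>P x) \<le> c * (\<integral>\<^sup>+\<omega>. ennreal (\<phi> (X t \<omega>)) * indicator D \<omega> \<partial>P x)"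
proof -
  have D'[measurable]: "D \<in> sets (P x)" using D sets_F_subset[of s] by (auto simp: sets_P[OF x])
  have g: "(\<lambda>y. ennreal (\<phi> y)) \<in> borel_measurable borel"
    using borel_measurable_continuous_onI[OF \<phi>] by simp
  have ts: "0 \<le> t - s" using s by simp
  note M = markov_nn_integral[OF g s(1) ts x D]
  have [measurable]: "(\<lambda>\<omega>. \<integral>\<^sup>+\<omega>'. \<phi> (X (t - s) \<omega>') \<partial>P (X s \<omega>)) \<in> borel_measurable (P x)"
    by (rule measurable_compose[OF X_measurable_restrict[OF x s(1)] transition_nn_integral_measurable[OF g ts]])
  have "(\<integral>\<^sup>+\<omega>. ennreal (\<phi> (X s \<omega>)) * indicator D \<omega> \<partial>P x) \<le> (\<integral>\<^sup>+\<omega>. c * ((\<integral>\<^sup>+\<omega>'. \<phi> (X (t - s) \<omega>') \<partial>P (X s \<omega>)) * indicator D \<omega>) \<partial>P x)"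
    using dom[OF state_space[OF s(1)], of _ "t - s"] s
    by (intro nn_integral_mono) (auto simp: space_P[OF x] indicator_def)
  also have "\<dots> = c * (\<integral>\<^sup>+\<omega>. (\<integral>\<^sup>+\<omega>'. \<phi> (X (t - s) \<omega>') \<partial>P (X s \<omega>)) * indicator D \<omega> \<partial>P x)"
    by (rule nn_integral_cmult) measurable
  also have "\<dots> = c * (\<integral>\<^sup>+\<omega>. ennreal (\<phi> (X t \<omega>)) * indicator D \<omega> \<partial>P x)"
    using M by simp
  finally show ?thesis .
qed

text \<open>If \<open>\<phi>\<close> is dominated, up to a constant, by its later conditional means, then its value at a stopping
  time before \<open>t\<close> is dominated by its value at \<open>t\<close> on the same event. For a stopping time with discrete
  values this is the Markov property at each value; the general case follows by Fatou's lemma along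
  discrete times from the right. As the event shrinks, the right-hand side tends to \<open>0\<close>, so this acts
  as uniform integrability over all stopping times and stands in for a maximal inequality.\<close>

lemma stopped_domination:
  fixes \<phi> :: "real ^ 'd \<Rightarrow> real"
  assumes x: "x \<in> S" and t: "0 \<le> t" and \<rho>: "stopping_time F \<rho>"
    and \<rho>0: "\<And>\<omega>. \<omega> \<in> space \<Omega> \<Longrightarrow> 0 \<le> \<rho> \<omega>"
    and \<phi>: "continuous_on UNIV \<phi>"
    and dom: "\<And>y r. \<lbrakk>y \<in> S; 0 \<le> r; r \<le> t\<rbrakk> \<Longrightarrow> ennreal (\<phi> y) \<le> c * (\<integral>\<^sup>+\<omega>. \<phi> (X r \<omega>) \<partial>P y)"
  shows "(\<integral>\<^sup>+\<omega>. ennreal (\<phi> (X (\<rho> \<omega>) \<omega>)) * indicator {\<omega>. \<rho> \<omega> < t} \<omega> \<partial>P x)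
     \<le> c * (\<integral>\<^sup>+\<omega>. ennreal (\<phi> (X t \<omega>)) * indicator {\<omega>. \<rho> \<omega> < t} \<omega> \<partial>P x)"
proof -
  have [measurable]: "\<rho> \<in> borel_measurable (P x)"
    using stopping_time_measurable[OF \<rho>] by (simp add: measurable_P[OF x])
  have Xm: "(\<lambda>\<omega>. \<phi> (X r \<omega>)) \<in> borel_measurable (P x)" if "0 \<le> r" for r
    by (rule continuous_X_measurable[OF x that \<phi>])
  \<comment> \<open>The grid time \<open>g n\<close> strictly after \<open>\<rho>\<close> reduces the question to the fixed times \<open>a n j\<close>, and \<open>\<rho>\<close> selects
    \<open>a n j\<close> on the event \<open>D n j\<close>, which is known at that time.\<close>
  define g where "g n \<omega> = (real_of_int \<lfloor>\<rho> \<omega> * real (Suc n)\<rfloor> + 1) / real (Suc n)" for n \<omega>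
  define G where "G n \<omega> = ennreal (\<phi> (X (g n \<omega>) \<omega>)) * indicator {\<omega>. g n \<omega> < t} \<omega>" for n \<omega>
  define a where "a n j = (real j + 1) / real (Suc n)" for n j :: nat
  define D where "D n j = {\<omega> \<in> space \<Omega>. \<lfloor>\<rho> \<omega> * real (Suc n)\<rfloor> = int j}" for n j
  have a_pos: "0 \<le> a n j" for n j by (simp add: a_def)
  have g_gt: "\<rho> \<omega> < g n \<omega>" for n \<omega>
    by (simp add: g_def pos_less_divide_eq)
  have D_sets: "D n j \<in> sets (F (a n j))" for n j
  proof -
    have "D n j = {\<omega> \<in> space (F (a n j)). \<not> (\<rho> \<omega> < real j / real (Suc n)) \<and> \<rho> \<omega> < a n j}"
      unfolding D_def a_def space_F
      by (intro Collect_cong conj_cong refl)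
        (auto simp: floor_eq_iff pos_less_divide_eq pos_divide_less_eq not_less pos_divide_le_eq simp del: of_nat_Suc)
    moreover have "Measurable.pred (F (a n j)) (\<lambda>\<omega>. \<rho> \<omega> < a n j)"
      using filtration.stopping_time_less_const[OF filtration_F \<rho>] .
    moreover have "Measurable.pred (F (a n j)) (\<lambda>\<omega>. \<rho> \<omega> < real j / real (Suc n))"
    proof -
      have "{\<omega> \<in> space (F (real j / real (Suc n))). \<rho> \<omega> < real j / real (Suc n)} \<in> sets (F (real j / real (Suc n)))"
        using filtration.stopping_time_less_const[OF filtration_F \<rho>, of "real j / real (Suc n)"] by (simp add: pred_def)
      also have "\<dots> \<subseteq> sets (F (a n j))"
        by (rule filtration.sets_F_mono[OF filtration_F]) (auto simp: a_def intro!: divide_right_mono)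
      finally show ?thesis by (simp add: pred_def space_F)
    qed
    ultimately show ?thesis by simp
  qed
  have on_D: "g n \<omega> = a n j" if "\<omega> \<in> D n j" for n j \<omega>
    using that by (simp add: D_def g_def a_def)
  have D_disj: "j = j'" if "\<omega> \<in> D n j" "\<omega> \<in> D n j'" for n j j' \<omega>
    using that by (simp add: D_def)
  have D_cover: "\<exists>j. \<omega> \<in> D n j" if "\<omega> \<in> space \<Omega>" for \<omega> n
  proof -
    have "0 \<le> \<lfloor>\<rho> \<omega> * real (Suc n)\<rfloor>" using \<rho>0[OF that] by simp
    then show ?thesis using that by (intro exI[of _ "nat \<lfloor>\<rho> \<omega> * real (Suc n)\<rfloor>"]) (simp add: D_def)
  qed
  define J where "J n = {j. a n j < t}" for n
  have J_fin: "finite (J n)" for n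
  proof (rule finite_subset)
    show "J n \<subseteq> {..nat \<lceil>t * real (Suc n)\<rceil>}"
    proof
      fix j assume "j \<in> J n"
      then have "real j + 1 < t * real (Suc n)" by (simp add: J_def a_def pos_divide_less_eq)
      then show "j \<in> {..nat \<lceil>t * real (Suc n)\<rceil>}" by simp linarith
    qed
  qed simp
  have G_sum: "G n \<omega> = (\<Sum>j\<in>J n. ennreal (\<phi> (X (a n j) \<omega>)) * indicator (D n j) \<omega>)" if \<omega>: "\<omega> \<in> space \<Omega>" for n \<omega>
  proof -
    obtain j where j: "\<omega> \<in> D n j" using D_cover[OF \<omega>] by blast
    have "(\<Sum>i\<in>J n. ennreal (\<phi> (X (a n i) \<omega>)) * indicator (D n i) \<omega>) = (\<Sum>i\<in>J n. if i = j then ennreal (\<phi> (X (a n j) \<omega>)) else 0)"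
      using j D_disj by (intro sum.cong refl) (auto simp: indicator_def)
    also have "\<dots> = G n \<omega>"
      using J_fin on_D[OF j] by (auto simp: G_def J_def indicator_def)
    finally show ?thesis ..
  qed
  have G_le: "(\<integral>\<^sup>+\<omega>. G n \<omega> \<partial>P x) \<le> c * (\<integral>\<^sup>+\<omega>. ennreal (\<phi> (X t \<omega>)) * indicator {\<omega>. \<rho> \<omega> < t} \<omega> \<partial>P x)" for n
  proof -
    have Dm[measurable]: "D n j \<in> sets (P x)" for j
      using D_sets[of n j] sets_F_subset by (auto simp: sets_P[OF x])
    have [measurable]: "(\<lambda>\<omega>. \<phi> (X (a n j) \<omega>)) \<in> borel_measurable (P x)" for j by (rule Xm[OF a_pos])
    have [measurable]: "(\<lambda>\<omega>. \<phi> (X t \<omega>)) \<in> borel_measurable (P x)" by (rule Xm[OF t])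
    have "(\<integral>\<^sup>+\<omega>. G n \<omega> \<partial>P x) = (\<integral>\<^sup>+\<omega>. (\<Sum>j\<in>J n. ennreal (\<phi> (X (a n j) \<omega>)) * indicator (D n j) \<omega>) \<partial>P x)"
      using G_sum by (intro nn_integral_cong) (simp add: space_P[OF x])
    also have "\<dots> = (\<Sum>j\<in>J n. (\<integral>\<^sup>+\<omega>. ennreal (\<phi> (X (a n j) \<omega>)) * indicator (D n j) \<omega> \<partial>P x))"
      by (rule nn_integral_sum) measurable
    also have "\<dots> \<le> (\<Sum>j\<in>J n. c * (\<integral>\<^sup>+\<omega>. ennreal (\<phi> (X t \<omega>)) * indicator (D n j) \<omega> \<partial>P x))"
      using a_pos D_sets by (intro sum_mono markov_domination[OF x _ _ _ \<phi> dom]) (auto simp: J_def)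
    also have "\<dots> = c * (\<integral>\<^sup>+\<omega>. (\<Sum>j\<in>J n. ennreal (\<phi> (X t \<omega>)) * indicator (D n j) \<omega>) \<partial>P x)"
      by (subst nn_integral_sum) (auto simp: sum_distrib_left)
    also have "\<dots> \<le> c * (\<integral>\<^sup>+\<omega>. ennreal (\<phi> (X t \<omega>)) * indicator {\<omega>. \<rho> \<omega> < t} \<omega> \<partial>P x)"
    proof (intro mult_left_mono nn_integral_mono)
      fix \<omega> assume "\<omega> \<in> space (P x)"
      then obtain j where j: "\<omega> \<in> D n j" using D_cover by (auto simp: space_P[OF x])
      have "(\<Sum>i\<in>J n. ennreal (\<phi> (X t \<omega>)) * indicator (D n i) \<omega>) = (\<Sum>i\<in>J n. if i = j then ennreal (\<phi> (X t \<omega>)) else 0)"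
        using j D_disj by (intro sum.cong refl) (auto simp: indicator_def)
      also have "\<dots> \<le> ennreal (\<phi> (X t \<omega>)) * indicator {\<omega>. \<rho> \<omega> < t} \<omega>"
        using J_fin on_D[OF j] g_gt[of \<omega> n] by (auto simp: J_def indicator_def)
      finally show "(\<Sum>i\<in>J n. ennreal (\<phi> (X t \<omega>)) * indicator (D n i) \<omega>) \<le> ennreal (\<phi> (X t \<omega>)) * indicator {\<omega>. \<rho> \<omega> < t} \<omega>" .
    qed simp
    finally show ?thesis .
  qed
  have gm[measurable]: "g n \<in> borel_measurable (P x)" for n unfolding g_def[abs_def] by measurable
  have G_meas: "G n \<in> borel_measurable (P x)" for n
  proof -
    have [measurable]: "(\<lambda>\<omega>. \<phi> (X (g n \<omega>) \<omega>)) \<in> borel_measurable (P x)"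
      using \<rho>0 g_gt by (intro X_at_random_time_measurable[OF x \<phi> gm]) (meson less_imp_le order_trans)
    show ?thesis unfolding G_def[abs_def] by measurable
  qed
  have "(\<integral>\<^sup>+\<omega>. ennreal (\<phi> (X (\<rho> \<omega>) \<omega>)) * indicator {\<omega>. \<rho> \<omega> < t} \<omega> \<partial>P x) \<le> (\<integral>\<^sup>+\<omega>. liminf (\<lambda>n. G n \<omega>) \<partial>P x)"
  proof (rule nn_integral_mono)
    fix \<omega> assume "\<omega> \<in> space (P x)"
    then have \<omega>: "\<omega> \<in> space \<Omega>" by (simp add: space_P[OF x])
    show "ennreal (\<phi> (X (\<rho> \<omega>) \<omega>)) * indicator {\<omega>. \<rho> \<omega> < t} \<omega> \<le> liminf (\<lambda>n. G n \<omega>)"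
    proof (cases "\<rho> \<omega> < t")
      case True
      have lim: "filterlim (\<lambda>n. g n \<omega>) (at_right (\<rho> \<omega>)) sequentially"
        unfolding g_def by (rule at_right_grid)
      have "((\<lambda>s. X s \<omega>) \<longlongrightarrow> X (\<rho> \<omega>) \<omega>) (at_right (\<rho> \<omega>))"
        using cadlag_paths[OF \<omega>] \<rho>0[OF \<omega>] by (auto simp: cadlag_def continuous_within)
      from filterlim_compose[OF this lim]
      have "(\<lambda>n. \<phi> (X (g n \<omega>) \<omega>)) \<longlonglongrightarrow> \<phi> (X (\<rho> \<omega>) \<omega>)"
        using \<phi> by (intro continuous_on_tendsto_compose[OF \<phi>]) auto
      then have "(\<lambda>n. ennreal (\<phi> (X (g n \<omega>) \<omega>))) \<longlonglongrightarrow> ennreal (\<phi> (X (\<rho> \<omega>) \<omega>))"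
        by (rule tendsto_ennrealI)
      moreover have "eventually (\<lambda>n. g n \<omega> < t) sequentially"
      proof -
        have "(\<lambda>n. g n \<omega>) \<longlonglongrightarrow> \<rho> \<omega>" using lim by (simp add: filterlim_at)
        then show ?thesis using True by (rule order_tendstoD(2))
      qed
      then have "eventually (\<lambda>n. ennreal (\<phi> (X (g n \<omega>) \<omega>)) = G n \<omega>) sequentially"
        by eventually_elim (simp add: G_def)
      ultimately have "(\<lambda>n. G n \<omega>) \<longlonglongrightarrow> ennreal (\<phi> (X (\<rho> \<omega>) \<omega>))"
        by (rule Lim_transform_eventually)
      then have "liminf (\<lambda>n. G n \<omega>) = ennreal (\<phi> (X (\<rho> \<omega>) \<omega>))"
        by (intro lim_imp_Liminf) auto
      then show ?thesis using True by simp
    qed simp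
  qed
  also have "\<dots> \<le> liminf (\<lambda>n. \<integral>\<^sup>+\<omega>. G n \<omega> \<partial>P x)"
    by (rule nn_integral_liminf[OF G_meas])
  also have "\<dots> \<le> limsup (\<lambda>n. \<integral>\<^sup>+\<omega>. G n \<omega> \<partial>P x)"
    by (rule Liminf_le_Limsup) simp
  also have "\<dots> \<le> c * (\<integral>\<^sup>+\<omega>. ennreal (\<phi> (X t \<omega>)) * indicator {\<omega>. \<rho> \<omega> < t} \<omega> \<partial>P x)"
    using G_le by (intro Limsup_bounded always_eventually) auto
  finally show ?thesis .
qed

section \<open>Dynkin's formula for unbounded functions\<close>

text \<open>Here \<open>v\<close> is a version of the extended generator applied to \<open>u\<close>. Both are continuous on the whole
  space, so that path integrals exist along every path and not just almost surely.\<close>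

definition dynkin_pair :: "(real ^ 'd \<Rightarrow> real) \<Rightarrow> (real ^ 'd \<Rightarrow> real) \<Rightarrow> bool" where
  "dynkin_pair u v \<longleftrightarrow> continuous_on UNIV u \<and> continuous_on UNIV v \<and>
     (\<forall>x\<in>S. local_martingale (P x) F (dynkin_process X x u v))"

lemma localizing_times:
  assumes x: "x \<in> S" and uv: "dynkin_pair u v"
  obtains \<tau> where "\<And>n. stopping_time F (\<tau> n)" "\<And>n \<omega>. \<omega> \<in> space \<Omega> \<Longrightarrow> 0 \<le> \<tau> n \<omega>"
    "AE \<omega> in P x. filterlim (\<lambda>n. \<tau> n \<omega>) at_top sequentially"
    "\<And>n. martingale (P x) F (\<lambda>t \<omega>. dynkin_process X x u v (min t (\<tau> n \<omega>)) \<omega>)"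
proof -
  have "local_martingale (P x) F (dynkin_process X x u v)"
    using x uv by (simp add: dynkin_pair_def)
  then obtain \<tau> where \<tau>: "\<forall>n. stopping_time F (\<tau> n) \<and> (\<forall>\<omega>\<in>space (P x). 0 \<le> \<tau> n \<omega>)"
    "AE \<omega> in P x. incseq (\<lambda>n. \<tau> n \<omega>) \<and> filterlim (\<lambda>n. \<tau> n \<omega>) at_top sequentially"
    "\<forall>n. martingale (P x) F (\<lambda>t \<omega>. dynkin_process X x u v (min t (\<tau> n \<omega>)) \<omega>)"
    unfolding local_martingale_def by (elim exE conjE)
  from \<tau>(2) have "AE \<omega> in P x. filterlim (\<lambda>n. \<tau> n \<omega>) at_top sequentially"
    by eventually_elim simp
  with \<tau>(1,3) show ?thesis by (intro that[of \<tau>]) (auto simp: space_P[OF x])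
qed

lemma dynkin_jointly_measurable:
  assumes "x \<in> S" "continuous_on UNIV u" "continuous_on UNIV v"
  shows "(\<lambda>(s, \<omega>). dynkin_process X x u v (max 0 s) \<omega>) \<in> borel_measurable (borel \<Otimes>\<^sub>M P x)"
proof -
  have m: "(\<lambda>z. (max 0 (fst z), snd z)) \<in> borel \<Otimes>\<^sub>M P x \<rightarrow>\<^sub>M (borel :: real measure) \<Otimes>\<^sub>M P x"
    by measurable
  have "(\<lambda>z. LBINT r:{0..max 0 (fst z)}. v (X r (snd z))) \<in> borel_measurable (borel \<Otimes>\<^sub>M P x)"
    using measurable_compose[OF m path_integral_jointly_measurable[OF assms(1,3)]] by simp
  moreover have "(\<lambda>z. u (X (max 0 (fst z)) (snd z))) \<in> borel_measurable (borel \<Otimes>\<^sub>M P x)"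
    using continuous_X_jointly_measurable[OF assms(1,2)] by (simp add: split_beta')
  ultimately show ?thesis
    unfolding dynkin_process_def split_beta' by (intro borel_measurable_diff borel_measurable_const)
qed

lemma dynkin_at_0:
  assumes "x \<in> S"
  shows "AE \<omega> in P x. dynkin_process X x u v 0 \<omega> = 0"
  using initial[OF assms] by eventually_elim (simp add: dynkin_process_def set_integral_point)

lemma stopped_dynkin:
  assumes x: "x \<in> S" and uv: "continuous_on UNIV u" "continuous_on UNIV v"
    and \<tau>: "\<And>\<omega>. \<omega> \<in> space \<Omega> \<Longrightarrow> 0 \<le> \<tau> \<omega>"
    and mart: "martingale (P x) F (\<lambda>t \<omega>. dynkin_process X x u v (min t (\<tau> \<omega>)) \<omega>)"
    and s: "0 \<le> s"
  shows "integrable (P x) (\<lambda>\<omega>. dynkin_process X x u v (min s (\<tau> \<omega>)) \<omega>)"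
    and "(LINT \<omega>|P x. dynkin_process X x u v (min s (\<tau> \<omega>)) \<omega>) = 0"
proof -
  show int: "integrable (P x) (\<lambda>\<omega>. dynkin_process X x u v (min s (\<tau> \<omega>)) \<omega>)"
    using mart s by (auto simp: martingale_def)
  have "(LINT \<omega>|P x. dynkin_process X x u v (min s (\<tau> \<omega>)) \<omega>) = (LINT \<omega>|P x. dynkin_process X x u v (min 0 (\<tau> \<omega>)) \<omega>)"
    by (rule martingale_expectation(1)[OF finite_measure_P[OF x] subalgebra_P[OF x] mart _ s]) simp
  also have "\<dots> = 0"
  proof (rule integral_eq_zero_AE)
    show "AE \<omega> in P x. dynkin_process X x u v (min 0 (\<tau> \<omega>)) \<omega> = 0"
      using dynkin_at_0[OF x, of u v] AE_space
      by eventually_elim (use \<tau> in \<open>simp add: space_P[OF x] min_absorb1\<close>)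
  qed
  finally show "(LINT \<omega>|P x. dynkin_process X x u v (min s (\<tau> \<omega>)) \<omega>) = 0" .
qed

lemma dynkin_process_cong:
  assumes "0 \<le> t" "\<omega> \<in> space \<Omega>" "x \<in> S"
    and "\<And>y. y \<in> S \<Longrightarrow> u y = u' y" "\<And>y. y \<in> S \<Longrightarrow> v y = v' y"
  shows "dynkin_process X x u v t \<omega> = dynkin_process X x u' v' t \<omega>"
proof -
  have "(LBINT s:{0..t}. v (X s \<omega>)) = (LBINT s:{0..t}. v' (X s \<omega>))"
    using assms(5)[OF state_space[OF _ assms(2)]] by (intro set_lebesgue_integral_cong) auto
  then show ?thesis
    using assms(4)[OF state_space[OF assms(1,2)]] assms(4)[OF assms(3)] by (simp add: dynkin_process_def)
qed

lemma expectation_path_integral: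
  fixes v :: "real ^ 'd \<Rightarrow> real"
  assumes x: "x \<in> S" and v: "continuous_on UNIV v" and t: "0 \<le> t"
    and b: "\<And>s. \<lbrakk>0 \<le> s; s \<le> t\<rbrakk> \<Longrightarrow> (\<integral>\<^sup>+\<omega>. ennreal \<bar>v (X s \<omega>)\<bar> \<partial>P x) \<le> ennreal B"
  shows "integrable (P x) (\<lambda>\<omega>. LBINT s:{0..t}. v (X s \<omega>))"
    and "integrable (P x) (\<lambda>\<omega>. LBINT s:{0..t}. \<bar>v (X s \<omega>)\<bar>)"
    and "(LINT \<omega>|P x. (LBINT s:{0..t}. v (X s \<omega>))) = (LBINT s:{0..t}. (LINT \<omega>|P x. v (X s \<omega>)))"
    and "set_integrable lborel {0..t} (\<lambda>s. LINT \<omega>|P x. v (X s \<omega>))"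
proof -
  have cut: "(LBINT s:{0..t}. h (max 0 s)) = (LBINT s:{0..t}. h s)" for h :: "real \<Rightarrow> real"
    unfolding set_lebesgue_integral_def
    by (intro Bochner_Integration.integral_cong) (auto simp: indicator_def)
  have av: "continuous_on UNIV (\<lambda>y. \<bar>v y\<bar>)" using v by (intro continuous_intros)
  have b': "(\<integral>\<^sup>+\<omega>. \<bar>v (X (max 0 s) \<omega>)\<bar> \<partial>P x) \<le> ennreal B" if "0 \<le> s" "s \<le> t" for s
    using b[OF that] that by simp
  have b'': "(\<integral>\<^sup>+\<omega>. \<bar>\<bar>v (X (max 0 s) \<omega>)\<bar>\<bar> \<partial>P x) \<le> ennreal B" if "0 \<le> s" "s \<le> t" for s
    using b'[OF that] by simp
  have e1: "integrable (P x) (\<lambda>\<omega>. LBINT s:{0..t}. v (X (max 0 s) \<omega>))"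
    "(LINT \<omega>|P x. (LBINT s:{0..t}. v (X (max 0 s) \<omega>))) = (LBINT s:{0..t}. (LINT \<omega>|P x. v (X (max 0 s) \<omega>)))"
    "set_integrable lborel {0..t} (\<lambda>s. LINT \<omega>|P x. v (X (max 0 s) \<omega>))"
    by (rule expectation_set_integral[OF sigma_finite_P[OF x] t continuous_X_jointly_measurable[OF x v]], erule (1) b')+
  have e2: "integrable (P x) (\<lambda>\<omega>. LBINT s:{0..t}. \<bar>v (X (max 0 s) \<omega>)\<bar>)"
    by (rule expectation_set_integral[OF sigma_finite_P[OF x] t continuous_X_jointly_measurable[OF x av]], erule (1) b'')
  show "integrable (P x) (\<lambda>\<omega>. LBINT s:{0..t}. v (X s \<omega>))"
    using e1(1) unfolding cut[of "\<lambda>s. v (X s _)"] .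
  show "integrable (P x) (\<lambda>\<omega>. LBINT s:{0..t}. \<bar>v (X s \<omega>)\<bar>)"
    using e2 unfolding cut[of "\<lambda>s. \<bar>v (X s _)\<bar>"] .
  show "(LINT \<omega>|P x. (LBINT s:{0..t}. v (X s \<omega>))) = (LBINT s:{0..t}. (LINT \<omega>|P x. v (X s \<omega>)))"
    using e1(2) unfolding cut[of "\<lambda>s. v (X s _)"] cut[of "\<lambda>s. LINT \<omega>|P x. v (X s \<omega>)"] .
  have "(\<lambda>s. indicat_real {0..t} s *\<^sub>R (LINT \<omega>|P x. v (X (max 0 s) \<omega>))) = (\<lambda>s. indicator {0..t} s *\<^sub>R (LINT \<omega>|P x. v (X s \<omega>)))"
    by (rule ext) (simp add: indicator_def)
  with e1(3) show "set_integrable lborel {0..t} (\<lambda>s. LINT \<omega>|P x. v (X s \<omega>))"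
    unfolding set_integrable_def by (simp only:)
qed

text \<open>Only the time integral is controlled here; whether the expectation may be interchanged with the
  limit in \<open>u\<close> is left to the two lemmas that use this one.\<close>

lemma localized_expectation:
  assumes x: "x \<in> S" and uv: "dynkin_pair u v" and t: "0 \<le> t"
    and int: "integrable (P x) (\<lambda>\<omega>. LBINT s:{0..t}. \<bar>v (X s \<omega>)\<bar>)"
  obtains \<tau> where "\<And>n. stopping_time F (\<tau> n)" "\<And>n \<omega>. \<omega> \<in> space \<Omega> \<Longrightarrow> 0 \<le> \<tau> n \<omega>"
    "AE \<omega> in P x. filterlim (\<lambda>n. \<tau> n \<omega>) at_top sequentially"
    "\<And>n. integrable (P x) (\<lambda>\<omega>. u (X (min t (\<tau> n \<omega>)) \<omega>))"
    "(\<lambda>n. LINT \<omega>|P x. u (X (min t (\<tau> n \<omega>)) \<omega>)) \<longlonglongrightarrow> u x + (LINT \<omega>|P x. (LBINT s:{0..t}. v (X s \<omega>)))"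
proof -
  interpret prob_space "P x" by (rule prob_space_P[OF x])
  have u: "continuous_on UNIV u" and v: "continuous_on UNIV v" using uv by (auto simp: dynkin_pair_def)
  obtain \<tau> where \<tau>: "\<And>n. stopping_time F (\<tau> n)" "\<And>n \<omega>. \<omega> \<in> space \<Omega> \<Longrightarrow> 0 \<le> \<tau> n \<omega>"
    "AE \<omega> in P x. filterlim (\<lambda>n. \<tau> n \<omega>) at_top sequentially"
    and mart: "\<And>n. martingale (P x) F (\<lambda>t \<omega>. dynkin_process X x u v (min t (\<tau> n \<omega>)) \<omega>)"
    using localizing_times[OF x uv] by blast
  let ?M = "\<lambda>n \<omega>. dynkin_process X x u v (min t (\<tau> n \<omega>)) \<omega>"
  let ?I = "\<lambda>n \<omega>. LBINT s:{0..min t (\<tau> n \<omega>)}. v (X s \<omega>)"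
  have \<tau>m[measurable]: "\<tau> n \<in> borel_measurable (P x)" for n
    using stopping_time_measurable[OF \<tau>(1)] by (simp add: measurable_P[OF x])
  have eq: "u (X (min t (\<tau> n \<omega>)) \<omega>) = ?M n \<omega> + u x + ?I n \<omega>" for n \<omega>
    by (simp add: dynkin_process_def)
  have Im: "(\<lambda>\<omega>. LBINT s:{0..h \<omega>}. v (X s \<omega>)) \<in> borel_measurable (P x)" if "h \<in> borel_measurable (P x)" for h
    using measurable_compose[OF measurable_Pair[OF that measurable_ident] path_integral_jointly_measurable[OF x v]] by simp
  have Ib: "\<bar>?I n \<omega>\<bar> \<le> (LBINT s:{0..t}. \<bar>v (X s \<omega>)\<bar>)" if "\<omega> \<in> space (P x)" for n \<omega>
    using path_integrable[OF x _ v, of \<omega> t] that by (intro set_integral_abs_le) (auto simp: space_P[OF x])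
  have Ii: "integrable (P x) (?I n)" for n
  proof (rule Bochner_Integration.integrable_bound[OF int Im])
    show "AE \<omega> in P x. norm (?I n \<omega>) \<le> norm (LBINT s:{0..t}. \<bar>v (X s \<omega>)\<bar>)"
    proof (rule AE_I2)
      fix \<omega> assume "\<omega> \<in> space (P x)"
      from Ib[OF this, of n] show "norm (?I n \<omega>) \<le> norm (LBINT s:{0..t}. \<bar>v (X s \<omega>)\<bar>)"
        unfolding real_norm_def by linarith
    qed
  qed measurable
  have lim: "(\<lambda>n. LINT \<omega>|P x. ?I n \<omega>) \<longlonglongrightarrow> (LINT \<omega>|P x. (LBINT s:{0..t}. v (X s \<omega>)))"
  proof (rule integral_dominated_convergence[OF _ _ int])
    show "AE \<omega> in P x. (\<lambda>n. ?I n \<omega>) \<longlonglongrightarrow> (LBINT s:{0..t}. v (X s \<omega>))"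
      using \<tau>(3)
    proof eventually_elim
      fix \<omega> assume "filterlim (\<lambda>n. \<tau> n \<omega>) at_top sequentially"
      then have "eventually (\<lambda>n. t \<le> \<tau> n \<omega>) sequentially" by (simp add: filterlim_at_top)
      then have "eventually (\<lambda>n. (LBINT s:{0..t}. v (X s \<omega>)) = ?I n \<omega>) sequentially"
        by eventually_elim (simp add: min_absorb1)
      then show "(\<lambda>n. ?I n \<omega>) \<longlonglongrightarrow> (LBINT s:{0..t}. v (X s \<omega>))"
        by (rule Lim_transform_eventually[OF tendsto_const])
    qed
    show "AE \<omega> in P x. norm (?I n \<omega>) \<le> (LBINT s:{0..t}. \<bar>v (X s \<omega>)\<bar>)" for n
      using Ib by (intro AE_I2) simp
  qed (auto intro!: Im)
  note M = stopped_dynkin[OF x u v \<tau>(2) mart t]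
  have "(LINT \<omega>|P x. u (X (min t (\<tau> n \<omega>)) \<omega>)) = u x + (LINT \<omega>|P x. ?I n \<omega>)" for n
    unfolding eq using M[of n] Ii[of n] by (simp add: prob_space)
  moreover have "integrable (P x) (\<lambda>\<omega>. u (X (min t (\<tau> n \<omega>)) \<omega>))" for n
    unfolding eq using M[of n] Ii[of n] by simp
  ultimately show ?thesis
    using tendsto_add[OF tendsto_const lim, of "u x"] by (intro that[OF \<tau>]) simp_all
qed

lemma stopped_fatou:
  fixes h :: "real ^ 'd \<Rightarrow> real"
  assumes x: "x \<in> S" and t: "0 \<le> t" and h: "continuous_on UNIV h"
    and \<tau>: "\<And>n. stopping_time F (\<tau> n)" "\<And>n \<omega>. \<omega> \<in> space \<Omega> \<Longrightarrow> 0 \<le> \<tau> n \<omega>"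
    "AE \<omega> in P x. filterlim (\<lambda>n. \<tau> n \<omega>) at_top sequentially"
  shows "(\<integral>\<^sup>+\<omega>. ennreal (h (X t \<omega>)) \<partial>P x) \<le> liminf (\<lambda>n. \<integral>\<^sup>+\<omega>. ennreal (h (X (min t (\<tau> n \<omega>)) \<omega>)) \<partial>P x)"
proof -
  have [measurable]: "\<tau> n \<in> borel_measurable (P x)" for n
    using stopping_time_measurable[OF \<tau>(1)] by (simp add: measurable_P[OF x])
  have m: "(\<lambda>\<omega>. h (X (min t (\<tau> n \<omega>)) \<omega>)) \<in> borel_measurable (P x)" for n
    using \<tau>(2)[of _ n] t by (intro X_at_random_time_measurable[OF x h]) auto
  have "(\<integral>\<^sup>+\<omega>. ennreal (h (X t \<omega>)) \<partial>P x) \<le> (\<integral>\<^sup>+\<omega>. liminf (\<lambda>n. ennreal (h (X (min t (\<tau> n \<omega>)) \<omega>))) \<partial>P x)"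
  proof (rule nn_integral_mono_AE)
    show "AE \<omega> in P x. ennreal (h (X t \<omega>)) \<le> liminf (\<lambda>n. ennreal (h (X (min t (\<tau> n \<omega>)) \<omega>)))"
      using \<tau>(3)
    proof eventually_elim
      fix \<omega> assume "filterlim (\<lambda>n. \<tau> n \<omega>) at_top sequentially"
      then have "eventually (\<lambda>n. t \<le> \<tau> n \<omega>) sequentially" by (simp add: filterlim_at_top)
      then have "eventually (\<lambda>n. ennreal (h (X t \<omega>)) \<le> ennreal (h (X (min t (\<tau> n \<omega>)) \<omega>))) sequentially"
        by eventually_elim (simp add: min_absorb1)
      then show "ennreal (h (X t \<omega>)) \<le> liminf (\<lambda>n. ennreal (h (X (min t (\<tau> n \<omega>)) \<omega>)))"
        by (rule Liminf_bounded)
    qed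
  qed
  also have "\<dots> \<le> liminf (\<lambda>n. \<integral>\<^sup>+\<omega>. ennreal (h (X (min t (\<tau> n \<omega>)) \<omega>)) \<partial>P x)"
    using m by (intro nn_integral_liminf) simp
  finally show ?thesis .
qed

text \<open>Fatou's lemma loses mass in one direction only, so for functions bounded below half of Dynkin's
  formula survives the removal of the localizing times.\<close>

lemma dynkin_fatou:
  assumes x: "x \<in> S" and uv: "dynkin_pair u v" and t: "0 \<le> t"
    and int: "integrable (P x) (\<lambda>\<omega>. LBINT s:{0..t}. \<bar>v (X s \<omega>)\<bar>)"
    and lower: "\<And>y. y \<in> S \<Longrightarrow> - K \<le> u y"
    and ui: "integrable (P x) (\<lambda>\<omega>. u (X t \<omega>))"
  shows "(LINT \<omega>|P x. u (X t \<omega>)) \<le> u x + (LINT \<omega>|P x. (LBINT s:{0..t}. v (X s \<omega>)))"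
proof -
  interpret prob_space "P x" by (rule prob_space_P[OF x])
  obtain \<tau> where \<tau>: "\<And>n. stopping_time F (\<tau> n)" "\<And>n \<omega>. \<omega> \<in> space \<Omega> \<Longrightarrow> 0 \<le> \<tau> n \<omega>"
    "AE \<omega> in P x. filterlim (\<lambda>n. \<tau> n \<omega>) at_top sequentially"
    "\<And>n. integrable (P x) (\<lambda>\<omega>. u (X (min t (\<tau> n \<omega>)) \<omega>))"
    and lim: "(\<lambda>n. LINT \<omega>|P x. u (X (min t (\<tau> n \<omega>)) \<omega>)) \<longlonglongrightarrow> u x + (LINT \<omega>|P x. (LBINT s:{0..t}. v (X s \<omega>)))"
    using localized_expectation[OF x uv t int] by blast
  let ?Y = "\<lambda>n \<omega>. u (X (min t (\<tau> n \<omega>)) \<omega>) + K"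
  have Y0: "0 \<le> ?Y n \<omega>" if "\<omega> \<in> space (P x)" for n \<omega>
    using lower[OF state_space[of "min t (\<tau> n \<omega>)" \<omega>]] \<tau>(2)[of \<omega> n] that t by (simp add: space_P[OF x])
  have Z0: "0 \<le> u (X t \<omega>) + K" if "\<omega> \<in> space (P x)" for \<omega>
    using lower[OF state_space[OF t]] that by (force simp: space_P[OF x])
  have "continuous_on UNIV (\<lambda>y. u y + K)"
    using uv by (intro continuous_intros) (auto simp: dynkin_pair_def)
  from stopped_fatou[OF x t this \<tau>(1-3)]
  have "(\<integral>\<^sup>+\<omega>. ennreal (u (X t \<omega>) + K) \<partial>P x) \<le> liminf (\<lambda>n. \<integral>\<^sup>+\<omega>. ennreal (?Y n \<omega>) \<partial>P x)" .
  also have "(\<lambda>n. \<integral>\<^sup>+\<omega>. ennreal (?Y n \<omega>) \<partial>P x) = (\<lambda>n. ennreal ((LINT \<omega>|P x. u (X (min t (\<tau> n \<omega>)) \<omega>)) + K))"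
    using \<tau>(4) Y0 by (intro ext, subst nn_integral_eq_integral) (auto simp: prob_space)
  also have "liminf \<dots> = ennreal (u x + (LINT \<omega>|P x. (LBINT s:{0..t}. v (X s \<omega>))) + K)"
    by (intro lim_imp_Liminf tendsto_ennrealI tendsto_add lim tendsto_const) simp
  also have "(\<integral>\<^sup>+\<omega>. ennreal (u (X t \<omega>) + K) \<partial>P x) = ennreal ((LINT \<omega>|P x. u (X t \<omega>)) + K)"
    using ui Z0 by (subst nn_integral_eq_integral) (auto simp: prob_space)
  finally have "ennreal ((LINT \<omega>|P x. u (X t \<omega>)) + K) \<le> ennreal (u x + (LINT \<omega>|P x. (LBINT s:{0..t}. v (X s \<omega>))) + K)" .
  moreover have "0 \<le> u x + (LINT \<omega>|P x. (LBINT s:{0..t}. v (X s \<omega>))) + K"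
  proof (rule LIMSEQ_le_const[OF tendsto_add[OF lim tendsto_const]])
    have "0 \<le> (LINT \<omega>|P x. u (X (min t (\<tau> n \<omega>)) \<omega>)) + K" for n
    proof -
      have "0 \<le> (LINT \<omega>|P x. ?Y n \<omega>)" using Y0 by (intro integral_nonneg_AE AE_I2)
      then show ?thesis using \<tau>(4) by (simp add: prob_space)
    qed
    then show "\<exists>N. \<forall>n\<ge>N. 0 \<le> (LINT \<omega>|P x. u (X (min t (\<tau> n \<omega>)) \<omega>)) + K" by blast
  qed
  ultimately show ?thesis by (simp add: ennreal_le_iff)
qed

text \<open>On the event that the localizing time \<open>\<tau>\<^sub>n\<close> comes before \<open>t\<close>, the error is at most a multiple of
  \<open>\<phi>\<close> at \<open>\<tau>\<^sub>n\<close> and at \<open>t\<close>; both contributions vanish as \<open>n\<close> grows, by stopped domination.\<close>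

lemma dynkin_formula_dominated:
  assumes x: "x \<in> S" and uv: "dynkin_pair u v" and t: "0 \<le> t"
    and int: "integrable (P x) (\<lambda>\<omega>. LBINT s:{0..t}. \<bar>v (X s \<omega>)\<bar>)"
    and \<phi>: "continuous_on UNIV \<phi>" "\<And>y. 0 \<le> \<phi> y"
    and dom: "\<And>y r. \<lbrakk>y \<in> S; 0 \<le> r; r \<le> t\<rbrakk> \<Longrightarrow> ennreal (\<phi> y) \<le> ennreal c * (\<integral>\<^sup>+\<omega>. \<phi> (X r \<omega>) \<partial>P y)"
    and \<phi>i: "integrable (P x) (\<lambda>\<omega>. \<phi> (X t \<omega>))"
    and C: "0 \<le> C" and le: "\<And>y. y \<in> S \<Longrightarrow> \<bar>u y\<bar> \<le> C * \<phi> y"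
  shows "(LINT \<omega>|P x. u (X t \<omega>)) = u x + (LINT \<omega>|P x. (LBINT s:{0..t}. v (X s \<omega>)))"
proof -
  interpret prob_space "P x" by (rule prob_space_P[OF x])
  have u: "continuous_on UNIV u" and v: "continuous_on UNIV v" using uv by (auto simp: dynkin_pair_def)
  obtain \<tau> where \<tau>: "\<And>n. stopping_time F (\<tau> n)" "\<And>n \<omega>. \<omega> \<in> space \<Omega> \<Longrightarrow> 0 \<le> \<tau> n \<omega>"
    "AE \<omega> in P x. filterlim (\<lambda>n. \<tau> n \<omega>) at_top sequentially"
    "\<And>n. integrable (P x) (\<lambda>\<omega>. u (X (min t (\<tau> n \<omega>)) \<omega>))"
    and lim: "(\<lambda>n. LINT \<omega>|P x. u (X (min t (\<tau> n \<omega>)) \<omega>)) \<longlonglongrightarrow> u x + (LINT \<omega>|P x. (LBINT s:{0..t}. v (X s \<omega>)))"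
    using localized_expectation[OF x uv t int] by blast
  have \<tau>m[measurable]: "\<tau> n \<in> borel_measurable (P x)" for n
    using stopping_time_measurable[OF \<tau>(1)] by (simp add: measurable_P[OF x])
  have \<phi>m[measurable]: "(\<lambda>\<omega>. \<phi> (X t \<omega>)) \<in> borel_measurable (P x)" by (rule continuous_X_measurable[OF x t \<phi>(1)])
  have \<phi>\<tau>m[measurable]: "(\<lambda>\<omega>. \<phi> (X (\<tau> n \<omega>) \<omega>)) \<in> borel_measurable (P x)" for n
    by (rule X_at_random_time_measurable[OF x \<phi>(1) \<tau>m \<tau>(2)])
  have ui: "integrable (P x) (\<lambda>\<omega>. u (X t \<omega>))"
  proof (rule Bochner_Integration.integrable_bound[OF integrable_mult_right[OF \<phi>i, of C]])
    show "(\<lambda>\<omega>. u (X t \<omega>)) \<in> borel_measurable (P x)" by (rule continuous_X_measurable[OF x t u])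
    show "AE \<omega> in P x. norm (u (X t \<omega>)) \<le> norm (C * \<phi> (X t \<omega>))"
      using le[OF state_space[OF t]] C \<phi>(2) by (intro AE_I2) (simp add: space_P[OF x] abs_mult)
  qed
  let ?A = "\<lambda>n. \<integral>\<^sup>+\<omega>. ennreal (\<phi> (X t \<omega>)) * indicator {\<omega>. \<tau> n \<omega> < t} \<omega> \<partial>P x"
  have A0: "?A \<longlonglongrightarrow> 0"
  proof -
    have "?A \<longlonglongrightarrow> (\<integral>\<^sup>+\<omega>. 0 \<partial>P x)"
    proof (rule nn_integral_dominated_convergence[where w="\<lambda>\<omega>. ennreal (\<phi> (X t \<omega>))"])
      show "(\<integral>\<^sup>+\<omega>. ennreal (\<phi> (X t \<omega>)) \<partial>P x) < \<infinity>"
        using \<phi>i \<phi>(2) by (simp add: integrable_iff_bounded)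
      show "AE \<omega> in P x. (\<lambda>n. ennreal (\<phi> (X t \<omega>)) * indicator {\<omega>. \<tau> n \<omega> < t} \<omega>) \<longlonglongrightarrow> 0"
        using \<tau>(3)
      proof eventually_elim
        fix \<omega> assume "filterlim (\<lambda>n. \<tau> n \<omega>) at_top sequentially"
        then have "eventually (\<lambda>n. t \<le> \<tau> n \<omega>) sequentially" by (simp add: filterlim_at_top)
        then have "eventually (\<lambda>n. 0 = ennreal (\<phi> (X t \<omega>)) * indicator {\<omega>. \<tau> n \<omega> < t} \<omega>) sequentially"
          by eventually_elim simp
        then show "(\<lambda>n. ennreal (\<phi> (X t \<omega>)) * indicator {\<omega>. \<tau> n \<omega> < t} \<omega>) \<longlonglongrightarrow> 0"
          by (rule Lim_transform_eventually[OF tendsto_const])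
      qed
    qed (auto simp: indicator_def)
    then show ?thesis by simp
  qed
  have diff: "ennreal \<bar>(LINT \<omega>|P x. u (X (min t (\<tau> n \<omega>)) \<omega>)) - (LINT \<omega>|P x. u (X t \<omega>))\<bar> \<le> ennreal (C * (\<bar>c\<bar> + 1)) * ?A n" for n
  proof -
    have "\<bar>(LINT \<omega>|P x. u (X (min t (\<tau> n \<omega>)) \<omega>)) - (LINT \<omega>|P x. u (X t \<omega>))\<bar> =
        \<bar>LINT \<omega>|P x. u (X (min t (\<tau> n \<omega>)) \<omega>) - u (X t \<omega>)\<bar>"
      using \<tau>(4) ui by simp
    also have "\<dots> \<le> (LINT \<omega>|P x. \<bar>u (X (min t (\<tau> n \<omega>)) \<omega>) - u (X t \<omega>)\<bar>)"
      using integral_norm_bound[of "P x" "\<lambda>\<omega>. u (X (min t (\<tau> n \<omega>)) \<omega>) - u (X t \<omega>)"] by simp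
    finally have "ennreal \<bar>(LINT \<omega>|P x. u (X (min t (\<tau> n \<omega>)) \<omega>)) - (LINT \<omega>|P x. u (X t \<omega>))\<bar>
      \<le> ennreal (LINT \<omega>|P x. \<bar>u (X (min t (\<tau> n \<omega>)) \<omega>) - u (X t \<omega>)\<bar>)" by (rule ennreal_leI)
    also have "\<dots> = (\<integral>\<^sup>+\<omega>. ennreal \<bar>u (X (min t (\<tau> n \<omega>)) \<omega>) - u (X t \<omega>)\<bar> \<partial>P x)"
      using \<tau>(4) ui by (intro nn_integral_eq_integral[symmetric]) auto
    also have "\<dots> \<le> (\<integral>\<^sup>+\<omega>. ennreal C * (ennreal (\<phi> (X (\<tau> n \<omega>) \<omega>)) * indicator {\<omega>. \<tau> n \<omega> < t} \<omega> +
        ennreal (\<phi> (X t \<omega>)) * indicator {\<omega>. \<tau> n \<omega> < t} \<omega>) \<partial>P x)"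
    proof (rule nn_integral_mono)
      fix \<omega> assume "\<omega> \<in> space (P x)"
      then have \<omega>: "\<omega> \<in> space \<Omega>" by (simp add: space_P[OF x])
      show "ennreal \<bar>u (X (min t (\<tau> n \<omega>)) \<omega>) - u (X t \<omega>)\<bar> \<le> ennreal C * (ennreal (\<phi> (X (\<tau> n \<omega>) \<omega>)) * indicator {\<omega>. \<tau> n \<omega> < t} \<omega> +
        ennreal (\<phi> (X t \<omega>)) * indicator {\<omega>. \<tau> n \<omega> < t} \<omega>)"
      proof (cases "\<tau> n \<omega> < t")
        case True
        have "\<bar>u (X (\<tau> n \<omega>) \<omega>) - u (X t \<omega>)\<bar> \<le> C * \<phi> (X (\<tau> n \<omega>) \<omega>) + C * \<phi> (X t \<omega>)"
          using le[OF state_space[OF t \<omega>]] le[OF state_space[OF \<tau>(2)[OF \<omega>] \<omega>], of n] by linarith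
        then show ?thesis using True C \<phi>(2)
          by (simp add: ennreal_plus[symmetric] ennreal_mult[symmetric] distrib_left min_absorb2 del: ennreal_plus)
      qed (simp add: min_absorb1)
    qed
    also have "\<dots> = ennreal C * ((\<integral>\<^sup>+\<omega>. ennreal (\<phi> (X (\<tau> n \<omega>) \<omega>)) * indicator {\<omega>. \<tau> n \<omega> < t} \<omega> \<partial>P x) + ?A n)"
      by (subst nn_integral_cmult, measurable, subst nn_integral_add) measurable
    also have "\<dots> \<le> ennreal C * (ennreal c * ?A n + ?A n)"
      by (intro mult_left_mono add_right_mono stopped_domination[OF x t \<tau>(1) \<tau>(2) \<phi>(1) dom]) auto
    also have "\<dots> \<le> ennreal C * (ennreal \<bar>c\<bar> * ?A n + ?A n)"
      by (intro mult_left_mono add_right_mono mult_right_mono ennreal_leI) auto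
    also have "\<dots> = ennreal (C * (\<bar>c\<bar> + 1)) * ?A n"
      using C by (simp add: ennreal_mult distrib_right mult.assoc)
    finally show ?thesis .
  qed
  have "(\<lambda>n. ennreal (C * (\<bar>c\<bar> + 1)) * ?A n) \<longlonglongrightarrow> ennreal (C * (\<bar>c\<bar> + 1)) * 0"
    by (intro ennreal_tendsto_cmult A0) simp
  then have lim0: "(\<lambda>n. ennreal (C * (\<bar>c\<bar> + 1)) * ?A n) \<longlonglongrightarrow> 0" by simp
  have "(\<lambda>n. ennreal \<bar>(LINT \<omega>|P x. u (X (min t (\<tau> n \<omega>)) \<omega>)) - (LINT \<omega>|P x. u (X t \<omega>))\<bar>) \<longlonglongrightarrow> 0"
    by (rule tendsto_sandwich[OF _ _ tendsto_const lim0]) (auto intro!: always_eventually diff)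
  then have "(\<lambda>n. ennreal \<bar>(LINT \<omega>|P x. u (X (min t (\<tau> n \<omega>)) \<omega>)) - (LINT \<omega>|P x. u (X t \<omega>))\<bar>) \<longlonglongrightarrow> ennreal 0"
    by simp
  then have "(\<lambda>n. \<bar>(LINT \<omega>|P x. u (X (min t (\<tau> n \<omega>)) \<omega>)) - (LINT \<omega>|P x. u (X t \<omega>))\<bar>) \<longlonglongrightarrow> 0"
    by (rule tendsto_ennrealD) auto
  then have "(\<lambda>n. (LINT \<omega>|P x. u (X (min t (\<tau> n \<omega>)) \<omega>)) - (LINT \<omega>|P x. u (X t \<omega>))) \<longlonglongrightarrow> 0"
    by (rule tendsto_rabs_zero_cancel)
  then have "(\<lambda>n. LINT \<omega>|P x. u (X (min t (\<tau> n \<omega>)) \<omega>)) \<longlonglongrightarrow> (LINT \<omega>|P x. u (X t \<omega>))"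
    by (rule LIM_zero_cancel)
  then show ?thesis using lim by (rule LIMSEQ_unique)
qed

text \<open>Each path of the stopped process satisfies Gronwall's inequality with the stopped martingale as
  inhomogeneous term, whose expectation is constant. The bound does not depend on the localizing time.\<close>

lemma dynkin_exponential_bound:
  assumes x: "x \<in> S" and uv: "dynkin_pair u v" and t: "0 \<le> t" and C: "0 \<le> C"
    and u0: "\<And>y. y \<in> S \<Longrightarrow> 0 \<le> u y" and le: "\<And>y. y \<in> S \<Longrightarrow> v y \<le> C * u y"
  shows "(\<integral>\<^sup>+\<omega>. u (X t \<omega>) \<partial>P x) \<le> ennreal (u x * exp (C * t))"
proof -
  interpret prob_space "P x" by (rule prob_space_P[OF x])
  have u: "continuous_on UNIV u" and v: "continuous_on UNIV v" using uv by (auto simp: dynkin_pair_def)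
  obtain \<tau> where \<tau>: "\<And>n. stopping_time F (\<tau> n)" "\<And>n \<omega>. \<omega> \<in> space \<Omega> \<Longrightarrow> 0 \<le> \<tau> n \<omega>"
    "AE \<omega> in P x. filterlim (\<lambda>n. \<tau> n \<omega>) at_top sequentially"
    and mart: "\<And>n. martingale (P x) F (\<lambda>t \<omega>. dynkin_process X x u v (min t (\<tau> n \<omega>)) \<omega>)"
    using localizing_times[OF x uv] by blast
  have \<tau>m[measurable]: "\<tau> n \<in> borel_measurable (P x)" for n
    using stopping_time_measurable[OF \<tau>(1)] by (simp add: measurable_P[OF x])
  have stopped: "(\<integral>\<^sup>+\<omega>. u (X (min t (\<tau> n \<omega>)) \<omega>) \<partial>P x) \<le> ennreal (u x * exp (C * t))" for n
  proof -
    \<comment> \<open>The maximum with \<open>0\<close> makes the processes measurable in a time parameter ranging over all reals.\<close>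
    let ?M = "\<lambda>s \<omega>. dynkin_process X x u v (max 0 (min s (\<tau> n \<omega>))) \<omega>"
    let ?U = "\<lambda>s \<omega>. u (X (max 0 (min s (\<tau> n \<omega>))) \<omega>)"
    have Mm: "(\<lambda>(s, \<omega>). ?M s \<omega>) \<in> borel_measurable (borel \<Otimes>\<^sub>M P x)"
    proof -
      have "(\<lambda>z. (min (fst z) (\<tau> n (snd z)), snd z)) \<in> borel \<Otimes>\<^sub>M P x \<rightarrow>\<^sub>M (borel :: real measure) \<Otimes>\<^sub>M P x"
        by measurable
      from measurable_compose[OF this dynkin_jointly_measurable[OF x u v]] show ?thesis
        by (simp add: split_beta')
    qed
    have Mmin: "?M s \<omega> = dynkin_process X x u v (min s (\<tau> n \<omega>)) \<omega>" if "0 \<le> s" "\<omega> \<in> space (P x)" for s \<omega>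
      using that \<tau>(2)[of \<omega> n] by (simp add: space_P[OF x] max_absorb2)
    have Mi: "integrable (P x) (?M s)" "(LINT \<omega>|P x. ?M s \<omega>) = 0" if "0 \<le> s" for s
      using stopped_dynkin[OF x u v \<tau>(2) mart that, of n] Mmin[OF that]
      by (simp_all cong: Bochner_Integration.integrable_cong Bochner_Integration.integral_cong)
    have Mb: "(LINT \<omega>|P x. \<bar>?M s \<omega>\<bar>) \<le> (LINT \<omega>|P x. \<bar>?M t \<omega>\<bar>)" if "0 \<le> s" "s \<le> t" for s
      using martingale_expectation(2)[OF finite_measure_P[OF x] subalgebra_P[OF x] mart that, of n] Mmin that t
      by (simp cong: Bochner_Integration.integral_cong)
    have gronwall: "(\<integral>\<^sup>+\<omega>. ?U t \<omega> \<partial>P x) \<le> ennreal (u x * exp (C * t))"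
    proof (rule expected_gronwall[OF sigma_finite_P[OF x] t C, where k="\<lambda>s \<omega>. u x + ?M s \<omega>" and B="u x + (LINT \<omega>|P x. \<bar>?M t \<omega>\<bar>)"])
      show "(\<lambda>(s, \<omega>). u x + ?M s \<omega>) \<in> borel_measurable (borel \<Otimes>\<^sub>M P x)"
        using Mm unfolding split_beta' by measurable
      fix \<omega> assume "\<omega> \<in> space (P x)"
      then have \<omega>: "\<omega> \<in> space \<Omega>" by (simp add: space_P[OF x])
      have \<tau>0: "0 \<le> \<tau> n \<omega>" by (rule \<tau>(2)[OF \<omega>])
      obtain B where B: "\<And>s. \<lbrakk>0 \<le> s; s \<le> t\<rbrakk> \<Longrightarrow> \<bar>u (X s \<omega>)\<bar> \<le> B" using path_bounded[OF \<omega> u, of t] by blast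
      have Ub: "\<bar>?U s \<omega>\<bar> \<le> B" if "0 \<le> s" "s \<le> t" for s
        using B[of "max 0 (min s (\<tau> n \<omega>))"] that t by (auto simp: max_def min_def)
      have Umeas: "(\<lambda>s. ?U s \<omega>) \<in> borel_measurable borel"
        by (rule measurable_compose[OF _ path_section_measurable[OF x \<omega> u]]) measurable
      show Ui: "set_integrable lborel {0..t} (\<lambda>s. ?U s \<omega>)"
        by (rule set_integrable_bounded[OF Umeas Ub])
      have Mmeas: "(\<lambda>s. ?M s \<omega>) \<in> borel_measurable borel"
        using measurable_compose[OF measurable_Pair2'[of \<omega> "P x" borel] Mm] \<omega> by (simp add: space_P[OF x])
      let ?A = "LBINT s:{0..t}. \<bar>v (X s \<omega>)\<bar>"
      have Meq: "u x + ?M s \<omega> = ?U s \<omega> - (LBINT r:{0..max 0 (min s (\<tau> n \<omega>))}. v (X r \<omega>))" for s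
        by (simp add: dynkin_process_def)
      have "\<bar>u x + ?M s \<omega>\<bar> \<le> B + ?A" if "0 \<le> s" "s \<le> t" for s
      proof -
        have "\<bar>LBINT r:{0..max 0 (min s (\<tau> n \<omega>))}. v (X r \<omega>)\<bar> \<le> ?A"
          by (rule set_integral_abs_le[OF path_integrable[OF x \<omega> v]]) (use that t in auto)
        then show ?thesis unfolding Meq using Ub[OF that] by linarith
      qed
      then show "set_integrable lborel {0..t} (\<lambda>s. u x + ?M s \<omega>)"
        by (intro set_integrable_bounded) (use Mmeas in measurable)
      show "0 \<le> ?U t \<omega>" by (intro u0 state_space \<omega>) simp
      fix s assume s: "0 \<le> s" "s \<le> t"
      let ?r = "max 0 (min s (\<tau> n \<omega>))"
      have r: "0 \<le> ?r" "?r \<le> s" using s by auto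
      have "(LBINT r:{0..?r}. v (X r \<omega>)) \<le> (LBINT r:{0..?r}. C * u (X r \<omega>))"
        using path_integrable[OF x \<omega>] u v
        by (intro set_integral_mono set_integrable_mult_right) (auto intro!: le state_space \<omega>)
      also have "\<dots> = C * (LBINT r:{0..?r}. u (X r \<omega>))" by simp
      also have "(LBINT r:{0..?r}. u (X r \<omega>)) \<le> (LBINT r:{0..s}. ?U r \<omega>)"
        unfolding set_lebesgue_integral_def
      proof (rule integral_mono)
        show "integrable lborel (\<lambda>s. indicator {0..?r} s *\<^sub>R u (X s \<omega>))"
          using path_integrable[OF x \<omega> u, of ?r] by (simp add: set_integrable_def)
        show "integrable lborel (\<lambda>r. indicator {0..s} r *\<^sub>R ?U r \<omega>)"
          using set_integrable_subset[OF Ui, of "{0..s}"] s by (simp add: set_integrable_def)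
        fix q
        have "0 \<le> ?U q \<omega>" by (intro u0 state_space \<omega>) simp
        moreover have "u (X q \<omega>) = ?U q \<omega>" if "0 \<le> q" "q \<le> ?r"
        proof -
          have "max 0 (min q (\<tau> n \<omega>)) = q" using that \<tau>0 s by (auto simp: max_def min_def split: if_splits)
          then show ?thesis by simp
        qed
        ultimately show "indicator {0..?r} q *\<^sub>R u (X q \<omega>) \<le> indicator {0..s} q *\<^sub>R ?U q \<omega>"
          using r by (auto simp: indicator_def)
      qed
      finally have "(LBINT r:{0..?r}. v (X r \<omega>)) \<le> C * (LBINT r:{0..s}. ?U r \<omega>)"
        using C by (simp add: mult_left_mono)
      then show "?U s \<omega> \<le> u x + ?M s \<omega> + C * (LBINT r:{0..s}. ?U r \<omega>)"
        unfolding Meq by simp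
    next
      fix s assume s: "0 \<le> s" "s \<le> t"
      show "integrable (P x) (\<lambda>\<omega>. u x + ?M s \<omega>)" using Mi[OF s(1)] by simp
      show "(LINT \<omega>|P x. u x + ?M s \<omega>) \<le> u x" using Mi[OF s(1)] by (simp add: prob_space)
      have "(LINT \<omega>|P x. \<bar>u x + ?M s \<omega>\<bar>) \<le> (LINT \<omega>|P x. u x + \<bar>?M s \<omega>\<bar>)"
        using Mi[OF s(1)] u0[OF x] by (intro integral_mono) auto
      also have "\<dots> = u x + (LINT \<omega>|P x. \<bar>?M s \<omega>\<bar>)" using Mi[OF s(1)] by (simp add: prob_space)
      also have "\<dots> \<le> u x + (LINT \<omega>|P x. \<bar>?M t \<omega>\<bar>)" using Mb[OF s] by simp
      finally show "(LINT \<omega>|P x. \<bar>u x + ?M s \<omega>\<bar>) \<le> u x + (LINT \<omega>|P x. \<bar>?M t \<omega>\<bar>)" .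
    qed
    have "(\<integral>\<^sup>+\<omega>. u (X (min t (\<tau> n \<omega>)) \<omega>) \<partial>P x) = (\<integral>\<^sup>+\<omega>. ?U t \<omega> \<partial>P x)"
      using \<tau>(2)[of _ n] t by (intro nn_integral_cong) (simp add: space_P[OF x] max_absorb2)
    then show ?thesis using gronwall by simp
  qed
  have "(\<integral>\<^sup>+\<omega>. u (X t \<omega>) \<partial>P x) \<le> liminf (\<lambda>n. \<integral>\<^sup>+\<omega>. ennreal (u (X (min t (\<tau> n \<omega>)) \<omega>)) \<partial>P x)"
    by (rule stopped_fatou[OF x t u \<tau>(1-3)])
  also have "\<dots> \<le> limsup (\<lambda>n. \<integral>\<^sup>+\<omega>. ennreal (u (X (min t (\<tau> n \<omega>)) \<omega>)) \<partial>P x)"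
    by (rule Liminf_le_Limsup) simp
  also have "\<dots> \<le> ennreal (u x * exp (C * t))"
    using stopped by (intro Limsup_bounded always_eventually) auto
  finally show ?thesis .
qed

section \<open>Time change by an independent clock\<close>

text \<open>The value \<open>X\<close> at time \<open>L\<close> is a measurable function of two independent objects, the whole path of \<open>X\<close>
  and the real number \<open>L\<close>, so Fubini's theorem applies. The identity map into the sample space, with the
  \<open>\<sigma>\<close>-algebra generated by \<open>X\<close>, serves as the path.\<close>

lemma independent_time_change:
  fixes q :: "real ^ 'd \<Rightarrow> real" and t :: real
  assumes x: "x \<in> S" and ind: "independent_processes (P x) X \<sigma>"
    and \<sigma>: "\<forall>\<omega>\<in>space (P x). mono_on {0..} (\<lambda>t. \<sigma> t \<omega>)"
    and q: "continuous_on UNIV q"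
  defines "L \<equiv> inverse_process \<sigma> t"
  shows "integrable (P x) (\<lambda>\<omega>. q (X (L \<omega>) \<omega>)) \<Longrightarrow>
      (LINT \<omega>|P x. q (X (L \<omega>) \<omega>)) = (LINT \<omega>|P x. (LINT \<omega>'|P x. q (X (L \<omega>) \<omega>')))"
    and "(\<integral>\<^sup>+\<omega>. ennreal \<bar>q (X (L \<omega>) \<omega>)\<bar> \<partial>P x) = (\<integral>\<^sup>+\<omega>. (\<integral>\<^sup>+\<omega>'. ennreal \<bar>q (X (L \<omega>) \<omega>')\<bar> \<partial>P x) \<partial>P x)"
    and "L \<in> borel_measurable (P x)" "(\<lambda>\<omega>. q (X (L \<omega>) \<omega>)) \<in> borel_measurable (P x)"
proof -
  interpret prob_space "P x" by (rule prob_space_P[OF x])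
  let ?Q = "P x"
  define N where "N = vimage_algebra (space ?Q) (\<lambda>\<omega>. \<lambda>t\<in>{0..}. X t \<omega>) (PiM {0..} (\<lambda>_. borel :: (real ^ 'd) measure))"
  define N' where "N' = vimage_algebra (space ?Q) (\<lambda>\<omega>. \<lambda>t\<in>{0..}. \<sigma> t \<omega>) (PiM {0..} (\<lambda>_. borel :: real measure))"
  have indNN': "indep_set (sets N) (sets N')"
    using ind by (simp add: independent_processes_def N_def N'_def)
  then have NN': "sets N \<subseteq> events" "sets N' \<subseteq> events"
    "\<And>a b. \<lbrakk>a \<in> sets N; b \<in> sets N'\<rbrakk> \<Longrightarrow> prob (a \<inter> b) = prob a * prob b"
    unfolding indep_sets2_eq by auto
  have spN: "space N = space ?Q" "space N' = space ?Q" by (simp_all add: N_def N'_def)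
  have XN: "X s \<in> borel_measurable N" if "0 \<le> s" for s
  proof -
    have "(\<lambda>\<omega>. \<lambda>t\<in>{0..}. X t \<omega>) \<in> N \<rightarrow>\<^sub>M PiM {0..} (\<lambda>_. borel :: (real ^ 'd) measure)"
      unfolding N_def by (rule measurable_vimage_algebra1) (auto simp: space_PiM)
    from measurable_compose[OF this measurable_component_singleton[of s "{0..}"]] that
    show ?thesis by simp
  qed
  have \<sigma>N': "\<sigma> s \<in> borel_measurable N'" if "0 \<le> s" for s
  proof -
    have "(\<lambda>\<omega>. \<lambda>t\<in>{0..}. \<sigma> t \<omega>) \<in> N' \<rightarrow>\<^sub>M PiM {0..} (\<lambda>_. borel :: real measure)"
      unfolding N'_def by (rule measurable_vimage_algebra1) (auto simp: space_PiM)
    from measurable_compose[OF this measurable_component_singleton[of s "{0..}"]] that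
    show ?thesis by simp
  qed
  have LN': "L \<in> borel_measurable N'"
    unfolding L_def by (rule inverse_process_measurable[OF \<sigma>N']) (use \<sigma> in \<open>auto simp: spN\<close>)
  have idN: "(\<lambda>\<omega>. \<omega>) \<in> ?Q \<rightarrow>\<^sub>M N" using NN'(1) spN by (auto simp: measurable_def)
  have idN': "(\<lambda>\<omega>. \<omega>) \<in> ?Q \<rightarrow>\<^sub>M N'" using NN'(2) spN by (auto simp: measurable_def)
  show L: "L \<in> borel_measurable ?Q" using measurable_compose[OF idN' LN'] .
  have L0: "0 \<le> L \<omega>" for \<omega> by (simp add: L_def inverse_process_nonneg)
  have pairm: "(\<lambda>\<omega>. (\<omega>, L \<omega>)) \<in> ?Q \<rightarrow>\<^sub>M N \<Otimes>\<^sub>M borel" using idN L by (intro measurable_Pair)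
  interpret D1: prob_space "distr ?Q N (\<lambda>\<omega>. \<omega>)" by (rule prob_space_distr[OF idN])
  interpret D2: prob_space "distr ?Q borel L" by (rule prob_space_distr[OF L])
  interpret pair_sigma_finite "distr ?Q N (\<lambda>\<omega>. \<omega>)" "distr ?Q borel L" ..
  \<comment> \<open>On the \<open>\<sigma>\<close>-algebra \<open>N\<close> of the process, the pair of the sample point and the clock has a product law.\<close>
  have joint: "distr ?Q (N \<Otimes>\<^sub>M borel) (\<lambda>\<omega>. (\<omega>, L \<omega>)) = distr ?Q N (\<lambda>\<omega>. \<omega>) \<Otimes>\<^sub>M distr ?Q borel L"
  proof (rule pair_measure_eqI[symmetric])
    show "sets (distr ?Q N (\<lambda>\<omega>. \<omega>) \<Otimes>\<^sub>M distr ?Q borel L) = sets (distr ?Q (N \<Otimes>\<^sub>M borel) (\<lambda>\<omega>. (\<omega>, L \<omega>)))"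
      unfolding sets_distr by (intro sets_pair_measure_cong sets_distr)
    fix A B assume "A \<in> sets (distr ?Q N (\<lambda>\<omega>. \<omega>))" "B \<in> sets (distr ?Q borel L)"
    then have A: "A \<in> sets N" and B: "B \<in> sets borel" by auto
    have pre: "A \<inter> space ?Q = A" using sets.sets_into_space[OF A] spN by auto
    have LB: "L -` B \<inter> space ?Q \<in> sets N'" using measurable_sets[OF LN' B] spN by simp
    have "emeasure (distr ?Q N (\<lambda>\<omega>. \<omega>)) A * emeasure (distr ?Q borel L) B = ennreal (prob A * prob (L -` B \<inter> space ?Q))"
      using A B by (simp add: emeasure_distr[OF idN] emeasure_distr[OF L] pre emeasure_eq_measure ennreal_mult'')
    also have "prob A * prob (L -` B \<inter> space ?Q) = prob (A \<inter> (L -` B \<inter> space ?Q))"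
      using NN'(3)[OF A LB] by simp
    also have "A \<inter> (L -` B \<inter> space ?Q) = (\<lambda>\<omega>. (\<omega>, L \<omega>)) -` (A \<times> B) \<inter> space ?Q" by auto
    also have "ennreal (prob \<dots>) = emeasure (distr ?Q (N \<Otimes>\<^sub>M borel) (\<lambda>\<omega>. (\<omega>, L \<omega>))) (A \<times> B)"
      using A B by (subst emeasure_distr[OF pairm]) (auto simp: emeasure_eq_measure)
    finally show "emeasure (distr ?Q N (\<lambda>\<omega>. \<omega>)) A * emeasure (distr ?Q borel L) B =
      emeasure (distr ?Q (N \<Otimes>\<^sub>M borel) (\<lambda>\<omega>. (\<omega>, L \<omega>))) (A \<times> B)" .
  qed (unfold_locales)
  let ?J = "\<lambda>z. q (X (max 0 (snd z)) (fst z))"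
  have J: "?J \<in> borel_measurable (N \<Otimes>\<^sub>M borel)"
  proof -
    have "(\<lambda>(s, \<omega>). X (max 0 s) \<omega>) \<in> borel_measurable (borel \<Otimes>\<^sub>M N)"
      using cadlag_paths by (intro right_continuous_jointly_measurable XN) (auto simp: spN space_P[OF x] cadlag_def)
    from measurable_compose[OF measurable_Pair[OF measurable_snd measurable_fst] this]
    have "(\<lambda>z. X (max 0 (snd z)) (fst z)) \<in> borel_measurable (N \<Otimes>\<^sub>M borel)" by simp
    from measurable_compose[OF this borel_measurable_continuous_onI[OF q]] show ?thesis .
  qed
  have Jsec: "(\<lambda>\<omega>. q (X (max 0 s) \<omega>)) \<in> borel_measurable N" for s
    using measurable_compose[OF XN[of "max 0 s"] borel_measurable_continuous_onI[OF q]] by simp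
  show "(\<lambda>\<omega>. q (X (L \<omega>) \<omega>)) \<in> borel_measurable ?Q"
    using measurable_compose[OF pairm J] L0 by (simp add: max_absorb2)
  have JL: "(\<lambda>\<omega>'. q (X (L \<omega>) \<omega>')) \<in> borel_measurable N" for \<omega>
    using Jsec[of "L \<omega>"] L0[of \<omega>] by (simp add: max_absorb2)
  have sets_prod: "sets (distr ?Q N (\<lambda>\<omega>. \<omega>) \<Otimes>\<^sub>M distr ?Q borel L) = sets (N \<Otimes>\<^sub>M borel)"
    by (intro sets_pair_measure_cong) auto
  show "(\<integral>\<^sup>+\<omega>. ennreal \<bar>q (X (L \<omega>) \<omega>)\<bar> \<partial>?Q) = (\<integral>\<^sup>+\<omega>. (\<integral>\<^sup>+\<omega>'. ennreal \<bar>q (X (L \<omega>) \<omega>')\<bar> \<partial>?Q) \<partial>?Q)"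
  proof -
    have Jn: "(\<lambda>z. ennreal \<bar>?J z\<bar>) \<in> borel_measurable (N \<Otimes>\<^sub>M borel)" using J by measurable
    then have Jn': "(\<lambda>(\<omega>, s). ennreal \<bar>q (X (max 0 s) \<omega>)\<bar>) \<in> borel_measurable (distr ?Q N (\<lambda>\<omega>. \<omega>) \<Otimes>\<^sub>M distr ?Q borel L)"
      by (simp add: split_beta' measurable_cong_sets[OF sets_prod refl])
    have inner: "(\<lambda>s. \<integral>\<^sup>+\<omega>'. ennreal \<bar>q (X (max 0 s) \<omega>')\<bar> \<partial>distr ?Q N (\<lambda>\<omega>. \<omega>)) \<in> borel_measurable borel"
    proof (rule D1.borel_measurable_nn_integral)
      have "(\<lambda>(s, \<omega>). ennreal \<bar>q (X (max 0 s) \<omega>)\<bar>) \<in> borel_measurable (borel \<Otimes>\<^sub>M N)"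
        using measurable_compose[OF measurable_Pair[OF measurable_snd measurable_fst] Jn]
        by (simp add: split_beta')
      then show "(\<lambda>(s, \<omega>). ennreal \<bar>q (X (max 0 s) \<omega>)\<bar>) \<in> borel_measurable (borel \<Otimes>\<^sub>M distr ?Q N (\<lambda>\<omega>. \<omega>))"
        by (simp add: measurable_cong_sets[OF sets_pair_measure_cong[OF refl sets_distr] refl])
    qed
    have "(\<integral>\<^sup>+\<omega>. ennreal \<bar>q (X (L \<omega>) \<omega>)\<bar> \<partial>?Q) = (\<integral>\<^sup>+z. ennreal \<bar>?J z\<bar> \<partial>distr ?Q (N \<Otimes>\<^sub>M borel) (\<lambda>\<omega>. (\<omega>, L \<omega>)))"
      using L0 Jn by (subst nn_integral_distr[OF pairm]) (simp_all add: max_absorb2)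
    also have "\<dots> = (\<integral>\<^sup>+s. (\<integral>\<^sup>+\<omega>'. ennreal \<bar>q (X (max 0 s) \<omega>')\<bar> \<partial>distr ?Q N (\<lambda>\<omega>. \<omega>)) \<partial>distr ?Q borel L)"
      unfolding joint using nn_integral_snd[OF Jn'] by (simp add: split_beta')
    also have "\<dots> = (\<integral>\<^sup>+\<omega>. (\<integral>\<^sup>+\<omega>'. ennreal \<bar>q (X (max 0 (L \<omega>)) \<omega>')\<bar> \<partial>distr ?Q N (\<lambda>\<omega>. \<omega>)) \<partial>?Q)"
      using inner by (subst nn_integral_distr[OF L]) simp_all
    also have "\<dots> = (\<integral>\<^sup>+\<omega>. (\<integral>\<^sup>+\<omega>'. ennreal \<bar>q (X (L \<omega>) \<omega>')\<bar> \<partial>?Q) \<partial>?Q)"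
      using L0 JL by (subst nn_integral_distr[OF idN]) (auto simp: max_absorb2)
    finally show ?thesis .
  qed
  assume int: "integrable ?Q (\<lambda>\<omega>. q (X (L \<omega>) \<omega>))"
  then have "integrable (distr ?Q (N \<Otimes>\<^sub>M borel) (\<lambda>\<omega>. (\<omega>, L \<omega>))) ?J"
    using L0 by (subst integrable_distr_eq[OF pairm J]) (simp add: max_absorb2)
  then have Ji: "integrable (distr ?Q N (\<lambda>\<omega>. \<omega>) \<Otimes>\<^sub>M distr ?Q borel L) (\<lambda>(\<omega>, s). q (X (max 0 s) \<omega>))"
    unfolding joint by (simp add: split_beta')
  have inner: "(\<lambda>s. LINT \<omega>'|distr ?Q N (\<lambda>\<omega>. \<omega>). q (X (max 0 s) \<omega>')) \<in> borel_measurable borel"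
    using borel_measurable_integrable[OF integrable_snd[OF Ji]] by simp
  have "(LINT \<omega>|?Q. q (X (L \<omega>) \<omega>)) = (LINT z|distr ?Q (N \<Otimes>\<^sub>M borel) (\<lambda>\<omega>. (\<omega>, L \<omega>)). ?J z)"
    using L0 by (subst integral_distr[OF pairm J]) (simp add: max_absorb2)
  also have "\<dots> = (LINT s|distr ?Q borel L. (LINT \<omega>'|distr ?Q N (\<lambda>\<omega>. \<omega>). q (X (max 0 s) \<omega>')))"
    unfolding joint using integral_snd[OF Ji] by (simp add: split_beta')
  also have "\<dots> = (LINT \<omega>|?Q. (LINT \<omega>'|distr ?Q N (\<lambda>\<omega>. \<omega>). q (X (max 0 (L \<omega>)) \<omega>')))"
    by (rule integral_distr[OF L inner])
  also have "\<dots> = (LINT \<omega>|?Q. (LINT \<omega>'|?Q. q (X (L \<omega>) \<omega>')))"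
    using L0 JL by (subst integral_distr[OF idN]) (auto simp: max_absorb2)
  finally show "(LINT \<omega>|?Q. q (X (L \<omega>) \<omega>)) = (LINT \<omega>|?Q. (LINT \<omega>'|?Q. q (X (L \<omega>) \<omega>')))" .
qed

end

section \<open>Polynomials on Euclidean space\<close>

abbreviation monomial_fun :: "('d::finite \<Rightarrow> nat) \<Rightarrow> real ^ 'd \<Rightarrow> real" where
  "monomial_fun e x \<equiv> (\<Prod>i\<in>UNIV. x $ i ^ e i)"

lemma finite_multi_indices: "finite {e :: 'd::finite \<Rightarrow> nat. (\<Sum>i\<in>UNIV. e i) \<le> k}"
proof (rule finite_subset)
  show "{e :: 'd \<Rightarrow> nat. (\<Sum>i\<in>UNIV. e i) \<le> k} \<subseteq> PiE UNIV (\<lambda>_. {..k})"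
  proof (rule subsetI, rule PiE_I)
    fix e :: "'d \<Rightarrow> nat" and i assume "e \<in> {e. (\<Sum>i\<in>UNIV. e i) \<le> k}"
    moreover have "e i \<le> (\<Sum>i\<in>UNIV. e i)" by (rule member_le_sum) auto
    ultimately show "e i \<in> {..k}" by simp
  qed auto
qed (intro finite_PiE, auto)

lemma poly_space_on_subset: "u \<in> poly_space UNIV k \<Longrightarrow> u \<in> poly_space S k"
  unfolding poly_space_def by blast

lemma poly_space_representative:
  assumes "u \<in> poly_space S k"
  obtains v where "v \<in> poly_space UNIV k" "\<And>x. x \<in> S \<Longrightarrow> u x = v x"
proof -
  obtain c where c: "\<forall>x\<in>S. u x = (\<Sum>e | (\<Sum>i\<in>UNIV. e i) \<le> k. c e * monomial_fun e x)"
    using assms by (auto simp: poly_space_def)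
  then show ?thesis
    by (intro that[of "\<lambda>x. \<Sum>e | (\<Sum>i\<in>UNIV. e i) \<le> k. c e * monomial_fun e x"]) (auto simp: poly_space_def)
qed

lemma poly_space_cong: "\<lbrakk>u \<in> poly_space S k; \<And>x. x \<in> S \<Longrightarrow> u x = v x\<rbrakk> \<Longrightarrow> v \<in> poly_space S k"
  by (simp add: poly_space_def)

lemma continuous_on_poly_space:
  assumes "u \<in> poly_space UNIV k" shows "continuous_on UNIV u"
proof -
  obtain c where c: "u = (\<lambda>x. \<Sum>e | (\<Sum>i\<in>UNIV. e i) \<le> k. c e * monomial_fun e x)"
    using assms by (auto simp: poly_space_def fun_eq_iff)
  show ?thesis unfolding c by (intro continuous_intros)
qed

lemma poly_space_monomial:
  assumes "(\<Sum>i\<in>UNIV. e i) \<le> k"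
  shows "(\<lambda>x. monomial_fun e x) \<in> poly_space S k"
  unfolding poly_space_def
proof (rule CollectI, intro exI ballI)
  fix x
  show "monomial_fun e x = (\<Sum>e' | (\<Sum>i\<in>UNIV. e' i) \<le> k. (if e' = e then 1 else 0) * monomial_fun e' x)"
    using assms by (simp add: if_distrib[of "\<lambda>a. a * _"] sum.delta[OF finite_multi_indices] cong: if_cong)
qed

lemma poly_space_scale: 
  assumes "u \<in> poly_space S k" shows "(\<lambda>x. a * u x) \<in> poly_space S k"
proof -
  obtain c where "\<forall>x\<in>S. u x = (\<Sum>e | (\<Sum>i\<in>UNIV. e i) \<le> k. c e * monomial_fun e x)"
    using assms by (auto simp: poly_space_def)
  then show ?thesis unfolding poly_space_def
    by (intro CollectI exI[of _ "\<lambda>e. a * c e"]) (simp add: sum_distrib_left mult.assoc)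
qed

lemma poly_space_add:
  assumes "u \<in> poly_space S k" "v \<in> poly_space S k" shows "(\<lambda>x. u x + v x) \<in> poly_space S k"
proof -
  obtain c where "\<forall>x\<in>S. u x = (\<Sum>e | (\<Sum>i\<in>UNIV. e i) \<le> k. c e * monomial_fun e x)"
    using assms by (auto simp: poly_space_def)
  moreover obtain d where "\<forall>x\<in>S. v x = (\<Sum>e | (\<Sum>i\<in>UNIV. e i) \<le> k. d e * monomial_fun e x)"
    using assms by (auto simp: poly_space_def)
  ultimately show ?thesis unfolding poly_space_def
    by (intro CollectI exI[of _ "\<lambda>e. c e + d e"]) (simp add: sum.distrib distrib_right)
qed

lemma poly_space_mono:
  assumes "u \<in> poly_space S j" "j \<le> k" shows "u \<in> poly_space S k"
proof -
  obtain c where c: "\<forall>x\<in>S. u x = (\<Sum>e | (\<Sum>i\<in>UNIV. e i) \<le> j. c e * monomial_fun e x)"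
    using assms by (auto simp: poly_space_def)
  have "(\<Sum>e | (\<Sum>i\<in>UNIV. e i) \<le> k. (if (\<Sum>i\<in>UNIV. e i) \<le> j then c e else 0) * monomial_fun e x)
      = (\<Sum>e | (\<Sum>i\<in>UNIV. e i) \<le> j. c e * monomial_fun e x)" for x
    using assms(2) by (intro sum.mono_neutral_cong_right finite_multi_indices) auto
  with c show ?thesis unfolding poly_space_def
    by (intro CollectI exI[of _ "\<lambda>e. if (\<Sum>i\<in>UNIV. e i) \<le> j then c e else 0"]) simp
qed

lemma poly_space_const: "(\<lambda>x. a) \<in> poly_space S k"
  using poly_space_scale[OF poly_space_monomial[of "\<lambda>_. 0" k S], of a] by simp

lemma poly_space_coordinate_power:
  assumes "j \<le> k" shows "(\<lambda>x. x $ i ^ j) \<in> poly_space S k"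
proof -
  have "monomial_fun (\<lambda>i'. if i' = i then j else 0) x = x $ i ^ j" for x
  proof -
    have "monomial_fun (\<lambda>i'. if i' = i then j else 0) x = (\<Prod>i'\<in>UNIV. if i' = i then x $ i ^ j else 1)"
      by (intro prod.cong) auto
    then show ?thesis by simp
  qed
  then show ?thesis
    using poly_space_monomial[of "\<lambda>i'. if i' = i then j else 0" k S] assms by simp
qed

lemma poly_space_coordinate: "1 \<le> k \<Longrightarrow> (\<lambda>x. x $ i) \<in> poly_space S k"
  using poly_space_coordinate_power[of 1 k i S] by simp

lemma poly_space_sum:
  "(\<And>i. i \<in> I \<Longrightarrow> u i \<in> poly_space S k) \<Longrightarrow> (\<lambda>x. \<Sum>i\<in>I. u i x) \<in> poly_space S k"
  by (induction I rule: infinite_finite_induct) (auto intro: poly_space_const poly_space_add)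

lemma poly_space_1_affine:
  fixes u :: "real ^ 'd \<Rightarrow> real"
  assumes "u \<in> poly_space S 1"
  obtains b c where "\<And>x. x \<in> S \<Longrightarrow> u x = b + (\<Sum>i\<in>UNIV. c i * x $ i)"
proof -
  obtain c where c: "\<forall>x\<in>S. u x = (\<Sum>e | (\<Sum>i\<in>UNIV. e i) \<le> 1. c e * monomial_fun e x)"
    using assms by (auto simp: poly_space_def)
  let ?\<delta> = "\<lambda>(i :: 'd) j. if j = i then 1 else 0 :: nat"
  have set: "{e :: 'd \<Rightarrow> nat. (\<Sum>i\<in>UNIV. e i) \<le> 1} = insert (\<lambda>_. 0) (range ?\<delta>)"
  proof (intro equalityI subsetI)
    fix e :: "'d \<Rightarrow> nat" assume "e \<in> {e. (\<Sum>i\<in>UNIV. e i) \<le> 1}"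
    then have le: "(\<Sum>i\<in>UNIV. e i) \<le> 1" by simp
    show "e \<in> insert (\<lambda>_. 0) (range ?\<delta>)"
    proof (cases "\<exists>i. e i \<noteq> 0")
      case True
      then obtain i where i: "e i \<noteq> 0" by blast
      have "(\<Sum>j\<in>UNIV. e j) = e i + (\<Sum>j\<in>UNIV - {i}. e j)" by (rule sum.remove) auto
      moreover have "1 \<le> e i" using i by simp
      ultimately have "e i = 1" "(\<Sum>j\<in>UNIV - {i}. e j) = 0" using le by linarith+
      then have "e i = 1" "\<And>j. j \<noteq> i \<Longrightarrow> e j = 0" by (simp_all add: sum_eq_0_iff)
      then have "e = ?\<delta> i" by (auto simp: fun_eq_iff)
      then show ?thesis by blast
    next
      case False then have "e = (\<lambda>_. 0)" by auto
      then show ?thesis by blast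
    qed
  qed auto
  have inj: "inj ?\<delta>"
  proof (rule injI)
    fix i j :: 'd assume "?\<delta> i = ?\<delta> j"
    from fun_cong[OF this, of i] show "i = j" by (simp split: if_splits)
  qed
  have notin: "(\<lambda>_. 0) \<notin> range ?\<delta>"
  proof
    assume "(\<lambda>_. 0) \<in> range ?\<delta>"
    then obtain i where "(\<lambda>_. 0) = ?\<delta> i" by blast
    from fun_cong[OF this, of i] show False by simp
  qed
  have mon: "monomial_fun (?\<delta> i) x = x $ i" for i and x :: "real ^ 'd"
  proof -
    have "monomial_fun (?\<delta> i) x = (\<Prod>j\<in>UNIV. if j = i then x $ i else 1)" by (intro prod.cong) auto
    then show ?thesis by simp
  qed
  have "u x = c (\<lambda>_. 0) + (\<Sum>i\<in>UNIV. c (?\<delta> i) * x $ i)" if "x \<in> S" for x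
  proof -
    have "u x = (\<Sum>e\<in>insert (\<lambda>_. 0) (range ?\<delta>). c e * monomial_fun e x)"
      unfolding set[symmetric] using c that by blast
    also have "\<dots> = c (\<lambda>_. 0) * monomial_fun (\<lambda>_. 0) x + (\<Sum>e\<in>range ?\<delta>. c e * monomial_fun e x)"
      using notin by (intro sum.insert) auto
    also have "(\<Sum>e\<in>range ?\<delta>. c e * monomial_fun e x) = (\<Sum>i\<in>UNIV. c (?\<delta> i) * monomial_fun (?\<delta> i) x)"
      by (simp add: sum.reindex[OF inj])
    finally show ?thesis unfolding mon by simp
  qed
  then show ?thesis by (rule that)
qed

text \<open>The powers of the weight measure growth at infinity: a polynomial of degree \<open>k\<close> is bounded by a
  multiple of the \<open>k\<close>-th power, in odd degrees as well. For even \<open>k\<close> the polynomial \<open>even_weight k\<close> is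
  comparable to it.\<close>

definition weight :: "real ^ 'd \<Rightarrow> real" where
  "weight x = 1 + (\<Sum>i\<in>UNIV. \<bar>x $ i\<bar>)"

definition even_weight :: "nat \<Rightarrow> real ^ 'd \<Rightarrow> real" where
  "even_weight k x = 1 + (\<Sum>i\<in>UNIV. x $ i ^ k)"

lemma weight_ge_1: "1 \<le> weight x"
  by (simp add: weight_def sum_nonneg)

lemma coordinate_le_weight: "\<bar>x $ i\<bar> \<le> weight x"
  using member_le_sum[of i UNIV "\<lambda>i. \<bar>x $ i\<bar>"] by (simp add: weight_def)

lemma continuous_weight: "continuous_on UNIV weight"
  unfolding weight_def by (intro continuous_intros)

lemma poly_space_weight_bound:
  assumes "u \<in> poly_space S k"
  obtains C where "0 \<le> C" "\<And>x. x \<in> S \<Longrightarrow> \<bar>u x\<bar> \<le> C * weight x ^ k"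
proof -
  obtain c where c: "\<forall>x\<in>S. u x = (\<Sum>e | (\<Sum>i\<in>UNIV. e i) \<le> k. c e * monomial_fun e x)"
    using assms by (auto simp: poly_space_def)
  have mon: "\<bar>monomial_fun e x\<bar> \<le> weight x ^ k" if "(\<Sum>i\<in>UNIV. e i) \<le> k" for e and x :: "real ^ 'a"
  proof -
    have "\<bar>monomial_fun e x\<bar> = (\<Prod>i\<in>UNIV. \<bar>x $ i\<bar> ^ e i)" by (simp add: abs_prod power_abs)
    also have "\<dots> \<le> (\<Prod>i\<in>UNIV. weight x ^ e i)"
      by (intro prod_mono conjI power_mono coordinate_le_weight) auto
    also have "\<dots> = weight x ^ (\<Sum>i\<in>UNIV. e i)" by (simp add: power_sum)
    also have "\<dots> \<le> weight x ^ k" using that weight_ge_1 by (intro power_increasing)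
    finally show ?thesis .
  qed
  show ?thesis
  proof (rule that[of "\<Sum>e | (\<Sum>i\<in>UNIV. e i) \<le> k. \<bar>c e\<bar>"])
    fix x assume x: "x \<in> S"
    have "\<bar>u x\<bar> \<le> (\<Sum>e | (\<Sum>i\<in>UNIV. e i) \<le> k. \<bar>c e * monomial_fun e x\<bar>)"
      using c x by (simp add: sum_abs)
    also have "\<dots> \<le> (\<Sum>e | (\<Sum>i\<in>UNIV. e i) \<le> k. \<bar>c e\<bar> * weight x ^ k)"
      by (intro sum_mono) (simp add: abs_mult mult_left_mono mon)
    finally show "\<bar>u x\<bar> \<le> (\<Sum>e | (\<Sum>i\<in>UNIV. e i) \<le> k. \<bar>c e\<bar>) * weight x ^ k"
      by (simp add: sum_distrib_right)
  qed (simp add: sum_nonneg)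
qed

lemma weight_power_le:
  fixes x :: "real ^ 'd"
  shows "weight x ^ k \<le> (real CARD('d) + 1) ^ k * (1 + (\<Sum>i\<in>UNIV. \<bar>x $ i\<bar> ^ k))"
proof -
  let ?M = "Max (insert 1 (range (\<lambda>i. \<bar>x $ i\<bar>)))"
  have M: "\<bar>x $ i\<bar> \<le> ?M" for i by (rule Max_ge) auto
  have "weight x \<le> 1 + real CARD('d) * ?M"
    unfolding weight_def using sum_bounded_above[of UNIV "\<lambda>i. \<bar>x $ i\<bar>" ?M, OF M] by simp
  also have "\<dots> \<le> (real CARD('d) + 1) * ?M"
    using Max_ge[of "insert 1 (range (\<lambda>i. \<bar>x $ i\<bar>))" 1] by (simp add: distrib_right)
  finally have "weight x ^ k \<le> ((real CARD('d) + 1) * ?M) ^ k"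
    using weight_ge_1[of x] by (intro power_mono) auto
  also have "\<dots> = (real CARD('d) + 1) ^ k * ?M ^ k" by (rule power_mult_distrib)
  also have "?M ^ k \<le> 1 + (\<Sum>i\<in>UNIV. \<bar>x $ i\<bar> ^ k)"
  proof -
    have "?M \<in> insert 1 (range (\<lambda>i. \<bar>x $ i\<bar>))" by (rule Max_in) auto
    then consider "?M = 1" | i where "?M = \<bar>x $ i\<bar>" by auto
    then show ?thesis
    proof cases
      case 1 then show ?thesis by (simp add: sum_nonneg)
    next
      case (2 i)
      then show ?thesis using member_le_sum[of i UNIV "\<lambda>i. \<bar>x $ i\<bar> ^ k"] by simp
    qed
  qed
  finally show ?thesis by (simp add: mult_left_mono)
qed

lemma weight_power_le_even_weight:
  fixes x :: "real ^ 'd"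
  shows "even k \<Longrightarrow> weight x ^ k \<le> (real CARD('d) + 1) ^ k * even_weight k x"
  using weight_power_le[of x k] by (simp add: even_weight_def power_even_abs)

lemma even_weight_ge_1: "even k \<Longrightarrow> 1 \<le> even_weight k x"
  by (simp add: even_weight_def sum_nonneg zero_le_even_power)

lemma poly_space_even_weight: "j \<le> k \<Longrightarrow> even_weight j \<in> poly_space S k"
  unfolding even_weight_def[abs_def]
  by (intro poly_space_add poly_space_const poly_space_sum poly_space_coordinate_power)

lemma linear_le_quadratic:
  fixes e :: real
  assumes "0 < e"
  shows "K * a \<le> e * a\<^sup>2 + K\<^sup>2 / (4 * e)"
proof -
  have "0 \<le> (2 * e * a - K)\<^sup>2 / (4 * e)" using assms by simp
  also have "\<dots> = e * a\<^sup>2 - K * a + K\<^sup>2 / (4 * e)"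
    using assms by (simp add: power2_eq_square field_simps)
  finally show ?thesis by linarith
qed

section \<open>Moments of a polynomial process\<close>

text \<open>The operator \<open>gen\<close> represents the extended generator by polynomials on the whole space instead of
  functions on \<open>S\<close>. In degree \<open>0\<close> invariance is available only when \<open>m = 0\<close>, because the definition of an
  \<open>m\<close>-polynomial process starts at degree one.\<close>

locale polynomial_process = cadlag_markov_process S \<Omega> F P X
  for S :: "(real ^ 'd) set" and \<Omega> :: "'w measure" and F P X +
  fixes m :: nat and gen :: "(real ^ 'd \<Rightarrow> real) \<Rightarrow> real ^ 'd \<Rightarrow> real"
  assumes gen_poly: "\<lbrakk>u \<in> poly_space UNIV k; k \<le> m; 1 \<le> k \<or> m = 0\<rbrakk> \<Longrightarrow> gen u \<in> poly_space UNIV k"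
    and gen_dynkin: "u \<in> poly_space UNIV m \<Longrightarrow> dynkin_pair u (gen u)"
    and gen_linear: "\<lbrakk>u \<in> poly_space UNIV m; v \<in> poly_space UNIV m; y \<in> S\<rbrakk> \<Longrightarrow>
      gen (\<lambda>y. a * u y + b * v y) y = a * gen u y + b * gen v y"
    and poly_integrable: "\<lbrakk>u \<in> poly_space UNIV m; x \<in> S; 0 \<le> t\<rbrakk> \<Longrightarrow> integrable (P x) (\<lambda>\<omega>. u (X t \<omega>))"
    and true_martingale: "\<lbrakk>m = 1; u \<in> poly_space UNIV 1; x \<in> S\<rbrakk> \<Longrightarrow> martingale (P x) F (dynkin_process X x u (gen u))"
begin

text \<open>The polynomial \<open>even_weight k\<close> is nonnegative and dominates its image under the generator, which has
  the same degree.\<close>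

lemma even_weight_growth:
  assumes k: "even k" "k \<le> m" "1 \<le> k \<or> m = 0"
  obtains C where "0 \<le> C"
    "\<And>x t. \<lbrakk>x \<in> S; 0 \<le> t\<rbrakk> \<Longrightarrow> (\<integral>\<^sup>+\<omega>. even_weight k (X t \<omega>) \<partial>P x) \<le> ennreal (even_weight k x * exp (C * t))"
proof -
  have f: "even_weight k \<in> poly_space UNIV k" by (rule poly_space_even_weight) simp
  obtain C where C: "0 \<le> C" "\<And>y. \<bar>gen (even_weight k) y\<bar> \<le> C * weight y ^ k"
    using poly_space_weight_bound[OF gen_poly[OF f k(2,3)]] by auto
  let ?C = "C * (real CARD('d) + 1) ^ k"
  have le: "gen (even_weight k) y \<le> ?C * even_weight k y" for y
  proof -
    have "gen (even_weight k) y \<le> C * weight y ^ k" using C(2)[of y] by linarith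
    also have "\<dots> \<le> C * ((real CARD('d) + 1) ^ k * even_weight k y)"
      using C(1) weight_power_le_even_weight[OF k(1), of y] by (intro mult_left_mono) auto
    finally show ?thesis by (simp add: mult.assoc)
  qed
  show ?thesis
  proof (rule that[of ?C])
    show "0 \<le> ?C" using C(1) by simp
    fix x t assume "x \<in> S" "(0 :: real) \<le> t"
    moreover have "0 \<le> even_weight k y" for y :: "real ^ 'd"
      using even_weight_ge_1[OF k(1), of y] by linarith
    ultimately show "(\<integral>\<^sup>+\<omega>. even_weight k (X t \<omega>) \<partial>P x) \<le> ennreal (even_weight k x * exp (?C * t))"
      using le C(1) by (intro dynkin_exponential_bound[OF _ gen_dynkin[OF poly_space_mono[OF f k(2)]]]) auto
  qed
qed

lemma poly_moment_bound_of_weight: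
  assumes w: "(\<integral>\<^sup>+\<omega>. weight (X s \<omega>) ^ k \<partial>P x) \<le> ennreal B"
    and x: "x \<in> S" and s: "0 \<le> s"
    and C: "0 \<le> C" "\<And>y. y \<in> S \<Longrightarrow> \<bar>u y\<bar> \<le> C * weight y ^ k"
  shows "(\<integral>\<^sup>+\<omega>. \<bar>u (X s \<omega>)\<bar> \<partial>P x) \<le> ennreal (C * B)"
proof -
  have [measurable]: "(\<lambda>\<omega>. weight (X s \<omega>)) \<in> borel_measurable (P x)"
    by (rule continuous_X_measurable[OF x s continuous_weight])
  have "(\<integral>\<^sup>+\<omega>. \<bar>u (X s \<omega>)\<bar> \<partial>P x) \<le> (\<integral>\<^sup>+\<omega>. ennreal C * ennreal (weight (X s \<omega>) ^ k) \<partial>P x)"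
    using C(2)[OF state_space[OF s]] C(1)
    by (intro nn_integral_mono) (simp add: space_P[OF x] ennreal_mult'[symmetric] ennreal_leI)
  also have "\<dots> = ennreal C * (\<integral>\<^sup>+\<omega>. weight (X s \<omega>) ^ k \<partial>P x)"
    by (rule nn_integral_cmult) measurable
  also have "\<dots> \<le> ennreal C * ennreal B" by (intro mult_left_mono w) simp
  finally show ?thesis using C(1) by (simp add: ennreal_mult')
qed

text \<open>For \<open>m = 1\<close> no polynomial in reach dominates the weight, and the weight itself need not lie in the
  domain of the generator. The coordinates do, however, and the true martingale property bounds the
  first absolute moments of their martingale parts uniformly on \<open>[0, t]\<close>.\<close>

lemma weight_1_growth:
  assumes m: "m = 1" and x: "x \<in> S" and t: "0 \<le> t"
  obtains B where "\<And>s. \<lbrakk>0 \<le> s; s \<le> t\<rbrakk> \<Longrightarrow> (\<integral>\<^sup>+\<omega>. weight (X s \<omega>) \<partial>P x) \<le> ennreal B"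
proof -
  interpret prob_space "P x" by (rule prob_space_P[OF x])
  let ?x = "\<lambda>i (y :: real ^ 'd). y $ i"
  have xi: "?x i \<in> poly_space UNIV 1" for i by (rule poly_space_coordinate) simp
  have gi: "gen (?x i) \<in> poly_space UNIV 1" for i by (rule gen_poly[OF xi]) (use m in auto)
  have cont: "continuous_on UNIV (?x i)" "continuous_on UNIV (gen (?x i))" for i
    using xi gi by (auto intro: continuous_on_poly_space)
  have "\<exists>C\<ge>0. \<forall>y. \<bar>gen (?x i) y\<bar> \<le> C * weight y" for i
    by (rule poly_space_weight_bound[OF gi[of i]]) auto
  then obtain C where C: "\<And>i. 0 \<le> C i" "\<And>i y. \<bar>gen (?x i) y\<bar> \<le> C i * weight y" by metis
  \<comment> \<open>Each coordinate is its initial value plus a martingale plus a drift that \<open>weight\<close> dominates.\<close>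
  let ?C = "\<Sum>i\<in>UNIV. C i"
  let ?M = "\<lambda>i s \<omega>. dynkin_process X x (?x i) (gen (?x i)) (max 0 s) \<omega>"
  let ?k = "\<lambda>s \<omega>. weight x + (\<Sum>i\<in>UNIV. \<bar>?M i s \<omega>\<bar>)"
  let ?B = "weight x + (\<Sum>i\<in>UNIV. LINT \<omega>|P x. \<bar>?M i t \<omega>\<bar>)"
  have mart: "martingale (P x) F (dynkin_process X x (?x i) (gen (?x i)))" for i
    using true_martingale[OF m xi x] .
  have Mi: "integrable (P x) (?M i s)" for i s
    using mart[of i] by (auto simp: martingale_def)
  have Mmono: "(LINT \<omega>|P x. \<bar>?M i s \<omega>\<bar>) \<le> (LINT \<omega>|P x. \<bar>?M i t \<omega>\<bar>)" if "s \<le> t" for i s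
    by (rule martingale_expectation(2)[OF finite_measure_P[OF x] subalgebra_P[OF x] mart]) (use that in auto)
  have k0: "0 \<le> ?k s \<omega>" for s \<omega>
    using weight_ge_1[of x] by (intro add_nonneg_nonneg sum_nonneg) auto
  have bound: "(\<integral>\<^sup>+\<omega>. weight (X s \<omega>) \<partial>P x) \<le> ennreal (?B * exp (?C * s))" if s: "0 \<le> s" "s \<le> t" for s
  proof (rule expected_gronwall[OF sigma_finite_P[OF x] s(1), where k="?k" and B="?B"])
    show "0 \<le> ?C" by (intro sum_nonneg C)
    have "(\<lambda>z. ?M i (fst z) (snd z)) \<in> borel_measurable (borel \<Otimes>\<^sub>M P x)" for i
      using dynkin_jointly_measurable[OF x cont] by (simp add: split_beta')
    then show "(\<lambda>(s, \<omega>). ?k s \<omega>) \<in> borel_measurable (borel \<Otimes>\<^sub>M P x)"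
      unfolding split_beta' by (intro borel_measurable_add borel_measurable_const borel_measurable_sum borel_measurable_abs)
    fix r assume r: "0 \<le> r" "r \<le> s"
    show "integrable (P x) (?k r)"
      using Mi by (intro Bochner_Integration.integrable_add Bochner_Integration.integrable_sum integrable_abs) auto
    have "(LINT \<omega>|P x. ?k r \<omega>) = weight x + (\<Sum>i\<in>UNIV. LINT \<omega>|P x. \<bar>?M i r \<omega>\<bar>)"
      using Mi by (simp add: prob_space)
    also have "\<dots> \<le> ?B" using r s by (intro add_left_mono sum_mono Mmono) auto
    finally show "(LINT \<omega>|P x. ?k r \<omega>) \<le> ?B" .
    then show "(LINT \<omega>|P x. \<bar>?k r \<omega>\<bar>) \<le> ?B" using k0 by (simp only: abs_of_nonneg)
  next
    fix \<omega> assume "\<omega> \<in> space (P x)"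
    then have \<omega>: "\<omega> \<in> space \<Omega>" by (simp add: space_P[OF x])
    show "0 \<le> weight (X s \<omega>)" using weight_ge_1[of "X s \<omega>"] by simp
    show wi: "set_integrable lborel {0..s} (\<lambda>s. weight (X s \<omega>))"
      by (rule path_integrable[OF x \<omega> continuous_weight])
    have Msec: "(\<lambda>r. ?M i r \<omega>) \<in> borel_measurable borel" for i
      using measurable_compose[OF measurable_Pair2'[of \<omega> "P x" borel] dynkin_jointly_measurable[OF x cont]] \<omega>
      by (simp add: space_P[OF x])
    have "\<exists>b. \<forall>r. 0 \<le> r \<longrightarrow> r \<le> s \<longrightarrow> \<bar>?M i r \<omega>\<bar> \<le> b" for i
    proof -
      obtain b where b: "\<And>r. \<lbrakk>0 \<le> r; r \<le> s\<rbrakk> \<Longrightarrow> \<bar>X r \<omega> $ i\<bar> \<le> b"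
        using path_bounded[OF \<omega> cont(1)[of i], of s] by blast
      have "\<bar>?M i r \<omega>\<bar> \<le> b + \<bar>x $ i\<bar> + (LBINT q:{0..s}. \<bar>gen (?x i) (X q \<omega>)\<bar>)" if "0 \<le> r" "r \<le> s" for r
        using b[OF that] set_integral_abs_le[OF path_integrable[OF x \<omega> cont(2)[of i]] that(2)] that
        by (simp add: dynkin_process_def)
      then show ?thesis by blast
    qed
    then obtain b where b: "\<And>i r. \<lbrakk>0 \<le> r; r \<le> s\<rbrakk> \<Longrightarrow> \<bar>?M i r \<omega>\<bar> \<le> b i" by metis
    show "set_integrable lborel {0..s} (\<lambda>r. ?k r \<omega>)"
    proof (rule set_integrable_bounded)
      show "(\<lambda>r. ?k r \<omega>) \<in> borel_measurable borel"
        using Msec by (intro borel_measurable_add borel_measurable_const borel_measurable_sum borel_measurable_abs)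
      fix r assume r: "0 \<le> r" "r \<le> s"
      have "?k r \<omega> \<le> weight x + (\<Sum>i\<in>UNIV. b i)" by (intro add_left_mono sum_mono b r)
      then show "\<bar>?k r \<omega>\<bar> \<le> weight x + (\<Sum>i\<in>UNIV. b i)" using k0[of r \<omega>] by simp
    qed
    fix r assume r: "0 \<le> r" "r \<le> s"
    have wr: "set_integrable lborel {0..r} (\<lambda>s. weight (X s \<omega>))"
      by (rule path_integrable[OF x \<omega> continuous_weight])
    have "\<bar>X r \<omega> $ i\<bar> \<le> \<bar>x $ i\<bar> + \<bar>?M i r \<omega>\<bar> + C i * (LBINT q:{0..r}. weight (X q \<omega>))" for i
    proof -
      have "\<bar>LBINT q:{0..r}. gen (?x i) (X q \<omega>)\<bar> \<le> (LBINT q:{0..r}. \<bar>gen (?x i) (X q \<omega>)\<bar>)"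
        by (rule set_integral_abs_le[OF path_integrable[OF x \<omega> cont(2)[of i]] order_refl])
      also have "\<dots> \<le> (LBINT q:{0..r}. C i * weight (X q \<omega>))"
        using wr by (intro set_integral_mono set_integrable_abs path_integrable[OF x \<omega> cont(2)[of i]] set_integrable_mult_right C)
      also have "\<dots> = C i * (LBINT q:{0..r}. weight (X q \<omega>))" by simp
      finally show ?thesis using r by (simp add: dynkin_process_def)
    qed
    then have "weight (X r \<omega>) \<le> 1 + (\<Sum>i\<in>UNIV. \<bar>x $ i\<bar> + \<bar>?M i r \<omega>\<bar> + C i * (LBINT q:{0..r}. weight (X q \<omega>)))"
      unfolding weight_def[of "X r \<omega>"] by (intro add_left_mono sum_mono)
    also have "\<dots> = ?k r \<omega> + ?C * (LBINT q:{0..r}. weight (X q \<omega>))"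
      by (simp add: sum.distrib sum_distrib_right weight_def[of x])
    finally show "weight (X r \<omega>) \<le> ?k r \<omega> + ?C * (LBINT q:{0..r}. weight (X q \<omega>))" .
  qed
  have B0: "0 \<le> ?B"
    using weight_ge_1[of x] by (intro add_nonneg_nonneg sum_nonneg integral_nonneg_AE) auto
  show ?thesis
  proof (rule that[of "?B * exp (?C * t)"])
    fix s assume s: "0 \<le> s" "s \<le> t"
    have "?B * exp (?C * s) \<le> ?B * exp (?C * t)"
      using B0 C(1) s by (intro mult_left_mono) (auto intro!: mult_left_mono sum_nonneg)
    then show "(\<integral>\<^sup>+\<omega>. weight (X s \<omega>) \<partial>P x) \<le> ennreal (?B * exp (?C * t))"
      using bound[OF s] by (meson ennreal_leI order_trans)
  qed
qed

text \<open>Dynkin's formula in degree one when second moments exist. The functions \<open>\<epsilon>f + u\<close> and \<open>\<epsilon>f - u\<close>, with \<open>f\<close>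
  quadratic, are bounded below, so Fatou's lemma gives one inequality for each; letting \<open>\<epsilon>\<close> tend to \<open>0\<close>
  turns them into the two halves of the equality. In this way \<open>u\<close> and \<open>f\<close> never have to be localized by
  the same stopping times.\<close>

lemma dynkin_formula_affine:
  assumes m: "2 \<le> m" and x: "x \<in> S" and t: "0 \<le> t" and u: "u \<in> poly_space UNIV 1"
  shows "(LINT \<omega>|P x. u (X t \<omega>)) = u x + (LBINT s:{0..t}. (LINT \<omega>|P x. gen u (X s \<omega>)))"
    and "set_integrable lborel {0..t} (\<lambda>s. LINT \<omega>|P x. gen u (X s \<omega>))"
    and "set_integrable lborel {0..t} (\<lambda>s. LINT \<omega>|P x. u (X s \<omega>))"
proof -
  interpret prob_space "P x" by (rule prob_space_P[OF x])
  let ?f = "even_weight 2 :: real ^ 'd \<Rightarrow> real"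
  let ?D = "(real CARD('d) + 1)\<^sup>2"
  obtain C where C: "0 \<le> C"
    "\<And>x t. \<lbrakk>x \<in> S; 0 \<le> t\<rbrakk> \<Longrightarrow> (\<integral>\<^sup>+\<omega>. ?f (X t \<omega>) \<partial>P x) \<le> ennreal (?f x * exp (C * t))"
    by (rule even_weight_growth[of 2]) (use m in auto)
  have f1: "1 \<le> ?f y" for y by (rule even_weight_ge_1) simp
  have w2: "weight y ^ 2 \<le> ?D * ?f y" for y by (rule weight_power_le_even_weight) simp
  have quad: "(\<integral>\<^sup>+\<omega>. weight (X s \<omega>) ^ 2 \<partial>P x) \<le> ennreal (?D * (?f x * exp (C * t)))" if s: "0 \<le> s" "s \<le> t" for s
  proof -
    have [measurable]: "(\<lambda>\<omega>. ?f (X s \<omega>)) \<in> borel_measurable (P x)"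
      by (rule continuous_X_measurable[OF x s(1) continuous_on_poly_space[OF poly_space_even_weight[OF order_refl]]])
    have "(\<integral>\<^sup>+\<omega>. weight (X s \<omega>) ^ 2 \<partial>P x) \<le> (\<integral>\<^sup>+\<omega>. ennreal ?D * ennreal (?f (X s \<omega>)) \<partial>P x)"
      using w2 f1 by (intro nn_integral_mono) (auto simp: ennreal_mult'[symmetric] intro!: ennreal_leI)
    also have "\<dots> = ennreal ?D * (\<integral>\<^sup>+\<omega>. ?f (X s \<omega>) \<partial>P x)" by (rule nn_integral_cmult) measurable
    also have "\<dots> \<le> ennreal ?D * ennreal (?f x * exp (C * t))"
    proof (intro mult_left_mono)
      have "?f x * exp (C * s) \<le> ?f x * exp (C * t)"
        using f1[of x] mult_left_mono[OF s(2) C(1)] by (intro mult_left_mono) auto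
      then show "(\<integral>\<^sup>+\<omega>. ?f (X s \<omega>) \<partial>P x) \<le> ennreal (?f x * exp (C * t))"
        using C(2)[OF x s(1)] by (meson ennreal_leI order_trans)
    qed simp
    finally show ?thesis by (simp add: ennreal_mult')
  qed
  have bound: "\<exists>B. \<forall>s. 0 \<le> s \<longrightarrow> s \<le> t \<longrightarrow> (\<integral>\<^sup>+\<omega>. \<bar>v (X s \<omega>)\<bar> \<partial>P x) \<le> ennreal B" if v: "v \<in> poly_space UNIV 2" for v
  proof -
    obtain K where K: "0 \<le> K" "\<And>y. \<bar>v y\<bar> \<le> K * weight y ^ 2"
      using poly_space_weight_bound[OF v] by auto
    show ?thesis
      using poly_moment_bound_of_weight[OF quad x _ K] by blast
  qed
  have path: "integrable (P x) (\<lambda>\<omega>. LBINT s:{0..t}. \<bar>v (X s \<omega>)\<bar>)" "integrable (P x) (\<lambda>\<omega>. LBINT s:{0..t}. v (X s \<omega>))"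
    "(LINT \<omega>|P x. (LBINT s:{0..t}. v (X s \<omega>))) = (LBINT s:{0..t}. (LINT \<omega>|P x. v (X s \<omega>)))"
    "set_integrable lborel {0..t} (\<lambda>s. LINT \<omega>|P x. v (X s \<omega>))" if v: "v \<in> poly_space UNIV 2" for v
  proof -
    obtain B where B: "\<And>s. \<lbrakk>0 \<le> s; s \<le> t\<rbrakk> \<Longrightarrow> (\<integral>\<^sup>+\<omega>. \<bar>v (X s \<omega>)\<bar> \<partial>P x) \<le> ennreal B"
      using bound[OF v] by blast
    show "integrable (P x) (\<lambda>\<omega>. LBINT s:{0..t}. \<bar>v (X s \<omega>)\<bar>)" "integrable (P x) (\<lambda>\<omega>. LBINT s:{0..t}. v (X s \<omega>))"
    "(LINT \<omega>|P x. (LBINT s:{0..t}. v (X s \<omega>))) = (LBINT s:{0..t}. (LINT \<omega>|P x. v (X s \<omega>)))"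
    "set_integrable lborel {0..t} (\<lambda>s. LINT \<omega>|P x. v (X s \<omega>))"
      using expectation_path_integral[OF x continuous_on_poly_space[OF v] t B] by auto
  qed
  have f2: "?f \<in> poly_space UNIV 2" by (rule poly_space_even_weight) simp
  have gf2: "gen ?f \<in> poly_space UNIV 2" by (rule gen_poly[OF f2]) (use m in auto)
  have le: "(LINT \<omega>|P x. u (X t \<omega>)) \<le> u x + (LINT \<omega>|P x. (LBINT s:{0..t}. gen u (X s \<omega>)))"
    if u: "u \<in> poly_space UNIV 1" for u
  proof -
    have um: "u \<in> poly_space UNIV m" and fm: "?f \<in> poly_space UNIV m" and u2: "u \<in> poly_space UNIV 2"
      using poly_space_mono[OF u] poly_space_mono[OF f2] m by auto
    have gu2: "gen u \<in> poly_space UNIV 2"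
      using poly_space_mono[OF gen_poly[OF u]] m by auto
    obtain K where K: "0 \<le> K" "\<And>y. \<bar>u y\<bar> \<le> K * weight y ^ 1"
      using poly_space_weight_bound[OF u] by auto
    have ui: "integrable (P x) (\<lambda>\<omega>. u (X t \<omega>))" and fi: "integrable (P x) (\<lambda>\<omega>. ?f (X t \<omega>))"
      using poly_integrable[OF um x t] poly_integrable[OF fm x t] by auto
    let ?E = "LINT \<omega>|P x. u (X t \<omega>)" and ?I = "LINT \<omega>|P x. (LBINT s:{0..t}. gen u (X s \<omega>))"
    let ?R = "?f x + (LINT \<omega>|P x. (LBINT s:{0..t}. gen ?f (X s \<omega>))) - (LINT \<omega>|P x. ?f (X t \<omega>))"
    have eps: "?E - u x - ?I \<le> \<epsilon> * ?R" if \<epsilon>: "0 < \<epsilon>" for \<epsilon>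
    proof -
      \<comment> \<open>The quadratic term makes \<open>\<epsilon>f + u\<close> bounded below; its own contribution is \<open>\<epsilon>\<close> times a finite
        quantity.\<close>
      let ?\<psi> = "\<lambda>y. \<epsilon> * ?f y + 1 * u y"
      have \<psi>2: "?\<psi> \<in> poly_space UNIV 2"
        using poly_space_add[OF poly_space_scale[OF f2, of \<epsilon>] poly_space_scale[OF u2, of 1]] by simp
      have \<psi>m: "?\<psi> \<in> poly_space UNIV m" by (rule poly_space_mono[OF \<psi>2 m])
      have g\<psi>2: "gen ?\<psi> \<in> poly_space UNIV 2" by (rule gen_poly[OF \<psi>2]) (use m in auto)
      have lower: "- (K\<^sup>2 / (4 * (\<epsilon> / ?D))) \<le> ?\<psi> y" for y
      proof -
        let ?e = "\<epsilon> / ?D"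
        have D: "0 < ?D" by (simp add: add_pos_pos)
        have "K * weight y \<le> ?e * weight y ^ 2 + K\<^sup>2 / (4 * ?e)"
          using \<epsilon> D by (intro linear_le_quadratic divide_pos_pos)
        moreover have "?e * weight y ^ 2 \<le> ?e * (?D * ?f y)" using \<epsilon> D w2 by (intro mult_left_mono) auto
        moreover have "?e * (?D * ?f y) = \<epsilon> * ?f y" using D by simp
        moreover have "- (K * weight y) \<le> u y" using K(2)[of y] by simp
        ultimately show ?thesis by simp
      qed
      have \<psi>i: "integrable (P x) (\<lambda>\<omega>. ?\<psi> (X t \<omega>))" using ui fi by simp
      have "(LINT \<omega>|P x. ?\<psi> (X t \<omega>)) \<le> ?\<psi> x + (LINT \<omega>|P x. (LBINT s:{0..t}. gen ?\<psi> (X s \<omega>)))"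
        by (rule dynkin_fatou[OF x gen_dynkin[OF \<psi>m] t path(1)[OF g\<psi>2] lower \<psi>i])
      also have "(LINT \<omega>|P x. (LBINT s:{0..t}. gen ?\<psi> (X s \<omega>))) =
          (LINT \<omega>|P x. \<epsilon> * (LBINT s:{0..t}. gen ?f (X s \<omega>)) + (LBINT s:{0..t}. gen u (X s \<omega>)))"
      proof (rule Bochner_Integration.integral_cong[OF refl])
        fix \<omega> assume "\<omega> \<in> space (P x)"
        then have \<omega>: "\<omega> \<in> space \<Omega>" by (simp add: space_P[OF x])
        have "(LBINT s:{0..t}. gen ?\<psi> (X s \<omega>)) = (LBINT s:{0..t}. \<epsilon> * gen ?f (X s \<omega>) + gen u (X s \<omega>))"
          using gen_linear[OF fm um state_space[OF _ \<omega>], of _ \<epsilon> 1]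
          by (intro set_lebesgue_integral_cong) auto
        also have "\<dots> = \<epsilon> * (LBINT s:{0..t}. gen ?f (X s \<omega>)) + (LBINT s:{0..t}. gen u (X s \<omega>))"
          using path_integrable[OF x \<omega> continuous_on_poly_space[OF gf2], of t]
            path_integrable[OF x \<omega> continuous_on_poly_space[OF gu2], of t]
          by (subst set_integral_add) auto
        finally show "(LBINT s:{0..t}. gen ?\<psi> (X s \<omega>)) = \<epsilon> * (LBINT s:{0..t}. gen ?f (X s \<omega>)) + (LBINT s:{0..t}. gen u (X s \<omega>))" .
      qed
      also have "\<dots> = \<epsilon> * (LINT \<omega>|P x. (LBINT s:{0..t}. gen ?f (X s \<omega>))) + ?I"
        using path(2)[OF gf2] path(2)[OF gu2] by simp
      also have "(LINT \<omega>|P x. ?\<psi> (X t \<omega>)) = \<epsilon> * (LINT \<omega>|P x. ?f (X t \<omega>)) + ?E" using ui fi by simp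
      finally show ?thesis by (simp add: algebra_simps)
    qed
    have "?E - u x - ?I \<le> 0"
    proof (rule field_le_epsilon)
      fix e :: real assume e: "0 < e"
      have "?E - u x - ?I \<le> e / (\<bar>?R\<bar> + 1) * ?R" by (rule eps) (use e in \<open>simp add: add_nonneg_pos\<close>)
      also have "\<dots> \<le> e / (\<bar>?R\<bar> + 1) * (\<bar>?R\<bar> + 1)" using e by (intro mult_left_mono) auto
      also have "\<dots> = 0 + e"
      proof -
        have "\<bar>?R\<bar> + 1 \<noteq> 0" by linarith
        then show ?thesis by simp
      qed
      finally show "?E - u x - ?I \<le> 0 + e" .
    qed
    then show ?thesis by simp
  qed
  have um: "u \<in> poly_space UNIV m" using poly_space_mono[OF u] m by auto
  have gu2: "gen u \<in> poly_space UNIV 2"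
    using poly_space_mono[OF gen_poly[OF u]] m by auto
  let ?n = "\<lambda>y. (- 1) * u y + 0 * u y"
  have n1: "?n \<in> poly_space UNIV 1"
    using poly_space_add[OF poly_space_scale[OF u, of "- 1"] poly_space_scale[OF u, of 0]] by simp
  have "(LINT \<omega>|P x. (LBINT s:{0..t}. gen ?n (X s \<omega>))) = (LINT \<omega>|P x. - (LBINT s:{0..t}. gen u (X s \<omega>)))"
  proof (rule Bochner_Integration.integral_cong[OF refl])
    fix \<omega> assume "\<omega> \<in> space (P x)"
    then have \<omega>: "\<omega> \<in> space \<Omega>" by (simp add: space_P[OF x])
    have "(LBINT s:{0..t}. gen ?n (X s \<omega>)) = (LBINT s:{0..t}. - gen u (X s \<omega>))"
      using gen_linear[OF um um state_space[OF _ \<omega>], of _ "- 1" 0]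
      by (intro set_lebesgue_integral_cong) auto
    then show "(LBINT s:{0..t}. gen ?n (X s \<omega>)) = - (LBINT s:{0..t}. gen u (X s \<omega>))"
      by (simp add: set_lebesgue_integral_def)
  qed
  then have "(LINT \<omega>|P x. u (X t \<omega>)) \<ge> u x + (LINT \<omega>|P x. (LBINT s:{0..t}. gen u (X s \<omega>)))"
    using le[OF n1] by simp
  with le[OF u] show "(LINT \<omega>|P x. u (X t \<omega>)) = u x + (LBINT s:{0..t}. (LINT \<omega>|P x. gen u (X s \<omega>)))"
    unfolding path(3)[OF gu2] by simp
  show "set_integrable lborel {0..t} (\<lambda>s. LINT \<omega>|P x. gen u (X s \<omega>))" by (rule path(4)[OF gu2])
  show "set_integrable lborel {0..t} (\<lambda>s. LINT \<omega>|P x. u (X s \<omega>))"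
    by (rule path(4)[OF poly_space_mono[OF u]]) simp
qed

lemma coordinate_integrable:
  assumes "1 \<le> m" "x \<in> S" "0 \<le> t"
  shows "integrable (P x) (\<lambda>\<omega>. X t \<omega> $ i)"
  using poly_integrable[OF poly_space_coordinate[OF assms(1)] assms(2,3)] .

text \<open>The first moments solve an affine differential equation, so their initial value is controlled by
  their value at a later time. This lower bound on the later mean is what a true martingale would
  provide, and it fails for strict local martingales.\<close>

lemma weight_submean:
  assumes m: "2 \<le> m"
  obtains C where "0 \<le> C"
    "\<And>y t. \<lbrakk>y \<in> S; 0 \<le> t\<rbrakk> \<Longrightarrow> weight y \<le> exp (C * t) * (LINT \<omega>|P y. weight (X t \<omega>))"
proof -
  let ?x = "\<lambda>i (y :: real ^ 'd). y $ i"
  have m1: "1 \<le> m" using m by simp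
  have xi: "?x i \<in> poly_space UNIV 1" for i by (rule poly_space_coordinate) simp
  have gi: "gen (?x i) \<in> poly_space UNIV 1" for i by (rule gen_poly[OF xi]) (use m in auto)
  have "\<exists>b c. \<forall>y. gen (?x i) y = b + (\<Sum>j\<in>UNIV. c j * y $ j)" for i
    by (rule poly_space_1_affine[OF gi[of i]]) auto
  then obtain b c where bc: "\<And>i y. gen (?x i) y = b i + (\<Sum>j\<in>UNIV. c i j * y $ j)" by metis
  let ?C = "\<lambda>i. \<bar>b i\<bar> + (\<Sum>j\<in>UNIV. \<bar>c i j\<bar>)"
  show ?thesis
  proof (rule that[of "\<Sum>i\<in>UNIV. ?C i"])
    show C0: "0 \<le> (\<Sum>i\<in>UNIV. ?C i)" by (intro sum_nonneg add_nonneg_nonneg) auto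
    fix y t assume y: "y \<in> S" and t: "(0 :: real) \<le> t"
    interpret prob_space "P y" by (rule prob_space_P[OF y])
    \<comment> \<open>\<open>\<xi>\<close> is the vector of first moments; since the generator maps degree one to degree one, its derivative
      \<open>h\<close> is an affine function of \<open>\<xi>\<close>.\<close>
    define \<xi> where "\<xi> i s = (LINT \<omega>|P y. X s \<omega> $ i)" for i s
    define h where "h i s = (LINT \<omega>|P y. gen (?x i) (X s \<omega>))" for i s
    define \<phi> where "\<phi> s = 1 + (\<Sum>i\<in>UNIV. \<bar>\<xi> i s\<bar>)" for s
    have \<xi>: "\<xi> i s = y $ i + (LBINT r:{0..s}. h i r)" if "0 \<le> s" for i s
      using dynkin_formula_affine(1)[OF m y that xi] by (simp add: \<xi>_def h_def)
    have hi: "set_integrable lborel {0..s} (h i)" if "0 \<le> s" for i s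
      using dynkin_formula_affine(2)[OF m y that xi] by (simp add: h_def[abs_def])
    have \<xi>i: "set_integrable lborel {0..t} (\<xi> i)" for i
      using dynkin_formula_affine(3)[OF m y t xi] by (simp add: \<xi>_def[abs_def])
    have \<phi>i: "set_integrable lborel {0..t} \<phi>"
    proof -
      have "set_integrable lborel {0..t} (\<lambda>s. 1 + (\<Sum>i\<in>UNIV. \<bar>\<xi> i s\<bar>))"
      proof (rule set_integral_add(1))
        show "set_integrable lborel {0..t} (\<lambda>s. 1 :: real)"
          by (intro borel_integrable_atLeastAtMost' continuous_on_const)
        show "set_integrable lborel {0..t} (\<lambda>s. \<Sum>i\<in>UNIV. \<bar>\<xi> i s\<bar>)"
          unfolding set_integrable_def scaleR_sum_right
          by (intro Bochner_Integration.integrable_sum)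
            (use set_integrable_abs[OF \<xi>i] in \<open>simp add: set_integrable_def\<close>)
      qed
      then show ?thesis by (simp add: \<phi>_def[abs_def])
    qed
    have h_le: "\<bar>h i s\<bar> \<le> ?C i * \<phi> s" if s: "0 \<le> s" for i s
    proof -
      have "h i s = b i + (\<Sum>j\<in>UNIV. c i j * \<xi> j s)"
        unfolding h_def \<xi>_def bc using coordinate_integrable[OF m1 y s]
        by (simp add: prob_space)
      then have "\<bar>h i s\<bar> \<le> \<bar>b i\<bar> + (\<Sum>j\<in>UNIV. \<bar>c i j * \<xi> j s\<bar>)"
        using sum_abs[of "\<lambda>j. c i j * \<xi> j s" UNIV] by linarith
      also have "\<dots> \<le> \<bar>b i\<bar> * \<phi> s + (\<Sum>j\<in>UNIV. \<bar>c i j\<bar> * \<phi> s)"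
      proof (intro add_mono sum_mono)
        have "1 \<le> \<phi> s" by (simp add: \<phi>_def sum_nonneg)
        then show "\<bar>b i\<bar> \<le> \<bar>b i\<bar> * \<phi> s" using mult_left_mono[of 1 "\<phi> s" "\<bar>b i\<bar>"] by simp
        fix j
        have "\<bar>\<xi> j s\<bar> \<le> \<phi> s"
          using member_le_sum[of j UNIV "\<lambda>i. \<bar>\<xi> i s\<bar>"] by (simp add: \<phi>_def)
        then show "\<bar>c i j * \<xi> j s\<bar> \<le> \<bar>c i j\<bar> * \<phi> s" by (simp add: abs_mult mult_left_mono)
      qed
      also have "\<dots> = ?C i * \<phi> s" by (simp add: sum_distrib_right distrib_right)
      finally show ?thesis .
    qed
    have backward: "\<phi> s \<le> \<phi> t + (\<Sum>i\<in>UNIV. ?C i) * (LBINT r:{s..t}. \<phi> r)" if s: "0 \<le> s" "s \<le> t" for s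
    proof -
      have \<phi>st: "set_integrable lborel {s..t} \<phi>" by (rule set_integrable_subset[OF \<phi>i]) (use s in auto)
      have "\<bar>\<xi> i s\<bar> \<le> \<bar>\<xi> i t\<bar> + ?C i * (LBINT r:{s..t}. \<phi> r)" for i
      proof -
        have "\<xi> i t - \<xi> i s = (\<integral>r. indicator {0..t} r * h i r - indicator {0..s} r * h i r \<partial>lborel)"
          using \<xi>[OF t, of i] \<xi>[OF s(1), of i] hi[OF t, of i] hi[OF s(1), of i]
          by (simp add: set_lebesgue_integral_def set_integrable_def)
        also have "\<bar>\<dots>\<bar> \<le> (\<integral>r. \<bar>indicator {0..t} r * h i r - indicator {0..s} r * h i r\<bar> \<partial>lborel)"
          using integral_norm_bound[of lborel "\<lambda>r. indicator {0..t} r * h i r - indicator {0..s} r * h i r"] by simp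
        also have "\<dots> \<le> (\<integral>r. ?C i * (indicator {s..t} r * \<phi> r) \<partial>lborel)"
        proof (rule integral_mono)
          show "integrable lborel (\<lambda>r. \<bar>indicator {0..t} r * h i r - indicator {0..s} r * h i r\<bar>)"
            using hi[OF t, of i] hi[OF s(1), of i] by (simp add: set_integrable_def)
          show "integrable lborel (\<lambda>r. ?C i * (indicator {s..t} r * \<phi> r))"
            using \<phi>st by (simp add: set_integrable_def)
          fix r
          show "\<bar>indicator {0..t} r * h i r - indicator {0..s} r * h i r\<bar> \<le> ?C i * (indicator {s..t} r * \<phi> r)"
            using s h_le[of r i] by (auto simp: indicator_def)
        qed
        also have "\<dots> = ?C i * (LBINT r:{s..t}. \<phi> r)" by (simp add: set_lebesgue_integral_def)
        finally show ?thesis by linarith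
      qed
      then have "(\<Sum>i\<in>UNIV. \<bar>\<xi> i s\<bar>) \<le> (\<Sum>i\<in>UNIV. \<bar>\<xi> i t\<bar> + ?C i * (LBINT r:{s..t}. \<phi> r))"
        by (intro sum_mono)
      then show ?thesis by (simp add: \<phi>_def sum.distrib sum_distrib_right distrib_right)
    qed
    have "weight y = \<phi> 0"
      using \<xi>[of 0] by (simp add: \<phi>_def weight_def set_integral_point)
    also have "\<dots> \<le> \<phi> t * exp ((\<Sum>i\<in>UNIV. ?C i) * t)"
      by (rule gronwall_backward[OF t C0 \<phi>i backward])
    also have "\<phi> t \<le> (LINT \<omega>|P y. weight (X t \<omega>))"
    proof -
      have "(LINT \<omega>|P y. weight (X t \<omega>)) = 1 + (\<Sum>i\<in>UNIV. LINT \<omega>|P y. \<bar>X t \<omega> $ i\<bar>)"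
        unfolding weight_def using coordinate_integrable[OF m1 y t] by (simp add: prob_space)
      moreover have "\<bar>\<xi> i t\<bar> \<le> (LINT \<omega>|P y. \<bar>X t \<omega> $ i\<bar>)" for i
        unfolding \<xi>_def using integral_norm_bound[of "P y" "\<lambda>\<omega>. X t \<omega> $ i"] by simp
      ultimately show ?thesis by (simp add: \<phi>_def sum_mono)
    qed
    finally show "weight y \<le> exp ((\<Sum>i\<in>UNIV. ?C i) * t) * (LINT \<omega>|P y. weight (X t \<omega>))"
      by (simp add: mult.commute)
  qed
qed

lemma weight_power_integrable:
  assumes x: "x \<in> S" and t: "0 \<le> t"
  shows "integrable (P x) (\<lambda>\<omega>. weight (X t \<omega>) ^ m)"
proof -
  interpret prob_space "P x" by (rule prob_space_P[OF x])
  have [measurable]: "(\<lambda>\<omega>. weight (X t \<omega>)) \<in> borel_measurable (P x)"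
    by (rule continuous_X_measurable[OF x t continuous_weight])
  have "integrable (P x) (\<lambda>\<omega>. \<bar>X t \<omega> $ i ^ m\<bar>)" for i
    using poly_integrable[OF poly_space_coordinate_power[OF order_refl] x t, of i] by simp
  then have "integrable (P x) (\<lambda>\<omega>. (real CARD('d) + 1) ^ m * (1 + (\<Sum>i\<in>UNIV. \<bar>X t \<omega> $ i\<bar> ^ m)))"
    by (simp add: power_abs)
  then show ?thesis
  proof (rule Bochner_Integration.integrable_bound)
    show "AE \<omega> in P x. norm (weight (X t \<omega>) ^ m) \<le> norm ((real CARD('d) + 1) ^ m * (1 + (\<Sum>i\<in>UNIV. \<bar>X t \<omega> $ i\<bar> ^ m)))"
    proof (rule AE_I2)
      fix \<omega>
      have "0 \<le> weight (X t \<omega>)" using weight_ge_1[of "X t \<omega>"] by simp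
      then have "norm (weight (X t \<omega>) ^ m) = weight (X t \<omega>) ^ m" by simp
      also have "\<dots> \<le> (real CARD('d) + 1) ^ m * (1 + (\<Sum>i\<in>UNIV. \<bar>X t \<omega> $ i\<bar> ^ m))" by (rule weight_power_le)
      also have "\<dots> \<le> norm \<dots>" by simp
      finally show "norm (weight (X t \<omega>) ^ m) \<le> norm ((real CARD('d) + 1) ^ m * (1 + (\<Sum>i\<in>UNIV. \<bar>X t \<omega> $ i\<bar> ^ m)))" .
    qed
  qed measurable
qed

text \<open>Jensen's inequality raises the degree-one estimate to the top degree \<open>m\<close>.\<close>

lemma weight_power_domination:
  assumes m: "2 \<le> m" and t: "0 \<le> t"
  obtains c where "0 \<le> c"
    "\<And>y r. \<lbrakk>y \<in> S; 0 \<le> r; r \<le> t\<rbrakk> \<Longrightarrow> ennreal (weight y ^ m) \<le> ennreal c * (\<integral>\<^sup>+\<omega>. weight (X r \<omega>) ^ m \<partial>P y)"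
proof -
  obtain C where C: "0 \<le> C"
    "\<And>y t. \<lbrakk>y \<in> S; 0 \<le> t\<rbrakk> \<Longrightarrow> weight y \<le> exp (C * t) * (LINT \<omega>|P y. weight (X t \<omega>))"
    by (rule weight_submean[OF m]) auto
  show ?thesis
  proof (rule that[of "exp (C * t) ^ m"])
    fix y r assume y: "y \<in> S" and r: "0 \<le> r" "r \<le> t"
    interpret prob_space "P y" by (rule prob_space_P[OF y])
    have w1: "1 \<le> weight (X r \<omega>)" for \<omega> by (rule weight_ge_1)
    have wi: "integrable (P y) (\<lambda>\<omega>. weight (X r \<omega>))"
      unfolding weight_def using coordinate_integrable[OF _ y r(1)] m by simp
    have E1: "1 \<le> (LINT \<omega>|P y. weight (X r \<omega>))"
      using integral_mono[OF _ wi, of "\<lambda>_. 1"] w1 by (simp add: prob_space)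
    have jensen: "(LINT \<omega>|P y. weight (X r \<omega>)) ^ m \<le> (LINT \<omega>|P y. weight (X r \<omega>) ^ m)"
    proof (rule jensens_inequality[where I="{0<..}" and a=0])
      show "AE \<omega> in P y. weight (X r \<omega>) \<in> {0<..}"
        using w1 by (intro AE_I2) (auto intro: less_le_trans[OF zero_less_one])
      show "convex_on {0<..} (\<lambda>x :: real. x ^ m)"
        by (cases "even m") (auto intro: convex_on_subset[OF convex_power_even] convex_on_subset[OF convex_power_odd])
    qed (use wi weight_power_integrable[OF y r(1)] in auto)
    have "weight y ^ m \<le> (exp (C * r) * (LINT \<omega>|P y. weight (X r \<omega>))) ^ m"
      using C(2)[OF y r(1)] weight_ge_1[of y] by (intro power_mono) auto
    also have "\<dots> = exp (C * r) ^ m * (LINT \<omega>|P y. weight (X r \<omega>)) ^ m" by (rule power_mult_distrib)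
    also have "\<dots> \<le> exp (C * t) ^ m * (LINT \<omega>|P y. weight (X r \<omega>) ^ m)"
      using jensen C(1) r E1 by (intro mult_mono power_mono) (auto intro: mult_left_mono)
    finally have "ennreal (weight y ^ m) \<le> ennreal (exp (C * t) ^ m * (LINT \<omega>|P y. weight (X r \<omega>) ^ m))"
      by (rule ennreal_leI)
    also have "\<dots> = ennreal (exp (C * t) ^ m) * ennreal (LINT \<omega>|P y. weight (X r \<omega>) ^ m)"
      by (intro ennreal_mult') simp
    also have "ennreal (LINT \<omega>|P y. weight (X r \<omega>) ^ m) = (\<integral>\<^sup>+\<omega>. weight (X r \<omega>) ^ m \<partial>P y)"
      using w1 by (intro nn_integral_eq_integral[symmetric] weight_power_integrable[OF y r(1)] AE_I2)
        (auto intro: order_trans[OF zero_le_one])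
    finally show "ennreal (weight y ^ m) \<le> ennreal (exp (C * t) ^ m) * (\<integral>\<^sup>+\<omega>. weight (X r \<omega>) ^ m \<partial>P y)" .
  qed simp
qed

lemma weight_power_bounded:
  assumes x: "x \<in> S" and t: "0 \<le> t"
  obtains B where "\<And>s. \<lbrakk>0 \<le> s; s \<le> t\<rbrakk> \<Longrightarrow> (\<integral>\<^sup>+\<omega>. weight (X s \<omega>) ^ m \<partial>P x) \<le> ennreal B"
proof -
  interpret prob_space "P x" by (rule prob_space_P[OF x])
  consider "m = 0" | "m = 1" | "2 \<le> m" by linarith
  then show ?thesis
  proof cases
    case 1
    then show ?thesis by (intro that[of 1]) (simp add: emeasure_space_1)
  next
    case 2
    obtain B where "\<And>s. \<lbrakk>0 \<le> s; s \<le> t\<rbrakk> \<Longrightarrow> (\<integral>\<^sup>+\<omega>. weight (X s \<omega>) \<partial>P x) \<le> ennreal B"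
      using weight_1_growth[OF 2 x t] by metis
    then show ?thesis using 2 by (intro that[of B]) simp
  next
    case 3
    obtain c where c: "0 \<le> c"
      "\<And>y r. \<lbrakk>y \<in> S; 0 \<le> r; r \<le> t\<rbrakk> \<Longrightarrow> ennreal (weight y ^ m) \<le> ennreal c * (\<integral>\<^sup>+\<omega>. weight (X r \<omega>) ^ m \<partial>P y)"
      using weight_power_domination[OF 3 t] by metis
    have cw: "continuous_on UNIV (\<lambda>y :: real ^ 'd. weight y ^ m)" by (intro continuous_intros continuous_weight)
    have w0: "0 \<le> weight (X t \<omega>) ^ m" for \<omega> using weight_ge_1[of "X t \<omega>"] by simp
    show ?thesis
    proof (rule that[of "c * (LINT \<omega>|P x. weight (X t \<omega>) ^ m)"])
      fix s assume s: "0 \<le> s" "s \<le> t"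
      have D: "space \<Omega> \<in> sets (F s)" using sets.top[of "F s"] by (simp add: space_F)
      have "(\<integral>\<^sup>+\<omega>. weight (X s \<omega>) ^ m \<partial>P x) = (\<integral>\<^sup>+\<omega>. ennreal (weight (X s \<omega>) ^ m) * indicator (space \<Omega>) \<omega> \<partial>P x)"
        by (intro nn_integral_cong) (simp add: space_P[OF x])
      also have "\<dots> \<le> ennreal c * (\<integral>\<^sup>+\<omega>. ennreal (weight (X t \<omega>) ^ m) * indicator (space \<Omega>) \<omega> \<partial>P x)"
        by (rule markov_domination[OF x s D cw c(2)])
      also have "(\<integral>\<^sup>+\<omega>. ennreal (weight (X t \<omega>) ^ m) * indicator (space \<Omega>) \<omega> \<partial>P x) = (\<integral>\<^sup>+\<omega>. weight (X t \<omega>) ^ m \<partial>P x)"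
        by (intro nn_integral_cong) (simp add: space_P[OF x])
      also have "\<dots> = ennreal (LINT \<omega>|P x. weight (X t \<omega>) ^ m)"
        using w0 by (intro nn_integral_eq_integral weight_power_integrable[OF x t]) auto
      finally show "(\<integral>\<^sup>+\<omega>. weight (X s \<omega>) ^ m \<partial>P x) \<le> ennreal (c * (LINT \<omega>|P x. weight (X t \<omega>) ^ m))"
        using c(1) by (simp add: ennreal_mult')
    qed
  qed
qed

lemma poly_moment_bounded:
  assumes x: "x \<in> S" and t: "0 \<le> t" and u: "u \<in> poly_space UNIV m"
  obtains B where "\<And>s. \<lbrakk>0 \<le> s; s \<le> t\<rbrakk> \<Longrightarrow> (\<integral>\<^sup>+\<omega>. ennreal \<bar>u (X s \<omega>)\<bar> \<partial>P x) \<le> ennreal B"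
proof -
  obtain B where B: "\<And>s. \<lbrakk>0 \<le> s; s \<le> t\<rbrakk> \<Longrightarrow> (\<integral>\<^sup>+\<omega>. weight (X s \<omega>) ^ m \<partial>P x) \<le> ennreal B"
    using weight_power_bounded[OF x t] by metis
  obtain C where C: "0 \<le> C" "\<And>y. \<bar>u y\<bar> \<le> C * weight y ^ m"
    using poly_space_weight_bound[OF u] by auto
  show ?thesis
    by (rule that[of "C * B"]) (rule poly_moment_bound_of_weight[OF B x _ C], auto)
qed

lemma moment_formula:
  assumes x: "x \<in> S" and t: "0 \<le> t" and u: "u \<in> poly_space UNIV m"
  shows "(LINT \<omega>|P x. u (X t \<omega>)) = u x + (LBINT s:{0..t}. (LINT \<omega>|P x. gen u (X s \<omega>)))"
proof -
  interpret prob_space "P x" by (rule prob_space_P[OF x])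
  have gu: "gen u \<in> poly_space UNIV m" by (rule gen_poly[OF u]) auto
  obtain B where B: "\<And>s. \<lbrakk>0 \<le> s; s \<le> t\<rbrakk> \<Longrightarrow> (\<integral>\<^sup>+\<omega>. ennreal \<bar>gen u (X s \<omega>)\<bar> \<partial>P x) \<le> ennreal B"
    using poly_moment_bounded[OF x t gu] by metis
  note path = expectation_path_integral[OF x continuous_on_poly_space[OF gu] t B]
  obtain C where C: "0 \<le> C" "\<And>y. \<bar>u y\<bar> \<le> C * weight y ^ m"
    using poly_space_weight_bound[OF u] by auto
  have "(LINT \<omega>|P x. u (X t \<omega>)) = u x + (LINT \<omega>|P x. (LBINT s:{0..t}. gen u (X s \<omega>)))"
  proof (cases "m = 1")
    case True
    have mart: "martingale (P x) F (dynkin_process X x u (gen u))"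
      using true_martingale[OF True _ x] u True by simp
    have "(LINT \<omega>|P x. dynkin_process X x u (gen u) t \<omega>) = (LINT \<omega>|P x. dynkin_process X x u (gen u) 0 \<omega>)"
      by (rule martingale_expectation(1)[OF finite_measure_P[OF x] subalgebra_P[OF x] mart order_refl t])
    also have "\<dots> = 0" by (rule integral_eq_zero_AE[OF dynkin_at_0[OF x]])
    finally show ?thesis
      using poly_integrable[OF u x t] path(1) by (simp add: dynkin_process_def prob_space)
  next
    case False
    have cw: "continuous_on UNIV (\<lambda>y :: real ^ 'd. weight y ^ m)" by (intro continuous_intros continuous_weight)
    have w0: "0 \<le> weight y ^ m" for y :: "real ^ 'd" using weight_ge_1[of y] by simp
    have "\<exists>c. \<forall>y r. y \<in> S \<longrightarrow> 0 \<le> r \<longrightarrow> r \<le> t \<longrightarrow> ennreal (weight y ^ m) \<le> ennreal c * (\<integral>\<^sup>+\<omega>. weight (X r \<omega>) ^ m \<partial>P y)"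
    proof (cases "m = 0")
      case True
      then show ?thesis
        using prob_space.emeasure_space_1[OF prob_space_P] by (intro exI[of _ 1]) simp
    next
      case m0: False
      have "2 \<le> m" using m0 False by simp
      from weight_power_domination[OF this t] show ?thesis by metis
    qed
    then obtain c where c: "\<And>y r. \<lbrakk>y \<in> S; 0 \<le> r; r \<le> t\<rbrakk> \<Longrightarrow> ennreal (weight y ^ m) \<le> ennreal c * (\<integral>\<^sup>+\<omega>. weight (X r \<omega>) ^ m \<partial>P y)"
      by blast
    show ?thesis
      by (rule dynkin_formula_dominated[OF x gen_dynkin[OF u] t path(2) cw w0 c weight_power_integrable[OF x t] C(1)])
        (use C(2) in auto)
  qed
  then show ?thesis using path(3) by simp
qed

text \<open>The maximum with \<open>0\<close> in the proof extends the moments to negative times, where the process is not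
  specified.\<close>

lemma moment_power_series:
  fixes q :: "nat \<Rightarrow> real ^ 'd \<Rightarrow> real"
  assumes x: "x \<in> S" and t: "0 \<le> t"
    and q: "\<And>k. q k \<in> poly_space UNIV m"
    and step: "\<And>k y. y \<in> S \<Longrightarrow> gen (q k) y = q (Suc k) y"
    and bound: "\<And>k y. y \<in> S \<Longrightarrow> \<bar>q k y\<bar> \<le> K * a ^ k * weight y ^ m" and K: "0 \<le> K" "0 \<le> a"
  shows "(\<lambda>k. t ^ k / fact k * q k x) sums (LINT \<omega>|P x. q 0 (X t \<omega>))"
proof -
  obtain B where B: "\<And>s. \<lbrakk>0 \<le> s; s \<le> t\<rbrakk> \<Longrightarrow> (\<integral>\<^sup>+\<omega>. weight (X s \<omega>) ^ m \<partial>P x) \<le> ennreal B"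
    using weight_power_bounded[OF x t] by metis
  have B0: "0 \<le> max B 0" by simp
  let ?g = "\<lambda>k s. LINT \<omega>|P x. q k (X (max 0 s) \<omega>)"
  have "(\<lambda>k. t ^ k / fact k * q k x) sums ?g 0 t"
  proof (rule iterated_integral_sums[OF t, where K="K * max B 0" and a=a])
    fix k
    interpret sigma_finite_measure "P x" by (rule sigma_finite_P[OF x])
    show "?g k \<in> borel_measurable borel"
      by (rule borel_measurable_lebesgue_integral[OF continuous_X_jointly_measurable[OF x continuous_on_poly_space[OF q]]])
    fix s assume s: "0 \<le> s" "s \<le> t"
    have "(LBINT r:{0..s}. (LINT \<omega>|P x. gen (q k) (X r \<omega>))) = (LBINT r:{0..s}. ?g (Suc k) r)"
    proof (rule set_lebesgue_integral_cong)
      show "\<forall>r. r \<in> {0..s} \<longrightarrow> (LINT \<omega>|P x. gen (q k) (X r \<omega>)) = ?g (Suc k) r"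
        using step[OF state_space] by (auto intro!: Bochner_Integration.integral_cong simp: space_P[OF x] max_absorb2)
    qed simp
    then show "?g k s = q k x + (LBINT r:{0..s}. ?g (Suc k) r)"
      using moment_formula[OF x s(1) q[of k]] s by (simp add: max_absorb2)
    have "ennreal \<bar>?g k s\<bar> \<le> (\<integral>\<^sup>+\<omega>. ennreal (norm (q k (X s \<omega>))) \<partial>P x)"
      using integral_norm_bound_ennreal[OF poly_integrable[OF q[of k] x s(1)]] s by (simp add: max_absorb2)
    also have "\<dots> \<le> ennreal (K * a ^ k * B)"
      using poly_moment_bound_of_weight[OF B[OF s] x s(1) _ bound] K by simp
    also have "\<dots> \<le> ennreal (K * max B 0 * a ^ k)"
      using K by (intro ennreal_leI) (simp add: mult_left_mono mult.assoc mult.commute[of _ "a ^ k"])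
    finally show "\<bar>?g k s\<bar> \<le> K * max B 0 * a ^ k" using K by (simp add: ennreal_le_iff)
  qed
  then show ?thesis using t by (simp add: max_absorb2)
qed

end

section \<open>The generator matrix and the Mittag-Leffler function\<close>

lemma coords_eqI:
  assumes H: "is_basis_on S V H" and eq: "\<And>y. y \<in> S \<Longrightarrow> q y = H y \<bullet> c"
  shows "coords S H q = c"
  unfolding coords_def
proof (rule the_equality)
  show "\<forall>y\<in>S. q y = H y \<bullet> c" using eq by blast
  fix c' assume "\<forall>y\<in>S. q y = H y \<bullet> c'"
  then have "\<forall>y\<in>S. H y \<bullet> (c' - c) = 0" using eq by (simp add: inner_diff_right)
  then show "c' = c" using H by (auto simp: is_basis_on_def)
qed

lemma coords_represent:
  assumes H: "is_basis_on S V H" and q: "q \<in> V" and y: "y \<in> S"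
  shows "q y = H y \<bullet> coords S H q"
proof -
  obtain c where c: "\<And>y. y \<in> S \<Longrightarrow> q y = H y \<bullet> c" using H q unfolding is_basis_on_def by blast
  show ?thesis using coords_eqI[OF H, of q c] c y by simp
qed

lemma inner_basis_in_poly_space:
  assumes "is_basis_on S (poly_space S m) H"
  shows "(\<lambda>y. H y \<bullet> c) \<in> poly_space S m"
proof -
  have "(\<lambda>y. c $ i * H y $ i) \<in> poly_space S m" for i
    using assms by (intro poly_space_scale) (auto simp: is_basis_on_def)
  then have "(\<lambda>y. \<Sum>i\<in>UNIV. c $ i * H y $ i) \<in> poly_space S m" by (intro poly_space_sum)
  then show ?thesis by (simp add: inner_vec_def mult.commute)
qed

lemma matrix_pow_scaleR: "matrix_pow (r *\<^sub>R A) k = r ^ k *\<^sub>R matrix_pow (A :: real ^ 'n ^ 'n) k"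
  by (induction k) (simp_all add: vec_eq_iff matrix_matrix_mult_def sum_distrib_left mult_ac)

lemma norm_matrix_pow_vector_le:
  fixes A :: "real ^ 'n ^ 'n"
  shows "norm (matrix_pow A k *v c) \<le> onorm ((*v) A) ^ k * norm c"
proof (induction k)
  case (Suc k)
  have "matrix_pow A (Suc k) *v c = A *v (matrix_pow A k *v c)"
    by (simp add: matrix_vector_mul_assoc)
  also have "norm \<dots> \<le> onorm ((*v) A) * norm (matrix_pow A k *v c)"
    by (rule onorm[OF matrix_vector_mul_bounded_linear])
  also have "\<dots> \<le> onorm ((*v) A) * (onorm ((*v) A) ^ k * norm c)"
    by (intro mult_left_mono Suc onorm_pos_le matrix_vector_mul_bounded_linear)
  finally show ?case by (simp add: mult.assoc)
qed simp

lemma norm_matrix_pow_le: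
  fixes A :: "real ^ 'n ^ 'n"
  shows "norm (matrix_pow A k) \<le> (real CARD('n))\<^sup>2 * onorm ((*v) A) ^ k"
proof -
  have entry: "\<bar>matrix_pow A k $ i $ j\<bar> \<le> onorm ((*v) A) ^ k" for i j
  proof -
    have "matrix_pow A k $ i $ j = (matrix_pow A k *v axis j 1) $ i"
      by (simp add: matrix_vector_mult_basis column_def)
    also have "\<bar>\<dots>\<bar> \<le> norm (matrix_pow A k *v axis j 1)" by (rule component_le_norm_cart)
    also have "\<dots> \<le> onorm ((*v) A) ^ k" using norm_matrix_pow_vector_le[of A k "axis j 1"] by simp
    finally show ?thesis .
  qed
  have "norm (matrix_pow A k) \<le> (\<Sum>i\<in>UNIV. norm (matrix_pow A k $ i))"
    unfolding norm_vec_def[of "matrix_pow A k"] by (rule L2_set_le_sum) simp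
  also have "\<dots> \<le> (\<Sum>i\<in>UNIV. \<Sum>j\<in>UNIV. \<bar>matrix_pow A k $ i $ j\<bar>)"
    by (intro sum_mono norm_le_l1_cart)
  also have "\<dots> \<le> (\<Sum>i\<in>(UNIV :: 'n set). \<Sum>j\<in>(UNIV :: 'n set). onorm ((*v) A) ^ k)"
    by (intro sum_mono entry)
  finally show ?thesis by (simp add: power2_eq_square mult.assoc)
qed

lemma (in cadlag_markov_process) constant_in_generator_domain:
  assumes u: "u \<in> poly_space UNIV 0"
  shows "u \<in> generator_domain S F P X"
proof -
  have "{e :: 'd \<Rightarrow> nat. (\<Sum>i\<in>UNIV. e i) \<le> 0} = {\<lambda>_. 0}" by auto
  then obtain c where c: "\<And>y. u y = c" using u by (auto simp: poly_space_def)
  have "generator_version S F P X u (\<lambda>_. 0)"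
    unfolding generator_version_def
  proof (intro conjI ballI)
    fix x assume x: "x \<in> S"
    show "AE \<omega> in P x. \<forall>t\<ge>0. set_integrable lborel {0..t} (\<lambda>s. 0 :: real)"
      by (simp add: set_integrable_def)
    show "local_martingale (P x) F (dynkin_process X x u (\<lambda>_. 0))"
      by (rule local_martingale_cong[OF finite_measure_P[OF x] subalgebra_P[OF x]
            local_martingale_zero[OF finite_measure_P[OF x] subalgebra_P[OF x]]])
        (simp add: dynkin_process_def c set_lebesgue_integral_def)
  qed simp
  then show ?thesis unfolding generator_domain_def c by auto
qed

text \<open>The matrix representation supplies linearity of the generator on \<open>S\<close>, since coordinates are linear.\<close>

lemma polynomial_process_of_generator:
  fixes H :: "real ^ 'd \<Rightarrow> real ^ 'n" and X :: "real \<Rightarrow> 'w \<Rightarrow> real ^ 'd"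
  assumes process: "cadlag_markov_process S \<Omega> F P X"
    and G: "extended_generator S F P X G" and poly: "m_polynomial m S F P X G"
    and H: "is_basis_on S (poly_space S m) H"
    and A: "\<And>q y. \<lbrakk>q \<in> poly_space S m; y \<in> S\<rbrakk> \<Longrightarrow> G q y = H y \<bullet> (A *v coords S H q)"
    and mart: "\<And>u y. \<lbrakk>m = 1; u \<in> poly_space S 1; y \<in> S\<rbrakk> \<Longrightarrow> martingale (P y) F (dynkin_process X y u (G u))"
  obtains gen where "polynomial_process S \<Omega> F P X m gen"
    "\<And>u y. \<lbrakk>u \<in> poly_space UNIV m; y \<in> S\<rbrakk> \<Longrightarrow> gen u y = G u y"
proof -
  interpret cadlag_markov_process S \<Omega> F P X by fact
  \<comment> \<open>Taking the least degree makes one representative of \<open>G u\<close> serve all degrees at once.\<close>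
  define gen where "gen u = (SOME v. v \<in> poly_space UNIV (LEAST k. G u \<in> poly_space S k) \<and> (\<forall>y\<in>S. v y = G u y))" for u
  have gen: "gen u \<in> poly_space UNIV k" "\<And>y. y \<in> S \<Longrightarrow> gen u y = G u y" if Gk: "G u \<in> poly_space S k" for u k
  proof -
    have "G u \<in> poly_space S (LEAST k. G u \<in> poly_space S k)" using Gk by (rule LeastI)
    then obtain v where "v \<in> poly_space UNIV (LEAST k. G u \<in> poly_space S k)" "\<And>y. y \<in> S \<Longrightarrow> G u y = v y"
      by (rule poly_space_representative) blast
    then have "\<exists>v. v \<in> poly_space UNIV (LEAST k. G u \<in> poly_space S k) \<and> (\<forall>y\<in>S. v y = G u y)" by metis
    from someI_ex[OF this] have *: "gen u \<in> poly_space UNIV (LEAST k. G u \<in> poly_space S k)" "\<forall>y\<in>S. gen u y = G u y"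
      unfolding gen_def by auto
    show "gen u \<in> poly_space UNIV k" by (rule poly_space_mono[OF *(1) Least_le]) (rule Gk)
    show "\<And>y. y \<in> S \<Longrightarrow> gen u y = G u y" using *(2) by blast
  qed
  have Gm: "G u \<in> poly_space S m" if "u \<in> poly_space S m" for u
    by (rule poly_space_cong[OF inner_basis_in_poly_space[OF H, of "A *v coords S H u"]]) (simp add: A[OF that])
  have Gk: "G u \<in> poly_space S k" if "u \<in> poly_space UNIV k" "k \<le> m" "1 \<le> k \<or> m = 0" for u k
  proof (cases "m = 0")
    case True then show ?thesis using Gm poly_space_on_subset[OF that(1)] that(2) by simp
  next
    case False
    then show ?thesis using poly poly_space_on_subset[OF that(1), of S] that by (auto simp: m_polynomial_def)
  qed
  have poly_m: "\<forall>u\<in>poly_space S m. (\<forall>x\<in>S. \<forall>t\<ge>0. integrable (P x) (\<lambda>\<omega>. u (X t \<omega>))) \<and>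
      u \<in> generator_domain S F P X" if "m \<noteq> 0"
    using bspec[OF poly[unfolded m_polynomial_def], of m] that by auto
  have dom: "u \<in> generator_domain S F P X" if u: "u \<in> poly_space UNIV m" for u
  proof (cases "m = 0")
    case True then show ?thesis using constant_in_generator_domain u by simp
  next
    case False
    then show ?thesis using poly_m poly_space_on_subset[OF u, of S] by blast
  qed
  have gen_m: "gen u \<in> poly_space UNIV m" "\<And>y. y \<in> S \<Longrightarrow> gen u y = G u y" if u: "u \<in> poly_space UNIV m" for u
    using gen[OF Gm[OF poly_space_on_subset[OF u]]] by auto
  have "polynomial_process S \<Omega> F P X m gen"
  proof unfold_locales
    show "gen u \<in> poly_space UNIV k" if "u \<in> poly_space UNIV k" "k \<le> m" "1 \<le> k \<or> m = 0" for u k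
      using gen(1)[OF Gk[OF that]] .
    show "dynkin_pair u (gen u)" if u: "u \<in> poly_space UNIV m" for u
      unfolding dynkin_pair_def
    proof (intro conjI ballI continuous_on_poly_space[OF u] continuous_on_poly_space[OF gen_m(1)[OF u]])
      fix x assume x: "x \<in> S"
      have "local_martingale (P x) F (dynkin_process X x u (G u))"
        using G dom[OF u] x by (auto simp: extended_generator_def generator_version_def)
      then show "local_martingale (P x) F (dynkin_process X x u (gen u))"
        by (rule local_martingale_cong[OF finite_measure_P[OF x] subalgebra_P[OF x]])
          (intro dynkin_process_cong x, auto simp: space_P[OF x] gen_m(2)[OF u])
    qed
    show "gen (\<lambda>y. a * u y + b * v y) y = a * gen u y + b * gen v y"
      if u: "u \<in> poly_space UNIV m" and v: "v \<in> poly_space UNIV m" and y: "y \<in> S" for u v y a b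
    proof -
      have uv: "(\<lambda>y. a * u y + b * v y) \<in> poly_space UNIV m"
        by (intro poly_space_add poly_space_scale u v)
      note S = poly_space_on_subset[OF u] poly_space_on_subset[OF v] poly_space_on_subset[OF uv]
      have "coords S H (\<lambda>y. a * u y + b * v y) = a *\<^sub>R coords S H u + b *\<^sub>R coords S H v"
        by (rule coords_eqI[OF H])
          (simp add: coords_represent[OF H S(1)] coords_represent[OF H S(2)] inner_add_right)
      then show ?thesis
        using A[OF S(1) y] A[OF S(2) y] A[OF S(3) y] gen_m(2)[OF u y] gen_m(2)[OF v y] gen_m(2)[OF uv y]
        by (simp add: matrix_vector_right_distrib matrix_vector_mult_scaleR inner_add_right)
    qed
    show "integrable (P x) (\<lambda>\<omega>. u (X t \<omega>))" if u: "u \<in> poly_space UNIV m" and x: "x \<in> S" and t: "0 \<le> t" for u x t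
    proof (cases "m = 0")
      case False
      then show ?thesis using poly_m poly_space_on_subset[OF u, of S] x t by blast
    next
      case True
      interpret prob_space "P x" by (rule prob_space_P[OF x])
      obtain C where C: "\<And>y. \<bar>u y\<bar> \<le> C * weight y ^ m"
        using poly_space_weight_bound[OF u] by auto
      show ?thesis
        by (rule integrable_const_bound[where B=C])
          (use C True continuous_X_measurable[OF x t continuous_on_poly_space[OF u]] in auto)
    qed
    show "martingale (P x) F (dynkin_process X x u (gen u))" if "m = 1" and u: "u \<in> poly_space UNIV 1" and x: "x \<in> S" for u x
    proof (rule martingale_cong[OF finite_measure_P[OF x] subalgebra_P[OF x] mart[OF that(1) poly_space_on_subset[OF u] x]])
      have um: "u \<in> poly_space UNIV m" using u that(1) by simp
      fix t :: real and \<omega> assume "0 \<le> t" "\<omega> \<in> space (P x)"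
      then show "dynkin_process X x u (G u) t \<omega> = dynkin_process X x u (gen u) t \<omega>"
        by (intro dynkin_process_cong x) (auto simp: space_P[OF x] gen_m(2)[OF um])
    qed
  qed
  then show ?thesis using gen_m(2) by (rule that)
qed

lemma mittag_leffler_matrix_sums:
  fixes A :: "real ^ 'n ^ 'n" and h c :: "real ^ 'n"
  assumes summable: "summable (\<lambda>k. (t powr (\<alpha> * real k) / Gamma (\<alpha> * real k + 1)) * onorm ((*v) A) ^ k)"
    and \<alpha>: "0 < \<alpha>" and t: "0 < t"
  shows "(\<lambda>k. t powr (\<alpha> * real k) / Gamma (\<alpha> * real k + 1) * (h \<bullet> (matrix_pow A k *v c))) sums
    (h \<bullet> (mittag_leffler_matrix \<alpha> ((t powr \<alpha>) *\<^sub>R A) *v c))"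
proof -
  let ?M = "\<lambda>k. (1 / Gamma (\<alpha> * real k + 1)) *\<^sub>R matrix_pow ((t powr \<alpha>) *\<^sub>R A) k"
  have M: "?M k = (t powr (\<alpha> * real k) / Gamma (\<alpha> * real k + 1)) *\<^sub>R matrix_pow A k" for k
    using t by (simp add: matrix_pow_scaleR powr_powr[symmetric] powr_realpow)
  have G: "0 < Gamma (\<alpha> * real k + 1)" for k
    using \<alpha> by (intro Gamma_real_pos) (auto intro: add_nonneg_pos)
  have "summable ?M"
  proof (rule summable_comparison_test')
    show "summable (\<lambda>k. (real CARD('n))\<^sup>2 * (t powr (\<alpha> * real k) / Gamma (\<alpha> * real k + 1) * onorm ((*v) A) ^ k))"
      by (rule summable_mult[OF summable])
    fix k
    have "norm (?M k) = t powr (\<alpha> * real k) / Gamma (\<alpha> * real k + 1) * norm (matrix_pow A k)"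
      unfolding M using G[of k] by simp
    also have "\<dots> \<le> t powr (\<alpha> * real k) / Gamma (\<alpha> * real k + 1) * ((real CARD('n))\<^sup>2 * onorm ((*v) A) ^ k)"
      using G[of k] by (intro mult_left_mono norm_matrix_pow_le) auto
    finally show "norm (?M k) \<le> (real CARD('n))\<^sup>2 * (t powr (\<alpha> * real k) / Gamma (\<alpha> * real k + 1) * onorm ((*v) A) ^ k)"
      by (simp only: mult_ac)
  qed
  then have "?M sums mittag_leffler_matrix \<alpha> ((t powr \<alpha>) *\<^sub>R A)"
    unfolding mittag_leffler_matrix_def by (rule summable_sums)
  moreover have "bounded_linear (\<lambda>B :: real ^ 'n ^ 'n. h \<bullet> (B *v c))"
    unfolding linear_conv_bounded_linear[symmetric]
    by (rule linearI) (simp_all add: matrix_vector_mult_add_rdistrib inner_add_right flip: scaleR_matrix_vector_assoc)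
  ultimately have "(\<lambda>k. h \<bullet> (?M k *v c)) sums (h \<bullet> (mittag_leffler_matrix \<alpha> ((t powr \<alpha>) *\<^sub>R A) *v c))"
    by (rule bounded_linear.sums[rotated])
  then show ?thesis unfolding M by (simp flip: scaleR_matrix_vector_assoc)
qed

theorem theorem18:
  fixes S :: "(real ^ 'd) set"
    and \<Omega> :: "'w measure"
    and F :: "real \<Rightarrow> 'w measure"
    and P :: "real ^ 'd \<Rightarrow> 'w measure"
    and X :: "real \<Rightarrow> 'w \<Rightarrow> real ^ 'd"
    and \<sigma> :: "real \<Rightarrow> 'w \<Rightarrow> real"
    and G :: "(real ^ 'd \<Rightarrow> real) \<Rightarrow> (real ^ 'd \<Rightarrow> real)"
    and H :: "real ^ 'd \<Rightarrow> real ^ 'n"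
    and A :: "real ^ 'n ^ 'n"
    and \<alpha> t :: real and m :: nat and x :: "real ^ 'd" and p :: "real ^ 'd \<Rightarrow> real"
  assumes "closed S" and "interior S \<noteq> {}"
    and "0 < \<alpha>" and "\<alpha> < 1"
    and "cadlag_markov_process S \<Omega> F P X"
    and "extended_generator S F P X G"
    and "m_polynomial m S F P X G"
    and "\<And>y. y \<in> S \<Longrightarrow> stable_subordinator \<alpha> (P y) \<sigma>"
    and "\<And>y. y \<in> S \<Longrightarrow> independent_processes (P y) X \<sigma>"
    and "is_basis_on S (poly_space S m) H"
    and "\<And>q y. \<lbrakk>q \<in> poly_space S m; y \<in> S\<rbrakk> \<Longrightarrow> G q y = H y \<bullet> (A *v coords S H q)"
    and "p \<in> poly_space S m" and "x \<in> S" and "t > 0"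
    and true_martingale_if_m_eq_1:
      "\<And>u y. \<lbrakk>m = 1; u \<in> poly_space S 1; y \<in> S\<rbrakk> \<Longrightarrow> martingale (P y) F (dynkin_process X y u (G u))"
    and integrable_if_m_odd:
      "odd m \<Longrightarrow> integrable (P x) (\<lambda>\<omega>. p (X (inverse_process \<sigma> t \<omega>) \<omega>))"
  shows "integrable (P x) (\<lambda>\<omega>. p (X (inverse_process \<sigma> t \<omega>) \<omega>)) \<and>
    (LINT \<omega>|P x. p (X (inverse_process \<sigma> t \<omega>) \<omega>)) =
      H x \<bullet> (mittag_leffler_matrix \<alpha> ((t powr \<alpha>) *\<^sub>R A) *v coords S H p)"
proof -
  note basis = assms(10) and matrix = assms(11) and p = assms(12) and x = assms(13) and t = assms(14)
  obtain gen where process: "polynomial_process S \<Omega> F P X m gen"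
    and gen: "\<And>u y. \<lbrakk>u \<in> poly_space UNIV m; y \<in> S\<rbrakk> \<Longrightarrow> gen u y = G u y"
    using polynomial_process_of_generator[OF assms(5,6,7) basis matrix true_martingale_if_m_eq_1] by blast
  interpret polynomial_process S \<Omega> F P X m gen by (rule process)
  interpret clock: stable_clock "P x" \<sigma> \<alpha>
    using prob_space_P[OF x] assms(3,8) x by (simp add: stable_clock_def stable_clock_axioms_def)
  let ?L = "inverse_process \<sigma> t"
  define c where "c = coords S H p"
  \<comment> \<open>Adding \<open>1\<close> keeps the geometric ratio positive when \<open>A = 0\<close>.\<close>
  define a where "a = onorm ((*v) A) + 1"
  have onorm0: "0 \<le> onorm ((*v) A)" by (intro onorm_pos_le matrix_vector_mul_bounded_linear)
  then have a: "0 < a" "onorm ((*v) A) \<le> a" by (simp_all add: a_def)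
  \<comment> \<open>\<open>q k\<close> is the \<open>k\<close>-th iterate of the generator on \<open>p\<close>, as a polynomial on the whole space.\<close>
  have "\<exists>q. q \<in> poly_space UNIV m \<and> (\<forall>y\<in>S. H y \<bullet> (matrix_pow A k *v c) = q y)" for k
    using poly_space_representative[OF inner_basis_in_poly_space[OF basis, of "matrix_pow A k *v c"]] by metis
  then obtain q where q: "\<And>k. q k \<in> poly_space UNIV m"
    and qH: "\<And>k y. y \<in> S \<Longrightarrow> H y \<bullet> (matrix_pow A k *v c) = q k y" by metis
  have pq: "p y = q 0 y" if "y \<in> S" for y
    using coords_represent[OF basis p that] qH[OF that, of 0] by (simp add: c_def)
  have step: "gen (q k) y = q (Suc k) y" if y: "y \<in> S" for k y
  proof -
    have "coords S H (q k) = matrix_pow A k *v c" by (rule coords_eqI[OF basis]) (simp add: qH)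
    then have "gen (q k) y = H y \<bullet> (A *v (matrix_pow A k *v c))"
      using gen[OF q y, of k] matrix[OF poly_space_on_subset[OF q] y, of k] by simp
    then show ?thesis using qH[OF y, of "Suc k"] by (simp add: matrix_vector_mul_assoc)
  qed
  have "\<exists>C\<ge>0. \<forall>y\<in>S. \<bar>H y $ i\<bar> \<le> C * weight y ^ m" for i
    using poly_space_weight_bound[of "\<lambda>y. H y $ i" S m] basis unfolding is_basis_on_def by metis
  then obtain C where C: "\<And>i. 0 \<le> C i" "\<And>i y. y \<in> S \<Longrightarrow> \<bar>H y $ i\<bar> \<le> C i * weight y ^ m" by metis
  let ?C = "\<Sum>i\<in>UNIV. C i"
  have C0: "0 \<le> ?C" by (intro sum_nonneg C)
  have bound: "\<bar>q k y\<bar> \<le> ?C * norm c * a ^ k * weight y ^ m" if y: "y \<in> S" for k y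
  proof -
    have "\<bar>q k y\<bar> \<le> norm (H y) * norm (matrix_pow A k *v c)"
      unfolding qH[OF y, symmetric] by (rule Cauchy_Schwarz_ineq2)
    also have "\<dots> \<le> (?C * weight y ^ m) * (a ^ k * norm c)"
    proof (intro mult_mono)
      have "norm (H y) \<le> (\<Sum>i\<in>UNIV. \<bar>H y $ i\<bar>)" by (rule norm_le_l1_cart)
      also have "\<dots> \<le> (\<Sum>i\<in>UNIV. C i * weight y ^ m)" by (intro sum_mono C y)
      finally show "norm (H y) \<le> ?C * weight y ^ m" by (simp add: sum_distrib_right)
      have "norm (matrix_pow A k *v c) \<le> onorm ((*v) A) ^ k * norm c" by (rule norm_matrix_pow_vector_le)
      also have "\<dots> \<le> a ^ k * norm c" using onorm0 a by (intro mult_right_mono power_mono) auto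
      finally show "norm (matrix_pow A k *v c) \<le> a ^ k * norm c" .
      show "0 \<le> ?C * weight y ^ m" using C0 weight_ge_1[of y] by (intro mult_nonneg_nonneg) auto
    qed auto
    finally show ?thesis by (simp only: mult_ac)
  qed
  have L0: "0 \<le> ?L \<omega>" for \<omega> by (rule inverse_process_nonneg)
  have pX: "p (X (?L \<omega>) \<omega>) = q 0 (X (?L \<omega>) \<omega>)" if "\<omega> \<in> space (P x)" for \<omega>
    using pq[OF state_space[OF L0]] that by (simp add: space_P[OF x])
  have mono: "\<forall>\<omega>\<in>space (P x). mono_on {0..} (\<lambda>t. \<sigma> t \<omega>)"
    using assms(8)[OF x] by (simp add: stable_subordinator_def)
  note change = independent_time_change[OF x assms(9)[OF x] mono continuous_on_poly_space[OF q[of 0]], of t]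
  \<comment> \<open>In even degree the moments grow at most exponentially, and the clock has exponential moments. The rate
    is raised to \<open>B + 1\<close> to be positive.\<close>
  have int: "integrable (P x) (\<lambda>\<omega>. q 0 (X (?L \<omega>) \<omega>))"
  proof (cases "even m")
    case False
    show ?thesis
      using integrable_if_m_odd[OF False] pX by (simp cong: Bochner_Integration.integrable_cong)
  next
    case True
    obtain B where B: "0 \<le> B"
      "\<And>x t. \<lbrakk>x \<in> S; 0 \<le> t\<rbrakk> \<Longrightarrow> (\<integral>\<^sup>+\<omega>. even_weight m (X t \<omega>) \<partial>P x) \<le> ennreal (even_weight m x * exp (B * t))"
      using even_weight_growth[OF True order_refl] by (metis less_one linorder_not_le)
    let ?K = "?C * norm c * (real CARD('d) + 1) ^ m"
    have K: "0 \<le> ?K" using C0 by simp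
    have f0: "0 \<le> even_weight m y" for y :: "real ^ 'd" using even_weight_ge_1[OF True, of y] by linarith
    have q0: "\<bar>q 0 y\<bar> \<le> ?K * even_weight m y" if "y \<in> S" for y
    proof -
      have "\<bar>q 0 y\<bar> \<le> ?C * norm c * weight y ^ m" using bound[OF that, of 0] by simp
      also have "\<dots> \<le> ?C * norm c * ((real CARD('d) + 1) ^ m * even_weight m y)"
        using C0 by (intro mult_left_mono weight_power_le_even_weight[OF True]) auto
      finally show ?thesis by (simp only: mult_ac)
    qed
    have inner: "(\<integral>\<^sup>+\<omega>'. ennreal \<bar>q 0 (X s \<omega>')\<bar> \<partial>P x) \<le> ennreal (?K * even_weight m x * exp ((B + 1) * s))" if s: "0 \<le> s" for s
    proof -
      have [measurable]: "(\<lambda>\<omega>. even_weight m (X s \<omega>)) \<in> borel_measurable (P x)"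
        by (rule continuous_X_measurable[OF x s continuous_on_poly_space[OF poly_space_even_weight[OF order_refl]]])
      have "(\<integral>\<^sup>+\<omega>'. ennreal \<bar>q 0 (X s \<omega>')\<bar> \<partial>P x) \<le> (\<integral>\<^sup>+\<omega>'. ennreal ?K * ennreal (even_weight m (X s \<omega>')) \<partial>P x)"
        using q0[OF state_space[OF s]] K
        by (intro nn_integral_mono) (simp add: space_P[OF x] ennreal_mult'[symmetric] ennreal_leI)
      also have "\<dots> = ennreal ?K * (\<integral>\<^sup>+\<omega>'. even_weight m (X s \<omega>') \<partial>P x)"
        by (rule nn_integral_cmult) measurable
      also have "\<dots> \<le> ennreal ?K * ennreal (even_weight m x * exp (B * s))"
        by (intro mult_left_mono B(2)[OF x s]) simp
      also have "\<dots> = ennreal (?K * (even_weight m x * exp (B * s)))" using K by (simp add: ennreal_mult')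
      also have "\<dots> \<le> ennreal (?K * (even_weight m x * exp ((B + 1) * s)))"
        using K f0 s by (intro ennreal_leI mult_left_mono) (auto simp: distrib_right)
      finally show ?thesis by (simp only: mult.assoc)
    qed
    show ?thesis
    proof (rule integrableI_bounded)
      show "(\<lambda>\<omega>. q 0 (X (?L \<omega>) \<omega>)) \<in> borel_measurable (P x)" by (rule change(4))
      have "(\<integral>\<^sup>+\<omega>. ennreal (norm (q 0 (X (?L \<omega>) \<omega>))) \<partial>P x) = (\<integral>\<^sup>+\<omega>. (\<integral>\<^sup>+\<omega>'. ennreal \<bar>q 0 (X (?L \<omega>) \<omega>')\<bar> \<partial>P x) \<partial>P x)"
        unfolding real_norm_def by (rule change(2))
      also have "\<dots> \<le> (\<integral>\<^sup>+\<omega>. ennreal (?K * even_weight m x * exp ((B + 1) * ?L \<omega>)) \<partial>P x)"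
        by (intro nn_integral_mono inner L0)
      also have "\<dots> = ennreal (LINT \<omega>|P x. ?K * even_weight m x * exp ((B + 1) * ?L \<omega>))"
        using B(1) K f0[of x] by (intro nn_integral_eq_integral integrable_mult_right clock.integrable_exp_clock AE_I2) auto
      also have "\<dots> < \<infinity>" by simp
      finally show "(\<integral>\<^sup>+\<omega>. ennreal (norm (q 0 (X (?L \<omega>) \<omega>))) \<partial>P x) < \<infinity>" .
    qed
  qed
  have series: "(\<lambda>k. s ^ k / fact k * q k x) sums (LINT \<omega>|P x. q 0 (X s \<omega>))" if "0 \<le> s" for s
    by (rule moment_power_series[OF x that q step bound]) (use C0 a in auto)
  have "(\<lambda>k. t powr (\<alpha> * real k) / Gamma (\<alpha> * real k + 1) * q k x) sums
      (LINT \<omega>|P x. (LINT \<omega>'|P x. q 0 (X (?L \<omega>) \<omega>')))"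
    by (rule clock.expectation_clock_power_series[OF t a(1), where K="?C * norm c * weight x ^ m"])
      (use bound[OF x] series in \<open>auto simp: mult_ac\<close>)
  then have lhs: "(\<lambda>k. t powr (\<alpha> * real k) / Gamma (\<alpha> * real k + 1) * q k x) sums (LINT \<omega>|P x. q 0 (X (?L \<omega>) \<omega>))"
    using change(1)[OF int] by simp
  have "(\<lambda>k. s ^ k / fact k * onorm ((*v) A) ^ k) sums exp (s * onorm ((*v) A))" for s
    using exp_converges[of "s * onorm ((*v) A)"] by (simp add: power_mult_distrib field_simps)
  then have "(\<lambda>k. t powr (\<alpha> * real k) / Gamma (\<alpha> * real k + 1) * onorm ((*v) A) ^ k) sums
      (LINT \<omega>|P x. exp (?L \<omega> * onorm ((*v) A)))"
    using onorm0 a by (intro clock.expectation_clock_power_series[OF t a(1), where K=1]) (auto intro: power_mono)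
  from mittag_leffler_matrix_sums[OF sums_summable[OF this] assms(3) t, of "H x" c]
  have "(\<lambda>k. t powr (\<alpha> * real k) / Gamma (\<alpha> * real k + 1) * q k x) sums
      (H x \<bullet> (mittag_leffler_matrix \<alpha> ((t powr \<alpha>) *\<^sub>R A) *v c))"
    unfolding qH[OF x] .
  then have "(LINT \<omega>|P x. q 0 (X (?L \<omega>) \<omega>)) = H x \<bullet> (mittag_leffler_matrix \<alpha> ((t powr \<alpha>) *\<^sub>R A) *v c)"
    using lhs sums_unique2 by blast
  then show ?thesis
    using int pX unfolding c_def[symmetric]
    by (simp cong: Bochner_Integration.integrable_cong Bochner_Integration.integral_cong)
qed

end
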